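(* Assume that the period lattice $\mathcal{L}_f$ is rectangular and that $N$ is odd. Let $m=q_1\cdots q_{r(m)}$ be a product of $r(m)\ge1$ distinct odd primes with $\gcd(m,N)=1$, and put $M=4m$. (i) If $q_i\in\mathcal{S}_0\cup\mathcal{S}_1\cup\mathcal{S}_2$ for all $i$, then $$v_2\left(\frac{L(f,\chi_M,1)}{\Omega_f^{\mathrm{sgn}(\chi_M)}}\right)\ge \mathfrak{w}_m r(m)+\min\left\{-1+\delta_{\mathfrak{v}_m,0},\ -1+\delta_{\mathfrak{v}_m,0}+v_2\left(\frac{L(f,1)}{\Omega_f^+}\right),\ v_2\left(\frac{L(f,\chi_4,1)}{\Omega_f^-}\right)+\delta_{\mathfrak{v}_m,2}\right\}.$$ (ii) If $q_i\in\mathcal{S}_0^+\cup\mathcal{S}_1^+\cup\mathcal{S}_2^+$ for all $i$, then $$v_2\left(\frac{L(f,\chi_M,1)}{\Omega_f^{\mathrm{sgn}(\chi_M)}}\right)\ge \mathfrak{w}_m r(m)+\min\left\{\delta_{\mathfrak{v}_m,0},\ v_2\left(\frac{L(f,\chi_4,1)}{\Omega_f^-}\right)+\delta_{\mathfrak{v}_m,2}\right\},$$ and if $v_2(L(f,\chi_4,1)/\Omega_f^-)=0$ and $q_i\in\mathcal{S}_0^+$ for all $i$, equality holds.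
   Context: Let $f=\sum_{n\ge1}a_nq^n\in S_2(\Gamma_0(N))^{\mathrm{new}}$ be a normalized Hecke eigenform of weight 2 with all $a_n\in\mathbb{Q}$. Let $E$ be the optimal elliptic curve over $\mathbb{Q}$ attached to $f$, with modular parametrization $\Phi:X_0(N)\to E$ and Néron differential $\omega_E$ of a global minimal model; assume the Manin constant is $1$, i.e. $f(q)\,dq/q=\Phi^*\omega_E$. Then the period lattice $\mathcal{L}_f=\{\int_\gamma f(q)\,dq/q:\gamma\in H_1(X_0(N)(\mathbb{C}),\mathbb{Z})\}$ equals that of $\omega_E$, and there are reals $\Omega_f^{\pm}>0$ with either $\mathcal{L}_f=\Omega_f^+\mathbb{Z}+i\Omega_f^-\mathbb{Z}$ (rectangular) or $\mathcal{L}_f=\Omega_f^+\mathbb{Z}+\frac{\Omega_f^++i\Omega_f^-}{2}\mathbb{Z}$ (non-rectangular). For odd squarefree $d$, $\chi_d$ is the primitive quadratic character of conductor $d$ (product of Legendre symbols), $\chi_4$ is the nontrivial character mod 4, and $\chi_{4d}=\chi_4\chi_d$ is the primitive quadratic character of conductor $4d$; $\mathrm{sgn}(\chi)=\chi(-1)$. $L(f,\chi,s)$ is the analytic continuation of $\sum_n\chi(n)a_nn^{-s}$; the central ratios used are algebraic. $v_2$ is a 2-adic valuation on $\overline{\mathbb{Q}}$ with $v_2(2)=1$, $v_2(0)=+\infty$. For an integer $i$, $\mathcal{S}_i^{\pm}$ is the set of odd primes $q\nmid N$ with $\chi_q(-1)=\pm1$ and $v_2(a_q-2)=i$; $\mathcal{S}_i=\mathcal{S}_i^+\cup\mathcal{S}_i^-$.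 $\mathfrak{v}_m=\min_{q\mid m\text{ prime}}v_2(a_q-2)$; $\mathfrak{w}_m=0$ if $\mathfrak{v}_m=0$ and $1$ otherwise. $\delta_{i,j}$ is the Kronecker delta. *)

theory Defs
  imports
    "HOL-Complex_Analysis.Complex_Analysis"
    "HOL-Number_Theory.Number_Theory"
    "HOL-Library.Extended_Real"
begin

section \<open>Weight 2 cusp forms on Gamma0(N)\<close>

definition upper_half_plane :: "complex set" where
  "upper_half_plane = {z. Im z > 0}"

text \<open>The quadruple \<open>(a, b, c, d)\<close> stands for the matrix with rows \<open>(a, b)\<close> and \<open>(c, d)\<close>.\<close>

type_synonym mat2 = "int \<times> int \<times> int \<times> int"

definition SL2Z :: "mat2 set" where
  "SL2Z = {(a, b, c, d). a * d - b * c = 1}"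

definition Gamma0 :: "nat \<Rightarrow> mat2 set" where
  "Gamma0 N = {(a, b, c, d). (a, b, c, d) \<in> SL2Z \<and> int N dvd c}"

definition mat2_act :: "mat2 \<Rightarrow> complex \<Rightarrow> complex" where
  "mat2_act \<gamma> z =
     (case \<gamma> of (a, b, c, d) \<Rightarrow> (of_int a * z + of_int b) / (of_int c * z + of_int d))"

definition aut_factor :: "mat2 \<Rightarrow> complex \<Rightarrow> complex" where
  "aut_factor \<gamma> z = (case \<gamma> of (a, b, c, d) \<Rightarrow> of_int c * z + of_int d)"

definition slash2 :: "(complex \<Rightarrow> complex) \<Rightarrow> mat2 \<Rightarrow> complex \<Rightarrow> complex" where
  "slash2 f \<gamma> z = f (mat2_act \<gamma> z) / (aut_factor \<gamma> z)\<^sup>2"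

text \<open>Vanishing at all cusps is expressed at infinity for all \<open>SL2Z\<close>-translates of \<open>f\<close>.
  Only the values of \<open>f\<close> on the upper half plane matter.\<close>

definition cusp_form2 :: "nat \<Rightarrow> (complex \<Rightarrow> complex) \<Rightarrow> bool" where
  "cusp_form2 N f \<longleftrightarrow>
     f holomorphic_on upper_half_plane \<and>
     (\<forall>\<gamma>\<in>Gamma0 N. \<forall>z\<in>upper_half_plane. slash2 f \<gamma> z = f z) \<and>
     (\<forall>\<gamma>\<in>SL2Z. (slash2 f \<gamma> \<longlongrightarrow> 0) (filtercomap Im at_top))"

text \<open>The Ford fundamental domain of \<open>Gamma0 N\<close> (with its boundary, a null set).\<close>

definition ford_domain :: "nat \<Rightarrow> complex set" where
  "ford_domain N =
     {z \<in> upper_half_plane. \<bar>Re z\<bar> \<le> 1 / 2 \<and>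
        (\<forall>(a, b, c, d)\<in>Gamma0 N. c \<noteq> 0 \<longrightarrow> 1 \<le> cmod (of_int c * z + of_int d))}"

text \<open>In weight \<open>k\<close> the integrand is \<open>f(z) cnj(g(z)) y^k dx dy / y^2\<close>; for \<open>k = 2\<close> the
  powers of \<open>y\<close> cancel.\<close>

definition petersson2 :: "nat \<Rightarrow> (complex \<Rightarrow> complex) \<Rightarrow> (complex \<Rightarrow> complex) \<Rightarrow> complex" where
  "petersson2 N f g = set_lebesgue_integral lborel (ford_domain N) (\<lambda>z. f z * cnj (g z))"

text \<open>The new subspace: the orthogonal complement of all \<open>g(dz)\<close> with \<open>g\<close> a cusp form of
  proper divisor level \<open>M\<close> and \<open>d\<close> dividing \<open>N / M\<close>.\<close>

definition new_cusp_form2 :: "nat \<Rightarrow> (complex \<Rightarrow> complex) \<Rightarrow> bool" where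
  "new_cusp_form2 N f \<longleftrightarrow>
     cusp_form2 N f \<and>
     (\<forall>M d g. M * d dvd N \<and> M < N \<and> cusp_form2 M g \<longrightarrow>
        petersson2 N f (\<lambda>z. g (of_nat d * z)) = 0)"

definition hecke_op2 :: "nat \<Rightarrow> nat \<Rightarrow> (complex \<Rightarrow> complex) \<Rightarrow> complex \<Rightarrow> complex" where
  "hecke_op2 N n f z =
     of_nat n * (\<Sum>d | d dvd n \<and> coprime (n div d) N.
        (\<Sum>b<d. f ((of_nat (n div d) * z + of_nat b) / of_nat d)) / of_nat d ^ 2)"

definition hecke_eigenform2 :: "nat \<Rightarrow> (complex \<Rightarrow> complex) \<Rightarrow> bool" where
  "hecke_eigenform2 N f \<longleftrightarrow>
     (\<forall>n\<ge>1. \<exists>c. \<forall>z\<in>upper_half_plane. hecke_op2 N n f z = c * f z)"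

definition q_expansion :: "(complex \<Rightarrow> complex) \<Rightarrow> (nat \<Rightarrow> complex) \<Rightarrow> bool" where
  "q_expansion f a \<longleftrightarrow>
     a 0 = 0 \<and>
     (\<forall>z\<in>upper_half_plane. (\<lambda>n. a n * exp (2 * of_real pi * \<i> * z) ^ n) sums f z)"


section \<open>The period lattice\<close>

text \<open>With \<open>q = exp(2 pi i z)\<close> the differential \<open>f(q) dq/q\<close> is \<open>2 pi i f(z) dz\<close>.  Closed paths
  on \<open>X_0(N)\<close> that avoid the cusps and the elliptic points lift to paths in the upper half plane
  whose end points differ by an element of \<open>Gamma0 N\<close>, and such paths represent all of
  \<open>H_1(X_0(N), Z)\<close>.\<close>

definition period_lattice :: "nat \<Rightarrow> (complex \<Rightarrow> complex) \<Rightarrow> complex set" where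
  "period_lattice N f =
     {contour_integral p (\<lambda>z. 2 * of_real pi * \<i> * f z) | p.
        valid_path p \<and> path_image p \<subseteq> upper_half_plane \<and>
        (\<exists>\<gamma>\<in>Gamma0 N. pathfinish p = mat2_act \<gamma> (pathstart p))}"

definition rectangular_lattice :: "real \<Rightarrow> real \<Rightarrow> complex set" where
  "rectangular_lattice \<Omega>p \<Omega>m =
     {of_int j * of_real \<Omega>p + of_int k * (\<i> * of_real \<Omega>m) | j k. True}"


section \<open>Elliptic curves over the rationals\<close>

datatype weierstrass =
  Weierstrass (wa1: rat) (wa2: rat) (wa3: rat) (wa4: rat) (wa6: rat)

definition w_discriminant :: "weierstrass \<Rightarrow> rat" where
  "w_discriminant E =
    (let b2 = (wa1 E)^2 + 4 * wa2 E;
         b4 = 2 * wa4 E + wa1 E * wa3 E;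
         b6 = (wa3 E)^2 + 4 * wa6 E;
         b8 = (wa1 E)^2 * wa6 E + 4 * wa2 E * wa6 E - wa1 E * wa3 E * wa4 E
                + wa2 E * (wa3 E)^2 - (wa4 E)^2
     in - (b2^2 * b8) - 8 * b4^3 - 27 * b6^2 + 9 * b2 * b4 * b6)"

definition elliptic_curve :: "weierstrass \<Rightarrow> bool" where
  "elliptic_curve E \<longleftrightarrow> w_discriminant E \<noteq> 0"

definition w_integral :: "weierstrass \<Rightarrow> bool" where
  "w_integral E \<longleftrightarrow> {wa1 E, wa2 E, wa3 E, wa4 E, wa6 E} \<subseteq> \<int>"

text \<open>Substitution \<open>x = u^2 x' + r\<close>, \<open>y = u^3 y' + u^2 s x' + t\<close>.\<close>

definition w_isomorphic :: "weierstrass \<Rightarrow> weierstrass \<Rightarrow> bool" where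
  "w_isomorphic E E' \<longleftrightarrow>
     (\<exists>u r s t :: rat. u \<noteq> 0 \<and>
        u * wa1 E' = wa1 E + 2 * s \<and>
        u^2 * wa2 E' = wa2 E - s * wa1 E + 3 * r - s^2 \<and>
        u^3 * wa3 E' = wa3 E + r * wa1 E + 2 * t \<and>
        u^4 * wa4 E' = wa4 E - s * wa3 E + 2 * r * wa2 E - (t + r * s) * wa1 E
                         + 3 * r^2 - 2 * s * t \<and>
        u^6 * wa6 E' = wa6 E + r * wa4 E + r^2 * wa2 E + r^3 - t * wa3 E - t^2 - r * t * wa1 E)"

definition global_minimal_model :: "weierstrass \<Rightarrow> bool" where
  "global_minimal_model E \<longleftrightarrow>
     elliptic_curve E \<and> w_integral E \<and>
     (\<forall>E'. w_integral E' \<and> w_isomorphic E E' \<longrightarrow> \<bar>w_discriminant E\<bar> \<le> \<bar>w_discriminant E'\<bar>)"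


section \<open>Modular parametrizations\<close>

text \<open>Elements of the function field of \<open>X_0(N)\<close> over the complex numbers.  All cusp widths divide
  \<open>N\<close>, so \<open>exp(2 pi i z / N)\<close> can be used as a parameter at every cusp.  Nicely meromorphic
  functions have the value 0 at their poles.\<close>

definition modular_function :: "nat \<Rightarrow> (complex \<Rightarrow> complex) \<Rightarrow> bool" where
  "modular_function N X \<longleftrightarrow>
     X nicely_meromorphic_on upper_half_plane \<and>
     (\<forall>\<gamma>\<in>Gamma0 N. \<forall>z\<in>upper_half_plane. X (mat2_act \<gamma> z) = X z) \<and>
     (\<forall>\<gamma>\<in>SL2Z. \<exists>G F. G has_laurent_expansion F \<and>
        (\<forall>\<^sub>F z in filtercomap Im at_top.
           X (mat2_act \<gamma> z) = G (exp (2 * of_real pi * \<i> * z / of_nat N))))"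

definition laurent_q_expansion :: "(complex \<Rightarrow> complex) \<Rightarrow> complex fls \<Rightarrow> bool" where
  "laurent_q_expansion X F \<longleftrightarrow>
     (\<exists>G. G has_laurent_expansion F \<and>
        (\<forall>\<^sub>F z in filtercomap Im at_top. X z = G (exp (2 * of_real pi * \<i> * z))))"

text \<open>Membership in the function field of the canonical model of \<open>X_0(N)\<close> over the rationals
  means that the q-expansion at infinity has rational coefficients.\<close>

definition rational_modular_function :: "nat \<Rightarrow> (complex \<Rightarrow> complex) \<Rightarrow> bool" where
  "rational_modular_function N X \<longleftrightarrow>
     modular_function N X \<and> (\<exists>F. laurent_q_expansion X F \<and> (\<forall>n. fls_nth F n \<in> \<rat>))"

text \<open>A nonconstant morphism \<open>X_0(N) \<rightarrow> E\<close> over the rationals, given by the pullbacks \<open>X\<close>, \<open>Y\<close> of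
  the Weierstrass coordinates.  The last conjunct says that the cusp infinity goes to the origin.\<close>

definition modular_param ::
    "nat \<Rightarrow> weierstrass \<Rightarrow> (complex \<Rightarrow> complex) \<Rightarrow> (complex \<Rightarrow> complex) \<Rightarrow> bool" where
  "modular_param N E X Y \<longleftrightarrow>
     rational_modular_function N X \<and> rational_modular_function N Y \<and>
     (\<forall>z\<in>upper_half_plane. \<not> is_pole X z \<longrightarrow>
        (Y z)^2 + of_rat (wa1 E) * X z * Y z + of_rat (wa3 E) * Y z =
        (X z)^3 + of_rat (wa2 E) * (X z)^2 + of_rat (wa4 E) * X z + of_rat (wa6 E)) \<and>
     (\<exists>F. laurent_q_expansion X F \<and> fls_subdegree F < 0)"

text \<open>The image of \<open>z\<close> on the curve; \<open>None\<close> is the point at infinity.\<close>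

definition param_point ::
    "(complex \<Rightarrow> complex) \<Rightarrow> (complex \<Rightarrow> complex) \<Rightarrow> complex \<Rightarrow> (complex \<times> complex) option" where
  "param_point X Y z = (if is_pole X z then None else Some (X z, Y z))"

text \<open>The pullback of \<open>dx / (2 y + a1 x + a3)\<close> equals \<open>c f(q) dq/q\<close>.\<close>

definition pullback_differential ::
    "weierstrass \<Rightarrow> (complex \<Rightarrow> complex) \<Rightarrow> (complex \<Rightarrow> complex) \<Rightarrow> complex \<Rightarrow> (complex \<Rightarrow> complex) \<Rightarrow> bool"
  where
  "pullback_differential E X Y c f \<longleftrightarrow>
     (\<forall>z\<in>upper_half_plane. \<not> is_pole X z \<longrightarrow>
        deriv X z = c * (2 * of_real pi * \<i> * f z)
                      * (2 * Y z + of_rat (wa1 E) * X z + of_rat (wa3 E)))"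

definition attached_param ::
    "nat \<Rightarrow> (complex \<Rightarrow> complex) \<Rightarrow> weierstrass \<Rightarrow> (complex \<Rightarrow> complex) \<Rightarrow> (complex \<Rightarrow> complex) \<Rightarrow> bool"
  where
  "attached_param N f E X Y \<longleftrightarrow>
     elliptic_curve E \<and> modular_param N E X Y \<and>
     (\<exists>c. c \<noteq> 0 \<and> pullback_differential E X Y c f)"

text \<open>The optimal (strong Weil) quotient: every parametrization attached to \<open>f\<close> factors through it.
  The parametrization being surjective, a factorization on points is automatically an isogeny.\<close>

definition optimal_param ::
    "nat \<Rightarrow> (complex \<Rightarrow> complex) \<Rightarrow> weierstrass \<Rightarrow> (complex \<Rightarrow> complex) \<Rightarrow> (complex \<Rightarrow> complex) \<Rightarrow> bool"
  where
  "optimal_param N f E X Y \<longleftrightarrow>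
     attached_param N f E X Y \<and>
     (\<forall>E' X' Y'. attached_param N f E' X' Y' \<longrightarrow>
        (\<exists>\<psi>. \<forall>z\<in>upper_half_plane. param_point X' Y' z = \<psi> (param_point X Y z)))"

text \<open>On a global minimal model \<open>E\<close> the differential \<open>dx / (2 y + a1 x + a3)\<close> is a Neron
  differential, so Manin constant 1 means that the pullback constant is 1 (a Neron differential is
  unique up to sign, and the sign is absorbed by composing the parametrization with \<open>-1\<close>).\<close>

definition optimal_curve_manin_one ::
    "nat \<Rightarrow> (complex \<Rightarrow> complex) \<Rightarrow> weierstrass \<Rightarrow> (complex \<Rightarrow> complex) \<Rightarrow> (complex \<Rightarrow> complex) \<Rightarrow> bool"
  where
  "optimal_curve_manin_one N f E X Y \<longleftrightarrow>
     global_minimal_model E \<and> optimal_param N f E X Y \<and> pullback_differential E X Y 1 f"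


section \<open>Characters and twisted L-functions\<close>

definition chi4 :: "int \<Rightarrow> int" where
  "chi4 n = (if n mod 4 = 1 then 1 else if n mod 4 = 3 then -1 else 0)"

text \<open>The primitive quadratic character of conductor \<open>M\<close>, where \<open>M = d\<close> or \<open>M = 4 d\<close> with \<open>d\<close> odd
  and squarefree.  The index is the conductor, not the discriminant: \<open>quad_char d (-1) = -1\<close> for
  \<open>d\<close> congruent to 3 mod 4.\<close>

definition quad_char :: "nat \<Rightarrow> int \<Rightarrow> int" where
  "quad_char M n =
     (if 4 dvd M then chi4 n * (\<Prod>p\<in>prime_factors (M div 4). Legendre n (int p))
      else (\<Prod>p\<in>prime_factors M. Legendre n (int p)))"

text \<open>The entire function continuing the Dirichlet series, unique by the identity theorem.\<close>

definition twisted_L :: "(nat \<Rightarrow> complex) \<Rightarrow> (int \<Rightarrow> int) \<Rightarrow> complex \<Rightarrow> complex" where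
  "twisted_L a chr =
     (THE L. L holomorphic_on UNIV \<and>
        (\<exists>\<sigma>. \<forall>s. Re s > \<sigma> \<longrightarrow>
           (\<lambda>n. of_int (chr (int (Suc n))) * a (Suc n) * of_nat (Suc n) powr (- s)) sums L s))"

definition modular_L :: "(nat \<Rightarrow> complex) \<Rightarrow> complex \<Rightarrow> complex" where
  "modular_L a = twisted_L a (\<lambda>_. 1)"

definition period_sgn :: "(int \<Rightarrow> int) \<Rightarrow> real \<Rightarrow> real \<Rightarrow> real" where
  "period_sgn chr \<Omega>p \<Omega>m = (if chr (-1) = 1 then \<Omega>p else \<Omega>m)"


section \<open>2-adic valuations\<close>

text \<open>Only the values of \<open>v\<close> on algebraic numbers are constrained.\<close>

definition two_adic_valuation :: "(complex \<Rightarrow> ereal) \<Rightarrow> bool" where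
  "two_adic_valuation v \<longleftrightarrow>
     v 0 = \<infinity> \<and> v 2 = 1 \<and>
     (\<forall>x. algebraic x \<and> x \<noteq> 0 \<longrightarrow> (\<exists>r. v x = ereal r)) \<and>
     (\<forall>x y. algebraic x \<and> algebraic y \<longrightarrow>
        v (x * y) = v x + v y \<and> min (v x) (v y) \<le> v (x + y))"

definition S_sgn :: "nat \<Rightarrow> (nat \<Rightarrow> complex) \<Rightarrow> (complex \<Rightarrow> ereal) \<Rightarrow> int \<Rightarrow> int \<Rightarrow> nat set" where
  "S_sgn N a v \<epsilon> i =
     {q. prime q \<and> odd q \<and> \<not> q dvd N \<and> quad_char q (-1) = \<epsilon> \<and> v (a q - 2) = ereal (of_int i)}"

abbreviation S_plus :: "nat \<Rightarrow> (nat \<Rightarrow> complex) \<Rightarrow> (complex \<Rightarrow> ereal) \<Rightarrow> int \<Rightarrow> nat set" where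
  "S_plus N a v i \<equiv> S_sgn N a v 1 i"

definition S_all :: "nat \<Rightarrow> (nat \<Rightarrow> complex) \<Rightarrow> (complex \<Rightarrow> ereal) \<Rightarrow> int \<Rightarrow> nat set" where
  "S_all N a v i = S_sgn N a v 1 i \<union> S_sgn N a v (-1) i"

definition v_min :: "(nat \<Rightarrow> complex) \<Rightarrow> (complex \<Rightarrow> ereal) \<Rightarrow> nat \<Rightarrow> ereal" where
  "v_min a v m = Min ((\<lambda>q. v (a q - 2)) ` prime_factors m)"

definition w_ind :: "(nat \<Rightarrow> complex) \<Rightarrow> (complex \<Rightarrow> ereal) \<Rightarrow> nat \<Rightarrow> ereal" where
  "w_ind a v m = (if v_min a v m = 0 then 0 else 1)"

definition kdelta :: "ereal \<Rightarrow> ereal \<Rightarrow> ereal" where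
  "kdelta i j = (if i = j then 1 else 0)"

end

theory Submission
  imports Defs "HOL-Probability.Sinc_Integral" "HOL-Real_Asymp.Real_Asymp"
begin

text \<open>
  Put \<open>J r = 2 pi * integral of f (r + i y) dy over y > 0\<close>.  If the denominator of \<open>r\<close> is prime to
  \<open>N\<close>, then \<open>r\<close> is equivalent to \<open>0\<close> under \<open>Gamma0 N\<close> and \<open>J r - J 0\<close> is a period.  Birch's formula
  expresses \<open>L(f, chi, 1)\<close> for \<open>chi = chi_4 chi_d\<close> as the character sum of the values \<open>J (b / 4d)\<close>
  divided by a Gauss sum, whose square is \<open>chi(-1) 4d\<close>.

  Expanding the product of the factors \<open>chi_q(x) + chi_q(x)^2 \<in> {0, 2}\<close> over the primes \<open>q\<close> dividing
  \<open>m\<close> shows that the sum of these imprimitive character sums over all \<open>d\<close> dividing \<open>m\<close> is \<open>2^r(m)\<close>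
  times a sum of periods, because \<open>J 0\<close> cancels against \<open>chi_4\<close>.  By the Hecke relations the term of
  \<open>d\<close> is the primitive sum times the product of \<open>a_q - 2 chi_{4d}(q)\<close> over the \<open>q\<close> dividing \<open>m/d\<close>.
  Separating real and imaginary parts and isolating the term \<open>d = m\<close> gives the bounds by induction
  on the set of primes; when all \<open>q\<close> are 1 mod 4, the symmetry \<open>x \<mapsto> -x\<close> gains a further factor 2.
\<close>

section \<open>Quadratic characters and Gauss sums\<close>

text \<open>The induction controls \<open>norm_sum D\<close>, the character sum divided by
  \<open>\<Omega>p\<close> or \<open>\<i> * \<Omega>m\<close>. Because the lattice is rectangular,
  real and imaginary parts of a period are integral multiples of these separately, so characters of
  opposite parity decouple and \<open>norm_sum D\<close> is a rational integer. The square of the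
  Gauss sum is \<open>4 d\<close> up to sign with \<open>d\<close> odd, which gives the sum
  valuation 1; hence the central value has valuation one less than \<open>norm_sum\<close>, the
  source of the shifts by 1. The values \<open>a_q - 2\<close> and \<open>a_q + 2\<close> of a
  removed Euler factor differ by 4, so bounds up to 2 on their valuations agree. Equality rests on
  the residue field of Q at 2 having two elements: a sum of \<open>2^r - 1\<close> rationals of
  valuation 1 again has valuation 1.

  The analytic obstacle is that the central value is defined through an entire function continuing a
  Dirichlet series, whose existence must be shown. A cusp form decays so fast at both ends of a
  vertical line over a rational number that its Mellin integral converges everywhere, so no
  functional equation enters.\<close>

lemma Legendre_cong:
  assumes "[x = y] (mod p)"
  shows "Legendre x p = Legendre y p"
proof -
  have "[x = 0] (mod p) \<longleftrightarrow> [y = 0] (mod p)"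
    using assms cong_trans cong_sym by meson
  moreover have "QuadRes p x \<longleftrightarrow> QuadRes p y"
    unfolding QuadRes_def using assms cong_trans cong_sym by meson
  ultimately show ?thesis by (simp add: Legendre_def)
qed

lemma Legendre_values: "Legendre x p \<in> {-1, 0, 1}"
  by (auto simp: Legendre_def)

lemma Legendre_eq_0_iff: "Legendre x p = 0 \<longleftrightarrow> p dvd x"
  by (simp add: Legendre_def cong_0_iff)

lemma Legendre_1: "prime p \<Longrightarrow> Legendre 1 (int p) = 1"
  by (auto simp: Legendre_def QuadRes_def cong_0_iff intro: exI[of _ 1])

text \<open>Euler's criterion yields the identity modulo \<open>p\<close> only; both sides lie in
  {-1, 0, 1}, so they differ by at most 2, which is less than \<open>p\<close>.\<close>

lemma Legendre_mult:
  fixes p :: nat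
  assumes "prime p" "2 < p"
  shows "Legendre (x * y) (int p) = Legendre x (int p) * Legendre y (int p)"
proof -
  have "[Legendre x p * Legendre y p = x ^ ((p - 1) div 2) * y ^ ((p - 1) div 2)] (mod int p)"
    by (intro cong_mult euler_criterion assms)
  moreover have "[Legendre (x * y) p = (x * y) ^ ((p - 1) div 2)] (mod int p)"
    by (intro euler_criterion assms)
  ultimately have *: "[Legendre (x * y) p = Legendre x p * Legendre y p] (mod int p)"
    by (metis cong_sym cong_trans power_mult_distrib)
  have "Legendre (x * y) p \<in> {-1, 0, 1}" "Legendre x p * Legendre y p \<in> {-1, 0, 1}"
    using Legendre_values[of x p] Legendre_values[of y p] Legendre_values[of "x * y" p] by auto
  moreover have "int p dvd (Legendre (x * y) p - Legendre x p * Legendre y p)"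
    using * by (simp add: cong_iff_dvd_diff)
  ultimately show ?thesis
    using assms(2) zdvd_imp_le[of "int p" 2] zdvd_imp_le[of "int p" 1] by auto
qed

text \<open>If every unit were a square, squaring would be onto and hence injective on the nonzero
  residues; but 1 and \<open>p - 1\<close> are distinct with the same square.\<close>

lemma exists_nonresidue:
  fixes p :: nat
  assumes "prime p" "2 < p"
  shows "\<exists>x. Legendre x (int p) = -1"
proof (rule ccontr)
  assume no: "\<not> ?thesis"
  define S where "S = {1..<int p}"
  have surj: "S \<subseteq> (\<lambda>x. x\<^sup>2 mod int p) ` S"
  proof
    fix x assume x: "x \<in> S"
    then have "\<not> int p dvd x" by (auto simp: S_def dest: zdvd_imp_le)
    then have "Legendre x p \<noteq> 0" by (simp add: Legendre_eq_0_iff)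
    with no have "QuadRes (int p) x"
      by (metis Legendre_def)
    then obtain y where y: "[y\<^sup>2 = x] (mod int p)" unfolding QuadRes_def by auto
    define z where "z = y mod int p"
    have "z\<^sup>2 mod int p = x"
      using y x by (simp add: z_def cong_def S_def power_mod)
    moreover have "z \<noteq> 0"
      using calculation x by (auto simp: S_def)
    moreover have "0 \<le> z" "z < int p" using assms by (auto simp: z_def)
    ultimately show "x \<in> (\<lambda>x. x\<^sup>2 mod int p) ` S"
      by (auto simp: S_def intro!: image_eqI[of _ _ z])
  qed
  have fin: "finite S" by (simp add: S_def)
  have "card S \<le> card ((\<lambda>x. x\<^sup>2 mod int p) ` S)"
    using surj fin by (intro card_mono) auto
  then have "inj_on (\<lambda>x. x\<^sup>2 mod int p) S"
    using fin by (intro eq_card_imp_inj_on) (auto intro: le_antisym card_image_le)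
  moreover have "1 \<in> S" "int p - 1 \<in> S" "(1::int) \<noteq> int p - 1" using assms by (auto simp: S_def)
  moreover have "(int p - 1)\<^sup>2 mod int p = 1\<^sup>2 mod int p"
  proof -
    have "(int p - 1)\<^sup>2 = 1 + int p * (int p - 2)" by (simp add: power2_eq_square algebra_simps)
    then show ?thesis by (metis mod_mult_self2 one_power2)
  qed
  ultimately show False by (metis inj_onD)
qed

section \<open>The quadratic character modulo 4\<close>

lemma chi4_values: "chi4 n \<in> {-1, 0, 1}"
  by (auto simp: chi4_def)

lemma chi4_mult: "chi4 (x * y) = chi4 x * chi4 y"
proof -
  have m: "x * y mod 4 = (x mod 4) * (y mod 4) mod 4" by (simp add: mod_mult_eq)
  have "x mod 4 \<in> {0,1,2,3}" "y mod 4 \<in> {0,1,2,3}" by auto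
  then show ?thesis unfolding chi4_def m by auto
qed

lemma chi4_cong: "[x = y] (mod 4) \<Longrightarrow> chi4 x = chi4 y"
  by (simp add: chi4_def cong_def)

lemma chi4_eq_0_iff: "chi4 n = 0 \<longleftrightarrow> even n"
  unfolding chi4_def by presburger

lemma chi4_shift: "odd m \<Longrightarrow> chi4 (x + 2 * m) = - chi4 x"
proof -
  assume "odd m"
  then obtain k where "m = 2 * k + 1" by (elim oddE)
  then have "[x + 2 * m = x + 2] (mod 4)" by (simp add: cong_iff_dvd_diff)
  then have "chi4 (x + 2 * m) = chi4 (x + 2)" by (rule chi4_cong)
  also have "\<dots> = - chi4 x"
  proof -
    have *: "(x + 2) mod 4 = (x mod 4 + 2) mod 4" by (simp add: mod_add_left_eq)
    have "x mod 4 \<in> {0, 1, 2, 3}" by auto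
    then show ?thesis unfolding chi4_def * by auto
  qed
  finally show ?thesis .
qed

section \<open>Sums over complete residue systems\<close>

lemma sum_int_residues_affine:
  fixes M u v :: int and h :: "int \<Rightarrow> 'a :: comm_monoid_add"
  assumes M: "M > 0" and co: "coprime u M"
    and per: "\<And>x y. [x = y] (mod M) \<Longrightarrow> h x = h y"
  shows "(\<Sum>a\<in>{0..<M}. h (u * a + v)) = (\<Sum>a\<in>{0..<M}. h a)"
proof -
  define g where "g = (\<lambda>a. (u * a + v) mod M)"
  have "inj_on g {0..<M}"
  proof (rule inj_onI)
    fix x y assume xy: "x \<in> {0..<M}" "y \<in> {0..<M}" "g x = g y"
    then have "[u * x + v = u * y + v] (mod M)" by (simp add: g_def cong_def)
    then have "[u * x = u * y] (mod M)" by (simp add: cong_add_rcancel)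
    then have "[x = y] (mod M)" using co by (simp add: cong_mult_lcancel)
    then show "x = y" using xy(1,2) by (simp add: cong_def)
  qed
  moreover have "g ` {0..<M} \<subseteq> {0..<M}" using M by (auto simp: g_def)
  ultimately have "bij_betw g {0..<M} {0..<M}"
    by (simp add: bij_betw_def endo_inj_surj)
  then have "(\<Sum>a\<in>{0..<M}. h (g a)) = (\<Sum>a\<in>{0..<M}. h a)"
    by (rule sum.reindex_bij_betw)
  moreover have "h (g a) = h (u * a + v)" for a
    by (intro per) (simp add: g_def)
  ultimately show ?thesis by simp
qed

text \<open>The decomposition \<open>b + K * k\<close> requires no coprimality of \<open>K\<close>
  and \<open>q\<close>. For prime \<open>q\<close> the inner sums are those of the Hecke relation;
  for \<open>q = 2\<close> a period is folded in half.\<close>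

lemma sum_int_split:
  fixes K q :: int and h :: "int \<Rightarrow> 'a :: comm_monoid_add"
  assumes "K > 0" "q > 0"
  shows "(\<Sum>a\<in>{0..<K * q}. h a) = (\<Sum>b\<in>{0..<K}. \<Sum>k\<in>{0..<q}. h (b + K * k))"
proof -
  have "b + K * k < K * q" if "b < K" "k < q" for b k
  proof -
    have "b + K * k < K * (k + 1)" using that by (simp add: distrib_left)
    also have "\<dots> \<le> K * q" using that assms by (intro mult_left_mono) auto
    finally show ?thesis .
  qed
  moreover have "a div K < q" if "a < K * q" for a
  proof -
    have "K * (a div K) + a mod K = a" "0 \<le> a mod K" using assms by simp_all
    then have "K * (a div K) < K * q" using that by linarith
    then show ?thesis using assms by simp
  qed
  ultimately have "(\<Sum>a\<in>{0..<K * q}. h a) = (\<Sum>(b, k)\<in>{0..<K} \<times> {0..<q}. h (b + K * k))"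
    using assms
    by (intro sum.reindex_bij_witness[where i = "\<lambda>(b, k). b + K * k" and j = "\<lambda>a. (a mod K, a div K)"])
       (auto simp: pos_imp_zdiv_nonneg_iff)
  then show ?thesis by (simp add: sum.cartesian_product)
qed

lemma sum_antiperiodic:
  fixes f :: "int \<Rightarrow> int"
  assumes "K > 0" "\<And>x y. [x = y] (mod K) \<Longrightarrow> f x = f y" "\<And>x. f (x + v) = - f x"
  shows "(\<Sum>x\<in>{0..<K}. f x) = 0"
proof -
  have "(\<Sum>x\<in>{0..<K}. f (1 * x + v)) = (\<Sum>x\<in>{0..<K}. f x)"
    using assms by (intro sum_int_residues_affine) auto
  then show ?thesis by (simp add: assms(3) sum_negf)
qed

text \<open>Pairs \<open>x\<close> with \<open>- x\<close> modulo \<open>4 * m\<close>. The only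
  residues equal to their own negatives are 0 and \<open>2 * m\<close>, where \<open>f\<close>
  vanishes.\<close>

lemma sum_even_function:
  fixes f :: "int \<Rightarrow> int"
  assumes m: "m > 0" and per: "\<And>x y. [x = y] (mod 4 * m) \<Longrightarrow> f x = f y"
    and sym: "\<And>x. f (- x) = f x" and z: "f 0 = 0" "f (2 * m) = 0"
  shows "even (\<Sum>x\<in>{0..<4 * m}. f x)"
proof -
  have "(\<Sum>x\<in>{0..<2 * m * 2}. f x) = (\<Sum>b\<in>{0..<2 * m}. \<Sum>k\<in>{0..<2}. f (b + 2 * m * k))"
    using m by (intro sum_int_split) auto
  also have "\<dots> = (\<Sum>b\<in>{0..<2 * m}. f b + f (b + 2 * m))"
  proof -
    have "{0..<2::int} = {0, 1}" by auto
    then show ?thesis by simp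
  qed
  also have "\<dots> = (\<Sum>b\<in>{0..<2 * m}. f b) + (\<Sum>b\<in>{0..<2 * m}. f (2 * m - b))"
  proof -
    have "f (b + 2 * m) = f (2 * m - b)" for b
      using per[of "- (b + 2 * m)" "2 * m - b"] sym[of "b + 2 * m"] by (simp add: cong_iff_dvd_diff)
    then show ?thesis by (simp add: sum.distrib)
  qed
  also have "(\<Sum>b\<in>{0..<2 * m}. f (2 * m - b)) = (\<Sum>b\<in>{1..2 * m}. f b)"
    by (rule sum.reindex_bij_witness[where i = "\<lambda>b. 2 * m - b" and j = "\<lambda>b. 2 * m - b"]) auto
  also have "\<dots> = (\<Sum>b\<in>{1..<2 * m}. f b)"
    using z by (intro sum.mono_neutral_right) auto
  also have "\<dots> = (\<Sum>b\<in>{0..<2 * m}. f b)"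
  proof (rule sum.mono_neutral_left)
    show "\<forall>i\<in>{0..<2 * m} - {1..<2 * m}. f i = 0"
    proof
      fix i assume "i \<in> {0..<2 * m} - {1..<2 * m}"
      then have "i = 0" by auto
      then show "f i = 0" using z by simp
    qed
  qed auto
  finally show ?thesis by (simp add: mult.commute)
qed

lemma periodic_int_multiple:
  fixes g :: "'a :: ring_1 \<Rightarrow> 'b"
  assumes S: "\<And>z k. z \<in> S \<Longrightarrow> z + of_int k * p \<in> S" and per: "\<And>z. z \<in> S \<Longrightarrow> g (z + p) = g z" and z: "z \<in> S"
  shows "g (z + of_int k * p) = g z"
proof -
  have nat: "g (z + of_nat n * p) = g z" if "z \<in> S" for z n
  proof (induction n)
    case (Suc n)
    have "z + of_nat n * p \<in> S" using S[OF that, of "int n"] by simp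
    then show ?case using per[of "z + of_nat n * p"] Suc by (simp add: algebra_simps)
  qed simp
  show ?thesis
  proof (cases "k \<ge> 0")
    case True
    then show ?thesis using nat[OF z, of "nat k"] by simp
  next
    case False
    then show ?thesis using nat[OF S[OF z, of k], of "nat (- k)"] by simp
  qed
qed

section \<open>Additive characters and Gauss sums\<close>

definition eM :: "int \<Rightarrow> int \<Rightarrow> complex" where
  "eM M k = exp (2 * of_real pi * \<i> * (of_int k / of_int M))"

lemma eM_add: "eM M (j + k) = eM M j * eM M k"
  by (simp add: eM_def add_divide_distrib distrib_left exp_add)

lemma eM_cong:
  assumes "M > 0" "[j = k] (mod M)"
  shows "eM M j = eM M k"
proof -
  obtain t where t: "j = k + M * t"
    using assms by (metis cong_iff_lin cong_sym)
  have "eM M (M * t) = 1"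
    using assms(1) by (simp add: eM_def exp_eq_1)
  then show ?thesis by (simp add: t eM_add)
qed

lemma eM_0 [simp]: "eM M 0 = 1"
  by (simp add: eM_def)

lemma eM_eq_1_iff:
  assumes "M > 0"
  shows "eM M k = 1 \<longleftrightarrow> M dvd k"
proof
  assume "eM M k = 1"
  then obtain n :: int where "2 * pi * (of_int k / of_int M) = of_int (2 * n) * pi"
    by (auto simp: eM_def exp_eq_1)
  then have "real_of_int k = of_int (n * M)"
    using assms by (simp add: field_simps)
  then have "k = n * M" by (simp only: of_int_eq_iff)
  then show "M dvd k" by simp
next
  assume "M dvd k"
  then show "eM M k = 1" using eM_cong[OF assms, of k 0] by (simp add: cong_0_iff)
qed

text \<open>Translating the summation variable by 1 multiplies the sum by \<open>eM M k\<close>,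
  which differs from 1 unless \<open>M dvd k\<close>.\<close>

lemma sum_eM:
  assumes "M > 0"
  shows "(\<Sum>n\<in>{0..<M}. eM M (n * k)) = (if M dvd k then of_int M else 0)"
proof (cases "M dvd k")
  case True
  then have "eM M (n * k) = 1" for n using eM_eq_1_iff[OF assms] by simp
  with True assms show ?thesis by simp
next
  case False
  have "(\<Sum>n\<in>{0..<M}. eM M ((1 * n + 1) * k)) = (\<Sum>n\<in>{0..<M}. eM M (n * k))"
    by (rule sum_int_residues_affine[where h = "\<lambda>n. eM M (n * k)"])
       (auto intro!: assms eM_cong cong_mult)
  moreover have "(\<Sum>n\<in>{0..<M}. eM M ((1 * n + 1) * k)) = (\<Sum>n\<in>{0..<M}. eM M (n * k)) * eM M k"
    by (simp add: distrib_right eM_add sum_distrib_right)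
  ultimately have "(\<Sum>n\<in>{0..<M}. eM M (n * k)) * (eM M k - 1) = 0" by (simp add: algebra_simps)
  with False show ?thesis using eM_eq_1_iff[OF assms] by simp
qed

text \<open>Primitivity is tested on the maximal proper divisors \<open>M div p\<close> only: every
  proper divisor of \<open>M\<close> divides one of them, and a character induced from it would be 1
  at each unit that is 1 modulo that \<open>M div p\<close>.\<close>

locale primitive_quadratic_character =
  fixes M :: int and chr :: "int \<Rightarrow> int"
  assumes modulus_pos: "M > 0"
    and periodic: "\<And>x y. [x = y] (mod M) \<Longrightarrow> chr x = chr y"
    and mult: "\<And>x y. chr (x * y) = chr x * chr y"
    and range: "\<And>x. chr x \<in> {-1, 0, 1}"
    and zero_iff: "\<And>x. chr x = 0 \<longleftrightarrow> \<not> coprime x M"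
    and primitive: "\<And>p. prime p \<Longrightarrow> p dvd M \<Longrightarrow> \<exists>u. [u = 1] (mod (M div p)) \<and> chr u = -1"
begin

definition gauss :: "int \<Rightarrow> complex" where
  "gauss n = (\<Sum>a\<in>{0..<M}. of_int (chr a) * eM M (a * n))"

lemma gauss_scale:
  assumes "coprime u M"
  shows "of_int (chr u) * gauss (u * n) = gauss n"
proof -
  have "gauss n = (\<Sum>a\<in>{0..<M}. of_int (chr (u * a + 0)) * eM M ((u * a + 0) * n))"
    unfolding gauss_def
    by (rule sum_int_residues_affine[symmetric, where h = "\<lambda>a. of_int (chr a) * eM M (a * n)"])
       (auto intro!: modulus_pos assms arg_cong2[of _ _ _ _ "(*)"] arg_cong[of _ _ of_int] periodic
          eM_cong cong_mult)
  also have "\<dots> = of_int (chr u) * gauss (u * n)"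
    by (simp add: gauss_def mult sum_distrib_left mult_ac)
  finally show ?thesis by simp
qed

lemma gauss_cong: "[j = k] (mod M) \<Longrightarrow> gauss j = gauss k"
  unfolding gauss_def
  by (intro sum.cong refl arg_cong2[of _ _ _ _ "(*)"] eM_cong cong_mult modulus_pos) auto

lemma chr_1 [simp]: "chr 1 = 1"
proof -
  have "chr 1 * chr 1 = chr 1" "chr 1 \<noteq> 0" using mult[of 1 1] zero_iff[of 1] by simp_all
  then show ?thesis by simp
qed

lemma chr_square: "coprime n M \<Longrightarrow> chr n * chr n = 1"
  using range[of n] zero_iff[of n] by auto

text \<open>For \<open>n\<close> prime to \<open>M\<close> this is a substitution. If a prime
  \<open>p\<close> divides both, the \<open>u\<close> supplied by primitivity satisfies
  \<open>u * n = n\<close> modulo \<open>M\<close>, since \<open>u - 1\<close> contributes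
  \<open>M div p\<close> and \<open>n\<close> contributes \<open>p\<close>; as
  \<open>chr u = -1\<close>, the sum equals its own negative.\<close>

lemma gauss_eq: "gauss n = of_int (chr n) * gauss 1"
proof (cases "coprime n M")
  case True
  have "of_int (chr n) * gauss n = gauss 1"
    using gauss_scale[OF True, of 1] by simp
  then have "of_int (chr n * chr n) * gauss n = of_int (chr n) * gauss 1" by (simp add: mult.assoc)
  then show ?thesis by (simp add: chr_square[OF True])
next
  case False
  then obtain p where p: "prime p" "p dvd n" "p dvd M"
    using modulus_pos prime_divisor_exists[of "gcd n M"] by (auto simp: coprime_iff_gcd_eq_1 is_unit_gcd_iff)
  obtain u where u: "[u = 1] (mod (M div p))" "chr u = -1" using primitive[OF p(1,3)] by auto
  have co: "coprime u M" using u(2) zero_iff[of u] by auto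
  obtain t where t: "M = p * t" using p by auto
  obtain n' where n': "n = p * n'" using p by auto
  have "p \<noteq> 0" using p by auto
  have "M div p = t" using t \<open>p \<noteq> 0\<close> by simp
  with u(1) obtain k where k: "u = 1 + t * k" by (metis cong_iff_lin cong_sym)
  have "[u * n = n] (mod M)"
    unfolding k t n' by (simp add: cong_iff_dvd_diff algebra_simps)
  then have "gauss (u * n) = gauss n" using gauss_cong by simp
  with gauss_scale[OF co, of n] u(2) have "gauss n = 0" by simp
  with False zero_iff show ?thesis by simp
qed

text \<open>The sum of \<open>gauss n * gauss (- n)\<close> is evaluated twice: orthogonality of the
  additive characters leaves the diagonal, while \<open>gauss_eq\<close> pulls out the square of
  \<open>gauss 1\<close>. The common factor, the number of units, cancels.\<close>

lemma gauss_square: "(gauss 1)\<^sup>2 = of_int (chr (-1)) * of_int M"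
proof -
  let ?I = "{0..<M}"
  let ?n = "(\<Sum>a\<in>?I. of_int (chr a * chr a)) :: complex"
  have prod_term: "of_int (chr a) * eM M (a * n) * (of_int (chr b) * eM M (b * - n)) =
      of_int (chr a * chr b) * eM M (n * (a - b))" for a b n
  proof -
    have "eM M (n * (a - b)) = eM M (a * n + b * - n)" by (simp add: algebra_simps)
    then show ?thesis by (simp only: eM_add) simp
  qed
  have "(\<Sum>n\<in>?I. gauss n * gauss (- n)) =
      (\<Sum>n\<in>?I. \<Sum>a\<in>?I. \<Sum>b\<in>?I. of_int (chr a * chr b) * eM M (n * (a - b)))"
    unfolding gauss_def sum_product prod_term ..
  also have "\<dots> = (\<Sum>a\<in>?I. \<Sum>n\<in>?I. \<Sum>b\<in>?I. of_int (chr a * chr b) * eM M (n * (a - b)))"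
    by (rule sum.swap)
  also have "\<dots> = (\<Sum>a\<in>?I. \<Sum>b\<in>?I. \<Sum>n\<in>?I. of_int (chr a * chr b) * eM M (n * (a - b)))"
    by (intro sum.cong refl sum.swap)
  also have "\<dots> = (\<Sum>a\<in>?I. \<Sum>b\<in>?I. of_int (chr a * chr b) * (\<Sum>n\<in>?I. eM M (n * (a - b))))"
    by (simp only: sum_distrib_left)
  also have "\<dots> = (\<Sum>a\<in>?I. \<Sum>b\<in>?I. if b = a then of_int (chr a * chr b) * of_int M else 0)"
  proof (intro sum.cong refl)
    fix a b assume "a \<in> ?I" "b \<in> ?I"
    then have "M dvd a - b \<longleftrightarrow> b = a"
      by (auto simp flip: cong_iff_dvd_diff simp: cong_def)
    then show "of_int (chr a * chr b) * (\<Sum>n\<in>?I. eM M (n * (a - b))) =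
        (if b = a then of_int (chr a * chr b) * of_int M else 0)"
      by (simp add: sum_eM[OF modulus_pos])
  qed
  also have "\<dots> = ?n * of_int M" by (simp add: sum_distrib_right)
  finally have 1: "(\<Sum>n\<in>?I. gauss n * gauss (- n)) = ?n * of_int M" .
  have "gauss n * gauss (- n) = of_int (chr n * chr n) * (of_int (chr (-1)) * (gauss 1)\<^sup>2)" for n
    using gauss_eq[of n] gauss_eq[of "- n"] mult[of "-1" n] by (simp add: power2_eq_square)
  then have 2: "(\<Sum>n\<in>?I. gauss n * gauss (- n)) = ?n * (of_int (chr (-1)) * (gauss 1)\<^sup>2)"
    by (simp add: sum_distrib_right)
  have "?n = of_int (\<Sum>a\<in>?I. chr a * chr a)" by simp
  \<comment> \<open>The witness is \<open>1 mod M\<close> instead of 1 so that it lies in the range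
    of summation even for \<open>M = 1\<close>.\<close>
  moreover have "(\<Sum>a\<in>?I. chr a * chr a) > 0"
  proof (rule sum_pos2[of _ "1 mod M"])
    show "0 < chr (1 mod M) * chr (1 mod M)"
      using periodic[of "1 mod M" 1] by simp
  qed (use modulus_pos in auto)
  ultimately have "?n \<noteq> 0" by (simp only: of_int_eq_0_iff)
  with 1 2 have *: "of_int (chr (-1)) * (gauss 1)\<^sup>2 = of_int M" by simp
  have "of_int (chr (-1) * chr (-1)) * (gauss 1)\<^sup>2 = of_int (chr (-1)) * of_int M"
    unfolding *[symmetric] by simp
  then show ?thesis using chr_square[of "-1"] by simp
qed

end

section \<open>The characters chi_4 chi_d, indexed by the set of primes dividing d\<close>

definition tchar :: "nat set \<Rightarrow> int \<Rightarrow> int" where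
  "tchar D n = chi4 n * (\<Prod>p\<in>D. Legendre n (int p))"

text \<open>The principal character at the primes of \<open>F\<close>, written with squares so that
  the product of \<open>l + l^2\<close> over a set \<open>Q\<close> expands literally into products
  over \<open>D\<close> and \<open>Q - D\<close>.\<close>

definition cop_ind :: "nat set \<Rightarrow> int \<Rightarrow> int" where
  "cop_ind F n = (\<Prod>p\<in>F. (Legendre n (int p))\<^sup>2)"

lemma odd_prime_gt_2: "prime p \<Longrightarrow> odd p \<Longrightarrow> 2 < (p :: nat)"
  using prime_ge_2_nat[of p] by (cases "p = 2") auto

context
  fixes D :: "nat set"
  assumes primes: "\<And>p. p \<in> D \<Longrightarrow> prime p \<and> odd p"
begin

lemma tchar_mult: "tchar D (x * y) = tchar D x * tchar D y"
  using primes by (simp add: tchar_def chi4_mult Legendre_mult odd_prime_gt_2 prod.distrib)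

lemma cop_ind_mult: "cop_ind D (x * y) = cop_ind D x * cop_ind D y"
  using primes by (simp add: cop_ind_def Legendre_mult odd_prime_gt_2 prod.distrib power_mult_distrib)

end

lemma dvd_prod_int: "finite D \<Longrightarrow> p \<in> D \<Longrightarrow> int p dvd int (\<Prod>D)"
  by (metis dvd_prodI int_dvd_int_iff eq_id_iff)

lemma tchar_cong:
  assumes "finite D" "[x = y] (mod (4 * int (\<Prod>D)))"
  shows "tchar D x = tchar D y"
proof -
  have "chi4 x = chi4 y" using assms by (intro chi4_cong) (rule cong_dvd_modulus, auto)
  moreover have "Legendre x (int p) = Legendre y (int p)" if "p \<in> D" for p
    by (intro Legendre_cong cong_dvd_modulus[OF assms(2)] dvd_mult dvd_prod_int assms that)
  ultimately show ?thesis by (simp add: tchar_def)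
qed

lemma cop_ind_cong:
  assumes "finite D" "[x = y] (mod (int (\<Prod>D)))"
  shows "cop_ind D x = cop_ind D y"
proof -
  have "Legendre x (int p) = Legendre y (int p)" if "p \<in> D" for p
    using assms dvd_prod_int[OF assms(1) that] by (intro Legendre_cong) (rule cong_dvd_modulus, auto)
  then show ?thesis by (simp add: cop_ind_def)
qed

lemma prod_signs: "(\<And>x. x \<in> A \<Longrightarrow> f x \<in> {-1, 0, 1 :: int}) \<Longrightarrow> prod f A \<in> {-1, 0, 1}"
proof (induction A rule: infinite_finite_induct)
  case (insert x F)
  then have "f x \<in> {-1, 0, 1}" "prod f F \<in> {-1, 0, 1}" by blast+
  with insert.hyps show ?case by auto
qed auto

lemma tchar_values: "tchar D n \<in> {-1, 0, 1}"
  using chi4_values[of n] prod_signs[of D "\<lambda>p. Legendre n (int p)"] Legendre_values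
  by (auto simp: tchar_def)

lemma tchar_eq_0_iff:
  "finite D \<Longrightarrow> tchar D n = 0 \<longleftrightarrow> even n \<or> (\<exists>p\<in>D. int p dvd n)"
  by (simp add: tchar_def chi4_eq_0_iff Legendre_eq_0_iff)

lemma tchar_minus_1: "finite D \<Longrightarrow> (\<And>p. p \<in> D \<Longrightarrow> prime p \<and> odd p) \<Longrightarrow> tchar D (-1) \<in> {-1, 1}"
  using tchar_values[of D "-1"] tchar_eq_0_iff[of D "-1"] by auto (metis One_nat_def not_prime_1)

lemma prime_factors_prod_primes:
  assumes "finite D" "\<And>p. p \<in> D \<Longrightarrow> prime p"
  shows "prime_factors (\<Prod>D) = (D :: nat set)"
proof -
  have "0 \<notin> D" using assms by (metis not_prime_0)
  then show ?thesis
    using assms by (subst prime_factors_prod) (auto simp: prime_prime_factors)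
qed

lemma quad_char_4_times:
  assumes "finite D" "\<And>p. p \<in> D \<Longrightarrow> prime p"
  shows "quad_char (4 * \<Prod>D) = tchar D"
  using prime_factors_prod_primes[OF assms] by (auto simp: quad_char_def tchar_def)

lemma Legendre_prod_cong:
  assumes "finite Q" "[x = y] (mod int (\<Prod>Q))"
  shows "(\<Prod>p\<in>Q. h (Legendre x (int p))) = (\<Prod>p\<in>Q. h (Legendre y (int p)))"
  by (intro prod.cong refl arg_cong[of _ _ h] Legendre_cong cong_dvd_modulus[OF assms(2)] dvd_prod_int assms)

text \<open>At 2 the witness is \<open>1 + 2 * m\<close> with \<open>m\<close> the product of
  \<open>Q\<close>: it is 1 modulo \<open>2 * m\<close>, hence modulo every prime of
  \<open>Q\<close>, but 3 modulo 4 because \<open>m\<close> is odd. At an odd \<open>q\<close> the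
  Chinese remainder theorem combines a nonresidue modulo \<open>q\<close> with 1 modulo the
  cofactor.\<close>

lemma tchar_primitive:
  assumes fin: "finite Q" and pr: "\<And>p. p \<in> Q \<Longrightarrow> prime p \<and> odd p"
  shows "primitive_quadratic_character (4 * int (\<Prod>Q)) (tchar Q)"
proof
  let ?m = "int (\<Prod>Q)"
  have oddm: "odd (\<Prod>Q)" using fin pr by (auto simp: even_prod_iff)
  have "\<Prod>Q > 0" using pr by (intro prod_pos) (auto intro: prime_gt_0_nat)
  then have mpos: "?m > 0" by (simp del: of_nat_prod)
  then show "4 * ?m > 0" by simp
  show "tchar Q x = tchar Q y" if "[x = y] (mod 4 * ?m)" for x y
    using tchar_cong[OF fin that] .
  show "tchar Q (x * y) = tchar Q x * tchar Q y" for x y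
    using pr by (rule tchar_mult)
  show "tchar Q x \<in> {-1, 0, 1}" for x by (rule tchar_values)
  show "tchar Q x = 0 \<longleftrightarrow> \<not> coprime x (4 * ?m)" for x
  proof -
    have "coprime x 4 \<longleftrightarrow> odd x"
      using coprime_power_right_iff[of x 2 2] by simp
    moreover have "coprime x ?m \<longleftrightarrow> (\<forall>p\<in>Q. \<not> int p dvd x)"
    proof -
      have "coprime x ?m \<longleftrightarrow> (\<forall>p\<in>Q. coprime x (int p))"
        using fin by (induction Q rule: finite_induct) auto
      also have "\<dots> \<longleftrightarrow> (\<forall>p\<in>Q. \<not> int p dvd x)"
        using pr by (metis coprime_commute not_prime_unit prime_imp_coprime prime_nat_int_transfer coprime_absorb_left)
      finally show ?thesis .
    qed
    ultimately show ?thesis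
      unfolding coprime_mult_right_iff tchar_eq_0_iff[OF fin] by auto
  qed
  fix p :: int assume p: "prime p" "p dvd 4 * ?m"
  show "\<exists>u. [u = 1] (mod (4 * ?m div p)) \<and> tchar Q u = -1"
  proof (cases "p = 2")
    case True
    have u: "chi4 (1 + 2 * ?m) = - chi4 1" by (rule chi4_shift) (use oddm in \<open>simp del: of_nat_prod\<close>)
    have "Legendre (1 + 2 * ?m) (int q) = 1" if "q \<in> Q" for q
    proof -
      have "[1 + 2 * ?m = 1] (mod int q)"
        using dvd_prod_int[OF fin that] by (simp add: cong_iff_dvd_diff del: of_nat_prod)
      then have "Legendre (1 + 2 * ?m) (int q) = Legendre 1 (int q)" by (rule Legendre_cong)
      also have "\<dots> = 1" using Legendre_1 pr that by blast
      finally show ?thesis .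
    qed
    then have "tchar Q (1 + 2 * ?m) = -1" using u by (simp add: tchar_def chi4_def)
    moreover have "[1 + 2 * ?m = 1] (mod (4 * ?m div p))" using True by (simp add: cong_iff_dvd_diff)
    ultimately show ?thesis by blast
  next
    case False
    have "\<not> p dvd 4"
    proof
      assume "p dvd 4"
      then have "p dvd 2 * 2" by simp
      then have "p dvd 2" using p(1) prime_dvd_mult_iff by blast
      then have "p \<le> 2" by (rule zdvd_imp_le) simp
      then show False using False prime_ge_2_int[OF p(1)] by simp
    qed
    then have "p dvd ?m" using p prime_dvd_mult_iff by blast
    then obtain q where q: "q \<in> Q" "p dvd int q"
      using p(1) fin by (auto simp: prime_dvd_prod_iff)
    have pq: "p = int q"
      using q p(1) pr[OF q(1)] by (metis primes_dvd_imp_eq prime_nat_int_transfer)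
    define R where "R = Q - {q}"
    have Q: "Q = insert q R" "q \<notin> R" "finite R" using q fin by (auto simp: R_def)
    then have m: "?m = int q * int (\<Prod>R)" by (simp del: of_nat_prod)
    have "prime q" "2 < q" using pr[OF q(1)] odd_prime_gt_2 by auto
    then obtain n where n: "Legendre n (int q) = -1" using exists_nonresidue by blast
    have "coprime (int q) (4 * int (\<Prod>R))"
    proof -
      have "coprime q (\<Prod>R)" using pr Q by (intro prod_coprime_right primes_coprime) auto
      moreover have "coprime q (2 ^ 2)"
        unfolding coprime_power_right_iff using pr[OF q(1)] by simp
      then have "coprime q 4" by (simp only: power2_eq_square) simp
      ultimately show ?thesis
        by (metis coprime_int_iff coprime_mult_right_iff of_nat_numeral)
    qed
    then obtain u where u: "[u = n] (mod int q)" "[u = 1] (mod (4 * int (\<Prod>R)))"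
      using binary_chinese_remainder_int by blast
    have "4 * ?m div p = 4 * int (\<Prod>R)"
    proof -
      have "4 * ?m = int q * (4 * int (\<Prod>R))" unfolding m by (simp only: mult_ac)
      moreover have "int q \<noteq> 0" using pr[OF q(1)] by (auto dest: prime_gt_0_nat)
      ultimately show ?thesis unfolding pq by (metis nonzero_mult_div_cancel_left)
    qed
    moreover have "tchar Q u = -1"
    proof -
      have "chi4 u = chi4 1" using u(2) by (intro chi4_cong) (rule cong_dvd_modulus, auto)
      moreover have "Legendre u (int q) = -1" using Legendre_cong[OF u(1)] n by simp
      moreover have "Legendre u (int t) = 1" if "t \<in> R" for t
      proof -
        have "[u = 1] (mod int t)"
          using u(2) dvd_mult[OF dvd_prod_int[OF Q(3) that]] by (rule cong_dvd_modulus)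
        then have "Legendre u (int t) = Legendre 1 (int t)" by (rule Legendre_cong)
        also have "\<dots> = 1" using Legendre_1 pr that Q by blast
        finally show ?thesis .
      qed
      ultimately show ?thesis using Q by (simp add: tchar_def chi4_def)
    qed
    ultimately show ?thesis using u(2) by metis
  qed
qed

section \<open>Character sums of modular symbols\<close>

text \<open>\<open>J r\<close> stands for \<open>2 pi\<close> times the integral of \<open>f (r + i y)\<close> over \<open>y > 0\<close>.\<close>

locale modular_symbols =
  fixes N :: nat and J :: "real \<Rightarrow> complex" and a :: "nat \<Rightarrow> complex" and \<Omega>p \<Omega>m :: real
  assumes odd_level: "odd N"
    and omega_pos: "\<Omega>p > 0" "\<Omega>m > 0"
    and J_plus_1: "\<And>r. J (r + 1) = J r"
    and J_minus: "\<And>r. J (- r) = cnj (J r)"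
    and J_hecke: "\<And>q r. prime q \<Longrightarrow> \<not> q dvd N \<Longrightarrow> r \<in> \<rat> \<Longrightarrow>
        a q * J r = J (of_nat q * r) + (\<Sum>b<q. J ((r + of_nat b) / of_nat q))"
    and J_lattice: "\<And>b D :: int. D > 0 \<Longrightarrow> coprime D (int N) \<Longrightarrow>
        J (of_int b / of_int D) - J 0 \<in> rectangular_lattice \<Omega>p \<Omega>m"
    and a_rat: "\<And>n. a n \<in> \<rat>"
begin

lemma J_plus_int: "J (r + of_int k) = J r"
  using periodic_int_multiple[of UNIV 1 J r k] J_plus_1 by simp

lemma J_cong:
  assumes "K > 0" "[x = y] (mod K)"
  shows "J (of_int x / of_int K) = J (of_int y / of_int K)"
proof -
  obtain k where "y = x + K * k" using assms(2) by (auto simp: cong_iff_lin)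
  then have "of_int y / of_int K = of_int x / real_of_int K + of_int k"
    using assms(1) by (simp add: add_divide_distrib)
  then show ?thesis by (simp add: J_plus_int)
qed

text \<open>Grouping the residues modulo \<open>K * q\<close> by their class \<open>b\<close> modulo
  \<open>K\<close> produces the points \<open>(b / K + k) / q\<close> of the Hecke relation at
  \<open>b / K\<close>. This gives \<open>a q\<close> times the sum, minus a sum over
  \<open>J (q b / K)\<close> that equals \<open>\<psi> q\<close> times it; deleting the multiples of
  \<open>q\<close> removes \<open>\<psi> q\<close> times it once more. Hence the coefficient
  2.\<close>

lemma hecke_step:
  fixes K :: int and q :: nat
  assumes K: "K > 0" and q: "prime q" "\<not> q dvd N" and co: "coprime (int q) K"
    and per: "\<And>x y. [x = y] (mod K) \<Longrightarrow> \<psi> x = \<psi> y"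
    and mult: "\<And>x y. \<psi> (x * y) = \<psi> x * (\<psi> y :: int)"
    and unit: "\<psi> (int q) * \<psi> (int q) = 1"
  shows "(\<Sum>x\<in>{0..<K * int q}. of_int (if int q dvd x then 0 else \<psi> x) * J (of_int x / of_int (K * int q)))
     = (a q - 2 * of_int (\<psi> (int q))) * (\<Sum>x\<in>{0..<K}. of_int (\<psi> x) * J (of_int x / of_int K))"
proof -
  define S where "S = (\<Sum>x\<in>{0..<K}. of_int (\<psi> x) * J (of_int x / of_int K))"
  have q0: "q > 0" using q prime_gt_0_nat by blast
  let ?h = "\<lambda>x. of_int (\<psi> x) * J (of_int x / of_int (K * int q))"
  have "(\<Sum>x\<in>{0..<K * int q}. ?h x) = (\<Sum>b\<in>{0..<K}. \<Sum>k\<in>{0..<int q}. ?h (b + K * k))"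
    using K q0 by (intro sum_int_split) auto
  also have "\<dots> = (\<Sum>b\<in>{0..<K}. of_int (\<psi> b) * (a q * J (of_int b / of_int K) - J (of_int (int q * b) / of_int K)))"
  proof (intro sum.cong refl)
    fix b assume "b \<in> {0..<K}"
    have "(\<Sum>k\<in>{0..<int q}. ?h (b + K * k)) =
        (\<Sum>k\<in>{0..<int q}. of_int (\<psi> b) * J ((of_int b / of_int K + of_int k) / of_nat q))"
    proof (intro sum.cong refl)
      fix k
      have "\<psi> (b + K * k) = \<psi> b" by (intro per) (simp add: cong_def)
      moreover have "of_int (b + K * k) / of_int (K * int q) = (of_int b / of_int K + of_int k) / real q"
        using K q0 by (simp add: field_simps)
      ultimately show "?h (b + K * k) = of_int (\<psi> b) * J ((of_int b / of_int K + of_int k) / of_nat q)"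
        by simp
    qed
    also have "\<dots> = of_int (\<psi> b) * (\<Sum>k\<in>{0..<int q}. J ((of_int b / of_int K + of_int k) / of_nat q))"
      by (simp add: sum_distrib_left)
    also have "(\<Sum>k\<in>{0..<int q}. J ((of_int b / of_int K + of_int k) / of_nat q)) =
        (\<Sum>k<q. J ((of_int b / of_int K + of_nat k) / of_nat q))"
      by (rule sum.reindex_bij_witness[where i = int and j = nat]) auto
    also have "\<dots> = a q * J (of_int b / of_int K) - J (of_nat q * (of_int b / of_int K))"
      using J_hecke[OF q, of "of_int b / of_int K"] by simp
    finally show "(\<Sum>k\<in>{0..<int q}. ?h (b + K * k)) =
      of_int (\<psi> b) * (a q * J (of_int b / of_int K) - J (of_int (int q * b) / of_int K))" by simp
  qed
  also have "\<dots> = a q * S - (\<Sum>b\<in>{0..<K}. of_int (\<psi> b) * J (of_int (int q * b) / of_int K))"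
    by (simp add: S_def sum_distrib_left right_diff_distrib sum_subtractf mult_ac)
  \<comment> \<open>Since \<open>\<psi> q\<close> is its own inverse,
    \<open>\<psi> b = \<psi> q * \<psi> (q b)\<close>, which prepares the substitution of
    \<open>q b\<close> by \<open>b\<close>.\<close>
  also have "(\<Sum>b\<in>{0..<K}. of_int (\<psi> b) * J (of_int (int q * b) / of_int K)) =
      of_int (\<psi> q) * (\<Sum>b\<in>{0..<K}. of_int (\<psi> (int q * b + 0)) * J (of_int (int q * b + 0) / of_int K))"
    using arg_cong[OF unit, of complex_of_int]
    by (simp add: sum_distrib_left mult flip: mult.assoc)
  also have "(\<Sum>b\<in>{0..<K}. of_int (\<psi> (int q * b + 0)) * J (of_int (int q * b + 0) / of_int K)) = S"
    unfolding S_def using K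
    by (intro sum_int_residues_affine[where h = "\<lambda>b. of_int (\<psi> b) * J (of_int b / of_int K)"] co)
       (auto intro!: arg_cong2[of _ _ _ _ "(*)"] arg_cong[of _ _ of_int] per J_cong)
  finally have 1: "(\<Sum>x\<in>{0..<K * int q}. ?h x) = a q * S - of_int (\<psi> q) * S" .
  have "(\<Sum>x\<in>{0..<K * int q}. if int q dvd x then ?h x else 0) = (\<Sum>x\<in>{x \<in> {0..<K * int q}. int q dvd x}. ?h x)"
    by (rule sum.inter_filter[symmetric]) auto
  also have "\<dots> = (\<Sum>b\<in>{0..<K}. of_int (\<psi> q) * (of_int (\<psi> b) * J (of_int b / of_int K)))"
    using q0 K by (intro sum.reindex_bij_witness[where i = "\<lambda>b. int q * b" and j = "\<lambda>x. x div int q"])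
      (auto simp: mult mult_ac div_less_iff_less_mult zero_le_mult_iff)
  also have "\<dots> = of_int (\<psi> q) * S" by (simp add: S_def sum_distrib_left)
  finally have 2: "(\<Sum>x\<in>{0..<K * int q}. if int q dvd x then ?h x else 0) = of_int (\<psi> q) * S" .
  have "(\<Sum>x\<in>{0..<K * int q}. of_int (if int q dvd x then 0 else \<psi> x) * J (of_int x / of_int (K * int q)))
     = (\<Sum>x\<in>{0..<K * int q}. ?h x) - (\<Sum>x\<in>{0..<K * int q}. if int q dvd x then ?h x else 0)"
    unfolding sum_subtractf[symmetric] by (intro sum.cong) auto
  then show ?thesis unfolding 1 2 S_def[symmetric] by (simp add: algebra_simps)
qed

definition good :: "nat set \<Rightarrow> bool" where
  "good Q \<longleftrightarrow> finite Q \<and> (\<forall>p\<in>Q. prime p \<and> odd p \<and> \<not> p dvd N)"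

definition char_sum :: "nat set \<Rightarrow> complex" where
  "char_sum D = (\<Sum>x\<in>{0..<4 * int (\<Prod>D)}. of_int (tchar D x) * J (of_int x / of_int (4 * int (\<Prod>D))))"

lemma good_subset: "good Q \<Longrightarrow> D \<subseteq> Q \<Longrightarrow> good D"
  by (auto simp: good_def intro: finite_subset)

lemma good_pos: "good D \<Longrightarrow> \<Prod>D > 0"
  by (auto simp: good_def intro!: prod_pos prime_gt_0_nat)

text \<open>The primes of \<open>F\<close> are added one at a time. At each stage the character is
  the imprimitive \<open>tchar D * cop_ind F\<close>, and \<open>cop_ind F\<close> is 1 at the new
  prime, so the Euler factor always involves the value of the same primitive
  \<open>tchar D\<close>.\<close>

lemma imprimitive_char_sum:
  assumes "good (D \<union> F)" "D \<inter> F = {}"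
  shows "(\<Sum>x\<in>{0..<4 * int (\<Prod>(D \<union> F))}.
            of_int (tchar D x * cop_ind F x) * J (of_int x / of_int (4 * int (\<Prod>(D \<union> F)))))
       = (\<Prod>q\<in>F. a q - 2 * of_int (tchar D (int q))) * char_sum D"
proof -
  have "finite F" using assms by (simp add: good_def)
  then show ?thesis using assms
  proof (induction F rule: finite_induct)
    case empty
    then show ?case by (simp add: char_sum_def cop_ind_def)
  next
    case (insert q F)
    define K where "K = 4 * int (\<Prod>(D \<union> F))"
    define \<psi> where "\<psi> = (\<lambda>x. tchar D x * cop_ind F x)"
    have gDF: "good (D \<union> F)" using insert.prems by (rule_tac good_subset) auto
    have q: "prime q" "odd q" "\<not> q dvd N" "q \<notin> D" "q \<notin> F"
      using insert.prems insert.hyps by (auto simp: good_def)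
    have pr: "\<And>p. p \<in> D \<Longrightarrow> prime p \<and> odd p" "\<And>p. p \<in> F \<Longrightarrow> prime p \<and> odd p"
      and fin: "finite D" "finite F"
      using gDF by (auto simp: good_def)
    have nd: "\<not> int p dvd int q" if "p \<in> D \<union> F" for p
      using that pr q by (metis Un_iff int_dvd_int_iff primes_dvd_imp_eq)
    have K4: "4 * int (\<Prod>(D \<union> insert q F)) = K * int q"
      using q fin by (simp add: K_def)
    have Kpos: "K > 0" using good_pos[OF gDF] by (simp add: K_def del: of_nat_prod)
    have ND: "int (\<Prod>D) dvd int (\<Prod>(D \<union> F))" "int (\<Prod>F) dvd int (\<Prod>(D \<union> F))"
      using fin by (auto simp flip: of_nat_prod simp: int_dvd_int_iff intro!: prod_dvd_prod_subset)
    have co: "coprime (int q) K"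
    proof -
      have "coprime q (\<Prod>(D \<union> F))"
        using pr q by (intro prod_coprime_right primes_coprime) auto
      moreover have "coprime q (2 ^ 2)"
        unfolding coprime_power_right_iff using q by simp
      then have "coprime q 4" by (simp only: power2_eq_square) simp
      ultimately show ?thesis
        unfolding K_def by (metis coprime_int_iff coprime_mult_right_iff of_nat_numeral)
    qed
    have "4 * int (\<Prod>D) dvd K" "int (\<Prod>F) dvd K"
      unfolding K_def using ND by (auto simp del: of_nat_prod intro: mult_dvd_mono dvd_mult)
    then have per: "\<psi> x = \<psi> y" if "[x = y] (mod K)" for x y
      unfolding \<psi>_def
      by (intro arg_cong2[of _ _ _ _ "(*)"] tchar_cong cop_ind_cong fin cong_dvd_modulus[OF that])
    have mult: "\<psi> (x * y) = \<psi> x * \<psi> y" for x y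
      using tchar_mult[OF pr(1)] cop_ind_mult[OF pr(2)] by (simp add: \<psi>_def)
    have cq: "cop_ind F (int q) = 1"
      unfolding cop_ind_def
    proof (rule prod.neutral, rule ballI)
      fix p assume "p \<in> F"
      then have "Legendre (int q) (int p) \<noteq> 0" using nd by (simp add: Legendre_eq_0_iff)
      then show "(Legendre (int q) (int p))\<^sup>2 = 1" using Legendre_values[of "int q" "int p"] by auto
    qed
    have tq: "tchar D (int q) \<in> {-1, 1}"
      using tchar_values[of D "int q"] tchar_eq_0_iff[OF fin(1), of "int q"] q nd by auto
    have ci: "tchar D x * cop_ind (insert q F) x = (if int q dvd x then 0 else \<psi> x)" for x
      using q fin Legendre_eq_0_iff[of x "int q"] Legendre_values[of x "int q"]
      by (auto simp: \<psi>_def cop_ind_def)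
    have "(\<Sum>x\<in>{0..<K * int q}. of_int (if int q dvd x then 0 else \<psi> x) * J (of_int x / of_int (K * int q)))
       = (a q - 2 * of_int (\<psi> (int q))) * (\<Sum>x\<in>{0..<K}. of_int (\<psi> x) * J (of_int x / of_int K))"
      using tq cq by (intro hecke_step Kpos q co per mult) (auto simp: \<psi>_def)
    also have "(\<Sum>x\<in>{0..<K}. of_int (\<psi> x) * J (of_int x / of_int K)) =
        (\<Prod>q\<in>F. a q - 2 * of_int (tchar D (int q))) * char_sum D"
      using insert.IH[OF gDF] insert.prems by (simp add: \<psi>_def K_def)
    also have "\<psi> (int q) = tchar D (int q)" by (simp add: \<psi>_def cq)
    finally show ?case unfolding K4 ci using q fin by (simp add: mult_ac)
  qed
qed

definition even_char :: "nat set \<Rightarrow> bool" where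
  "even_char D \<longleftrightarrow> tchar D (-1) = 1"

definition period :: "nat set \<Rightarrow> complex" where
  "period D = (if even_char D then of_real \<Omega>p else \<i> * of_real \<Omega>m)"

text \<open>Coordinates in the lattice basis \<open>\<Omega>p\<close>,
  \<open>\<i> * \<Omega>m\<close>. They are linear over the reals, so they pass through the rational
  Euler coefficients, and one of them annihilates all sums of the wrong parity.\<close>

definition coord :: "bool \<Rightarrow> complex \<Rightarrow> real" where
  "coord e z = (if e then Re z / \<Omega>p else Im z / \<Omega>m)"

definition norm_sum :: "nat set \<Rightarrow> complex" where
  "norm_sum D = char_sum D / period D"

text \<open>The Euler factors at the primes of \<open>Q\<close> outside \<open>D\<close>, by which
  the imprimitive sum modulo \<open>4 * \<Prod>Q\<close> differs from the primitive
  \<open>char_sum D\<close>.\<close>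

definition euler_coeff :: "nat set \<Rightarrow> nat set \<Rightarrow> complex" where
  "euler_coeff Q D = (\<Prod>q\<in>Q - D. a q - 2 * of_int (tchar D (int q)))"

lemma euler_coeff_rat: "euler_coeff Q D \<in> \<rat>"
proof -
  have "(\<Prod>q\<in>F. a q - 2 * of_int (tchar D (int q))) \<in> \<rat>" for F
    by (induction F rule: infinite_finite_induct) (auto intro!: a_rat Rats_mult Rats_diff Rats_of_int simp del: of_int_mult)
  then show ?thesis by (simp add: euler_coeff_def)
qed

lemma euler_coeff_real: "euler_coeff Q D \<in> \<real>"
  using euler_coeff_rat[of Q D] by (auto elim!: Rats_cases')

lemma coord_add: "coord e (x + y) = coord e x + coord e y"
  by (simp add: coord_def add_divide_distrib)

lemma coord_diff: "coord e (x - y) = coord e x - coord e y"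
  by (simp add: coord_def diff_divide_distrib)

lemma coord_0 [simp]: "coord e 0 = 0"
  by (simp add: coord_def)

lemma coord_sum: "coord e (\<Sum>x\<in>A. f x) = (\<Sum>x\<in>A. coord e (f x))"
  by (induction A rule: infinite_finite_induct) (auto simp: coord_add)

lemma coord_mult_real: "c \<in> \<real> \<Longrightarrow> coord e (c * z) = Re c * coord e z"
  by (auto simp: coord_def complex_is_Real_iff)

lemma coord_int: "coord e (of_int k * z) = of_int k * coord e z"
  by (simp add: coord_mult_real)

lemma coord_lattice: "z \<in> rectangular_lattice \<Omega>p \<Omega>m \<Longrightarrow> coord e z \<in> \<int>"
  using omega_pos by (auto simp: rectangular_lattice_def coord_def)

lemma good_minus_1: "good D \<Longrightarrow> tchar D (-1) = (if even_char D then 1 else -1)"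
  using tchar_minus_1[of D] by (auto simp: good_def even_char_def)

lemma good_coprime:
  assumes "good D"
  shows "coprime (4 * int (\<Prod>D)) (int N)"
proof -
  have "coprime (\<Prod>D) N"
    using assms by (intro prod_coprime_left) (auto simp: good_def prime_imp_coprime)
  moreover have "coprime (2 ^ 2) N" unfolding coprime_power_left_iff using odd_level by simp
  then have "coprime 4 N" by (simp only: power2_eq_square) simp
  ultimately show ?thesis
    by (metis coprime_int_iff coprime_mult_left_iff of_nat_numeral)
qed

text \<open>Conjugation turns \<open>J r\<close> into \<open>J (- r)\<close>, and negation permutes
  the residues. So the sum is real or purely imaginary according to parity.\<close>

lemma char_sum_cnj:
  assumes "good D"
  shows "cnj (char_sum D) = of_int (tchar D (-1)) * char_sum D"
proof -
  define K where "K = 4 * int (\<Prod>D)"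
  have K: "K > 0" using good_pos[OF assms] by (simp add: K_def del: of_nat_prod)
  have pr: "\<And>p. p \<in> D \<Longrightarrow> prime p \<and> odd p" and fin: "finite D" using assms by (auto simp: good_def)
  let ?h = "\<lambda>x. of_int (tchar D x) * J (of_int x / of_int K)"
  have "char_sum D = (\<Sum>x\<in>{0..<K}. ?h x)" by (simp add: char_sum_def K_def)
  also have "\<dots> = (\<Sum>x\<in>{0..<K}. ?h (-1 * x + 0))"
  proof (rule sum_int_residues_affine[symmetric, OF K])
    fix x y assume xy: "[x = y] (mod K)"
    then have "tchar D x = tchar D y" by (intro tchar_cong fin) (simp add: K_def)
    with J_cong[OF K xy] show "?h x = ?h y" by simp
  qed simp
  also have "\<dots> = (\<Sum>x\<in>{0..<K}. of_int (tchar D (-1)) * cnj (?h x))"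
  proof (intro sum.cong refl)
    fix x
    have "tchar D (-1 * x + 0) = tchar D (-1) * tchar D x" using tchar_mult[of D "-1" x] pr by simp
    then show "?h (-1 * x + 0) = of_int (tchar D (-1)) * cnj (?h x)"
      using J_minus[of "of_int x / of_int K"] by simp
  qed
  also have "\<dots> = of_int (tchar D (-1)) * cnj (char_sum D)"
    by (simp add: char_sum_def K_def sum_distrib_left)
  finally have "char_sum D = of_int (tchar D (-1)) * cnj (char_sum D)" .
  then show ?thesis using good_minus_1[OF assms] by (metis minus_minus mult_1 mult_minus1 of_int_1 of_int_minus)
qed

text \<open>Shifting \<open>x\<close> by half the modulus changes the sign of \<open>chi4\<close> only, so the constant \<open>J 0\<close>
  drops out of the sums and \<open>L(f, 1)\<close> never enters.\<close>

lemma sum_chi4_times: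
  assumes Q: "good Q" and g: "\<And>x y. [x = y] (mod int (\<Prod>Q)) \<Longrightarrow> g x = g y"
  shows "(\<Sum>x\<in>{0..<4 * int (\<Prod>Q)}. chi4 x * g x) = 0"
proof (rule sum_antiperiodic[where v = "2 * int (\<Prod>Q)"])
  have "odd (\<Prod>Q)" using Q by (auto simp: good_def even_prod_iff)
  then have odd: "odd (int (\<Prod>Q))" by (simp del: of_nat_prod)
  show "0 < 4 * int (\<Prod>Q)" using good_pos[OF Q] by (simp del: of_nat_prod)
  fix x y
  show "chi4 (x + 2 * int (\<Prod>Q)) * g (x + 2 * int (\<Prod>Q)) = - (chi4 x * g x)"
    using chi4_shift[OF odd, of x] g[of "x + 2 * int (\<Prod>Q)" x] by (simp add: cong_iff_dvd_diff del: of_nat_prod)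
  assume xy: "[x = y] (mod 4 * int (\<Prod>Q))"
  have "[x = y] (mod 4)" "[x = y] (mod int (\<Prod>Q))"
    by (rule cong_dvd_modulus[OF xy]; simp)+
  then show "chi4 x * g x = chi4 y * g y" using g chi4_cong by metis
qed

lemma coord_char_sum_int:
  assumes "good D"
  shows "coord e (char_sum D) \<in> \<int>"
proof -
  define K where "K = 4 * int (\<Prod>D)"
  have K: "K > 0" using good_pos[OF assms] by (simp add: K_def del: of_nat_prod)
  have fin: "finite D" using assms by (simp add: good_def)
  have "(\<Sum>x\<in>{0..<K}. tchar D x) = 0"
    unfolding K_def tchar_def
    by (intro sum_chi4_times[OF assms] Legendre_prod_cong[OF fin, where h = "\<lambda>x. x"])
  then have 0: "(\<Sum>x\<in>{0..<K}. of_int (tchar D x) * J 0) = 0"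
    unfolding sum_distrib_right[symmetric] of_int_sum[symmetric] by simp
  have "char_sum D = (\<Sum>x\<in>{0..<K}. of_int (tchar D x) * J (of_int x / of_int K)) -
      (\<Sum>x\<in>{0..<K}. of_int (tchar D x) * J 0)"
    unfolding 0 by (simp add: char_sum_def K_def)
  also have "\<dots> = (\<Sum>x\<in>{0..<K}. of_int (tchar D x) * (J (of_int x / of_int K) - J 0))"
    by (simp add: sum_subtractf right_diff_distrib)
  finally have "coord e (char_sum D) = (\<Sum>x\<in>{0..<K}. of_int (tchar D x) * coord e (J (of_int x / of_int K) - J 0))"
    by (simp add: coord_sum coord_int)
  also have "\<dots> \<in> \<int>"
    using good_coprime[OF assms] K
    by (intro Ints_sum Ints_mult Ints_of_int coord_lattice J_lattice) (auto simp: K_def simp del: of_nat_prod)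
  finally show ?thesis .
qed

lemma coord_char_sum_other: "good D \<Longrightarrow> e \<noteq> even_char D \<Longrightarrow> coord e (char_sum D) = 0"
  using char_sum_cnj[of D] good_minus_1[of D]
  by (cases "even_char D") (auto simp: coord_def complex_eq_iff)

lemma norm_sum_eq:
  assumes "good D"
  shows "norm_sum D = of_real (coord (even_char D) (char_sum D))"
proof -
  have "char_sum D = (if even_char D then of_real (Re (char_sum D)) else \<i> * of_real (Im (char_sum D)))"
    using char_sum_cnj[OF assms] good_minus_1[OF assms] by (auto simp: complex_eq_iff)
  then show ?thesis
    using omega_pos by (subst norm_sum_def, elim ssubst) (simp add: period_def coord_def)
qed

lemma norm_sum_Int: "good D \<Longrightarrow> norm_sum D \<in> \<int>"
  using coord_char_sum_int[of D "even_char D"] by (auto simp: norm_sum_eq elim!: Ints_cases)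

lemma character_expansion:
  assumes Q: "good Q"
  shows "(\<Sum>D\<in>Pow Q. euler_coeff Q D * char_sum D) =
    (\<Sum>x\<in>{0..<4 * int (\<Prod>Q)}. of_int (chi4 x * (\<Prod>p\<in>Q. Legendre x (int p) + (Legendre x (int p))\<^sup>2)) *
        J (of_int x / of_int (4 * int (\<Prod>Q))))"
proof -
  have fin: "finite Q" using Q by (simp add: good_def)
  let ?K = "4 * int (\<Prod>Q)"
  have "(\<Sum>D\<in>Pow Q. euler_coeff Q D * char_sum D) =
      (\<Sum>D\<in>Pow Q. \<Sum>x\<in>{0..<?K}. of_int (tchar D x * cop_ind (Q - D) x) * J (of_int x / of_int ?K))"
  proof (intro sum.cong refl)
    fix D assume "D \<in> Pow Q"
    then have "D \<union> (Q - D) = Q" by auto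
    then show "euler_coeff Q D * char_sum D =
        (\<Sum>x\<in>{0..<?K}. of_int (tchar D x * cop_ind (Q - D) x) * J (of_int x / of_int ?K))"
      using imprimitive_char_sum[of D "Q - D"] Q by (simp add: euler_coeff_def)
  qed
  also have "\<dots> = (\<Sum>x\<in>{0..<?K}. \<Sum>D\<in>Pow Q. of_int (tchar D x * cop_ind (Q - D) x) * J (of_int x / of_int ?K))"
    by (rule sum.swap)
  also have "\<dots> = (\<Sum>x\<in>{0..<?K}. of_int (\<Sum>D\<in>Pow Q. tchar D x * cop_ind (Q - D) x) * J (of_int x / of_int ?K))"
    by (simp only: of_int_sum sum_distrib_right)
  also have "(\<lambda>x. \<Sum>D\<in>Pow Q. tchar D x * cop_ind (Q - D) x) =
      (\<lambda>x. chi4 x * (\<Prod>p\<in>Q. Legendre x (int p) + (Legendre x (int p))\<^sup>2))"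
    by (simp add: prod_add[OF fin] tchar_def cop_ind_def sum_distrib_left mult.assoc)
  finally show ?thesis .
qed

text \<open>Obtained from \<open>character_expansion\<close> by taking the coordinate that belongs
  to the parity of \<open>Q\<close>. The integer \<open>z\<close> is the sum, with signs
  \<open>chi4 x\<close>, of the coordinates of the periods \<open>J (x / K) - J 0\<close> over those
  \<open>x\<close> that are squares modulo every prime of \<open>Q\<close>.\<close>

lemma norm_sum_relation:
  assumes Q: "good Q"
  obtains z :: int where
    "(\<Sum>D\<in>{D \<in> Pow Q. even_char D = even_char Q}. euler_coeff Q D * norm_sum D) = 2 ^ card Q * of_int z"
    "(\<forall>p\<in>Q. Legendre (-1) (int p) = 1) \<longrightarrow> even z"
proof -
  define K where "K = 4 * int (\<Prod>Q)"
  define e where "e = even_char Q"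
  have fin: "finite Q" using Q by (simp add: good_def)
  have m: "int (\<Prod>Q) > 0" using good_pos[OF Q] by (simp del: of_nat_prod)
  then have K: "K > 0" by (simp add: K_def)
  define u where "u = (\<lambda>x. \<Prod>p\<in>Q. (if Legendre x (int p) = 1 then 1 else 0 :: int))"
  have u_cong: "u x = u y" if "[x = y] (mod int (\<Prod>Q))" for x y
    unfolding u_def by (rule Legendre_prod_cong[OF fin that, where h = "\<lambda>l. if l = 1 then 1 else 0"])
  define g where "g = (\<lambda>x. chi4 x * (\<Prod>p\<in>Q. Legendre x (int p) + (Legendre x (int p))\<^sup>2))"
  have g: "g x = 2 ^ card Q * (chi4 x * u x)" for x
  proof -
    have "Legendre x (int p) + (Legendre x (int p))\<^sup>2 = 2 * (if Legendre x (int p) = 1 then 1 else 0)" for p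
      using Legendre_values[of x "int p"] by auto
    then show ?thesis by (simp only: g_def u_def prod.distrib) simp
  qed
  have "\<exists>k. coord e (J (of_int x / of_int K) - J 0) = of_int k" for x
    using J_lattice[OF K, of x] good_coprime[OF Q] by (fold K_def) (metis Ints_cases coord_lattice)
  then obtain y where y: "\<And>x. coord e (J (of_int x / of_int K) - J 0) = of_int (y x)" by metis
  define z where "z = (\<Sum>x\<in>{0..<K}. chi4 x * u x * y x)"
  have zero: "(\<Sum>x\<in>{0..<K}. chi4 x * u x) = 0"
    unfolding K_def by (rule sum_chi4_times[OF Q u_cong])
  have "coord e (\<Sum>D\<in>Pow Q. euler_coeff Q D * char_sum D) =
      (\<Sum>x\<in>{0..<K}. of_int (g x) * coord e (J (of_int x / of_int K)))"
    unfolding character_expansion[OF Q] by (simp only: g_def K_def coord_sum coord_int)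
  also have "\<dots> = (\<Sum>x\<in>{0..<K}. of_int (g x) * (of_int (y x) + coord e (J 0)))"
    unfolding y[symmetric] by (simp add: coord_diff)
  also have "\<dots> = of_int (\<Sum>x\<in>{0..<K}. g x * y x) + of_int (\<Sum>x\<in>{0..<K}. g x) * coord e (J 0)"
    by (simp add: distrib_left sum.distrib sum_distrib_right)
  also have "(\<Sum>x\<in>{0..<K}. g x) = 0" by (simp only: g sum_distrib_left[symmetric] zero mult_zero_right)
  also have "(\<Sum>x\<in>{0..<K}. g x * y x) = 2 ^ card Q * z" by (simp add: g z_def sum_distrib_left mult_ac)
  finally have 1: "coord e (\<Sum>D\<in>Pow Q. euler_coeff Q D * char_sum D) = 2 ^ card Q * of_int z" by simp
  have "coord e (\<Sum>D\<in>Pow Q. euler_coeff Q D * char_sum D) =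
      (\<Sum>D\<in>Pow Q. Re (euler_coeff Q D) * coord e (char_sum D))"
    by (simp add: coord_sum coord_mult_real euler_coeff_real)
  also have "\<dots> = (\<Sum>D\<in>{D \<in> Pow Q. even_char D = even_char Q}. Re (euler_coeff Q D) * coord e (char_sum D))"
  proof (rule sum.mono_neutral_right)
    show "\<forall>D\<in>Pow Q - {D \<in> Pow Q. even_char D = even_char Q}. Re (euler_coeff Q D) * coord e (char_sum D) = 0"
    proof
      fix D assume "D \<in> Pow Q - {D \<in> Pow Q. even_char D = even_char Q}"
      then have "good D" "e \<noteq> even_char D" using good_subset[OF Q] by (auto simp: e_def)
      then show "Re (euler_coeff Q D) * coord e (char_sum D) = 0" by (simp add: coord_char_sum_other)
    qed
  qed (use fin in auto)
  finally have 2: "2 ^ card Q * of_int z =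
      (\<Sum>D\<in>{D \<in> Pow Q. even_char D = even_char Q}. Re (euler_coeff Q D) * coord e (char_sum D))"
    using 1 by simp
  have "euler_coeff Q D * norm_sum D = of_real (Re (euler_coeff Q D) * coord e (char_sum D))"
    if "D \<subseteq> Q" "even_char D = even_char Q" for D
    using that good_subset[OF Q] norm_sum_eq[of D] euler_coeff_real[of Q D]
    by (simp add: e_def)
  then have "(\<Sum>D\<in>{D \<in> Pow Q. even_char D = even_char Q}. euler_coeff Q D * norm_sum D) =
      of_real (\<Sum>D\<in>{D \<in> Pow Q. even_char D = even_char Q}. Re (euler_coeff Q D) * coord e (char_sum D))"
    unfolding of_real_sum by (intro sum.cong) auto
  also have "\<dots> = 2 ^ card Q * of_int z" unfolding 2[symmetric] by simp
  finally have A: "(\<Sum>D\<in>{D \<in> Pow Q. even_char D = even_char Q}. euler_coeff Q D * norm_sum D) = 2 ^ card Q * of_int z" .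
  have B: "even z" if leg: "\<forall>p\<in>Q. Legendre (-1) (int p) = 1"
  proof -
    have "chi4 (-1) = -1" by (simp add: chi4_def)
    \<comment> \<open>When -1 is a square modulo all primes of \<open>Q\<close>, \<open>chi4\<close>
      alone decides the parity. The relevant coordinate is then the imaginary one, which is odd
      under \<open>x \<mapsto> - x\<close>; so is \<open>chi4\<close>, while \<open>u\<close> is
      even. The summand is therefore even, and it vanishes at even arguments, in particular at the
      two fixed residues.\<close>
    then have "\<not> e" using leg by (simp add: e_def even_char_def tchar_def)
    have y_minus: "y (- x) = - y x" for x
    proof -
      have "Im (J 0) = 0" using J_minus[of 0] by (simp add: complex_eq_iff)
      then have "coord e (J (of_int (- x) / of_int K) - J 0) = - coord e (J (of_int x / of_int K) - J 0)"
        using \<open>\<not> e\<close> J_minus[of "of_int x / of_int K"] by (simp add: coord_def)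
      then show ?thesis unfolding y by linarith
    qed
    have u_minus: "u (- x) = u x" for x
      unfolding u_def
    proof (intro prod.cong refl)
      fix p assume p: "p \<in> Q"
      then have "Legendre (-1 * x) (int p) = Legendre (-1) (int p) * Legendre x (int p)"
        using Q by (intro Legendre_mult) (auto simp: good_def odd_prime_gt_2)
      then show "(if Legendre (- x) (int p) = 1 then 1 else 0) = (if Legendre x (int p) = 1 then 1 else 0 :: int)"
        using leg p by simp
    qed
    have chi_minus: "chi4 (- x) = - chi4 x" for x
      using chi4_mult[of "-1" x] \<open>chi4 (-1) = -1\<close> by simp
    have "even (\<Sum>x\<in>{0..<4 * int (\<Prod>Q)}. chi4 x * u x * y x)"
    proof (rule sum_even_function[OF m])
      fix v w assume vw: "[v = w] (mod 4 * int (\<Prod>Q))"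
      have "[v = w] (mod 4)" "[v = w] (mod int (\<Prod>Q))"
        by (rule cong_dvd_modulus[OF vw]; simp)+
      moreover have "real_of_int (y v) = real_of_int (y w)"
        using J_cong[OF K] vw unfolding y[symmetric] K_def[symmetric] by simp
      ultimately show "chi4 v * u v * y v = chi4 w * u w * y w"
        using chi4_cong u_cong by (metis of_int_eq_iff)
    qed (auto simp: chi_minus u_minus y_minus chi4_eq_0_iff[THEN iffD2])
    then show ?thesis by (simp only: z_def K_def)
  qed
  from A B that show ?thesis by blast
qed

end

section \<open>2-adic valuations of the character sums\<close>

lemma sum_in_Rats: "(\<And>x. x \<in> A \<Longrightarrow> f x \<in> \<rat>) \<Longrightarrow> sum f A \<in> (\<rat> :: 'a :: field_char_0 set)"
  by (induction A rule: infinite_finite_induct) auto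

lemma prod_in_Rats: "(\<And>x. x \<in> A \<Longrightarrow> f x \<in> \<rat>) \<Longrightarrow> prod f A \<in> (\<rat> :: 'a :: field_char_0 set)"
  by (induction A rule: infinite_finite_induct) auto

text \<open>The valuation is constrained at algebraic numbers only, so Gauss sums and their
  quotients must be seen to be algebraic before it is applied to them.\<close>

lemma algebraic_if_square_rat:
  assumes "(y :: complex)\<^sup>2 \<in> \<rat>"
  shows "algebraic y"
proof -
  have "algebraic (csqrt (y\<^sup>2))" using assms rat_imp_algebraic by blast
  moreover have "y = csqrt (y\<^sup>2) \<or> y = - csqrt (y\<^sup>2)"
    by (metis power2_csqrt power2_eq_iff)
  ultimately show ?thesis by (metis algebraic_minus_iff)
qed

locale two_adic =
  fixes v :: "complex \<Rightarrow> ereal"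
  assumes valuation: "two_adic_valuation v"
begin

lemma v_0 [simp]: "v 0 = \<infinity>" and v_2: "v 2 = 1"
  using valuation by (auto simp: two_adic_valuation_def)

lemma v_real: "algebraic x \<Longrightarrow> x \<noteq> 0 \<Longrightarrow> \<exists>r. v x = ereal r"
  using valuation unfolding two_adic_valuation_def by blast

lemma v_mult: "algebraic x \<Longrightarrow> algebraic y \<Longrightarrow> v (x * y) = v x + v y"
  using valuation unfolding two_adic_valuation_def by blast

lemma v_add: "x \<in> \<rat> \<Longrightarrow> y \<in> \<rat> \<Longrightarrow> min (v x) (v y) \<le> v (x + y)"
  using valuation rat_imp_algebraic unfolding two_adic_valuation_def by blast

lemma v_mult_rat: "x \<in> \<rat> \<Longrightarrow> y \<in> \<rat> \<Longrightarrow> v (x * y) = v x + v y"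
  by (intro v_mult rat_imp_algebraic)

lemma v_square_unit:
  assumes "algebraic x" "x * x = y" "v y = 0"
  shows "v x = 0"
proof -
  have "v x + v x = 0" using v_mult[OF assms(1,1)] assms by simp
  moreover have "x \<noteq> 0" using assms by auto
  then obtain r where "v x = ereal r" using v_real assms(1) by blast
  ultimately show ?thesis by (simp flip: zero_ereal_def)
qed

lemma v_1 [simp]: "v 1 = 0"
proof -
  have "v 1 + v 1 = v 1" using v_mult_rat[of 1 1] by simp
  moreover obtain r where "v 1 = ereal r" using v_real[of 1] rat_imp_algebraic[of 1] by auto
  ultimately show ?thesis by (simp flip: zero_ereal_def)
qed

lemma v_minus_1 [simp]: "v (-1) = 0"
  by (rule v_square_unit[of _ 1]) (auto intro: rat_imp_algebraic)

lemma v_ii [simp]: "v \<i> = 0"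
  by (rule v_square_unit[of _ "-1"]) auto

lemma v_minus: "x \<in> \<rat> \<Longrightarrow> v (- x) = v x"
  using v_mult_rat[of "-1" x] by simp

lemma v_add_ge: "x \<in> \<rat> \<Longrightarrow> y \<in> \<rat> \<Longrightarrow> c \<le> v x \<Longrightarrow> c \<le> v y \<Longrightarrow> c \<le> v (x + y)"
  using v_add[of x y] by (meson min.boundedI order_trans)

lemma v_diff_ge: "x \<in> \<rat> \<Longrightarrow> y \<in> \<rat> \<Longrightarrow> c \<le> v x \<Longrightarrow> c \<le> v y \<Longrightarrow> c \<le> v (x - y)"
  using v_add_ge[of x "- y" c] by (simp add: v_minus)

lemma v_sum_ge: "(\<And>x. x \<in> A \<Longrightarrow> f x \<in> \<rat>) \<Longrightarrow> (\<And>x. x \<in> A \<Longrightarrow> c \<le> v (f x)) \<Longrightarrow> c \<le> v (sum f A)"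
proof (induction A rule: infinite_finite_induct)
  case (insert x F)
  then show ?case by (auto intro!: v_add_ge sum_in_Rats)
qed auto

lemma v_int_ge_0: "0 \<le> v (of_int k)"
proof -
  have nat: "0 \<le> v (of_nat n)" for n
    by (induction n) (auto intro!: v_add_ge)
  show ?thesis
    using nat[of "nat k"] nat[of "nat (- k)"] v_minus[of "of_int k"] by (cases "k \<ge> 0") auto
qed

lemma v_even_ge_1:
  assumes "even k"
  shows "1 \<le> v (of_int k)"
proof -
  obtain j where "k = 2 * j" using assms by auto
  then show ?thesis using v_mult_rat[of 2 "of_int j"] v_int_ge_0[of j] by (simp add: v_2 add_increasing2)
qed

text \<open>1 is the difference of an odd and an even number, so a positive valuation of the odd one
  would give 1 a positive valuation.\<close>

lemma v_odd:
  assumes "odd k"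
  shows "v (of_int k) = 0"
proof (rule antisym)
  show "v (of_int k) \<le> 0"
  proof (rule ccontr)
    assume "\<not> v (of_int k) \<le> 0"
    then have *: "0 < min 1 (v (of_int k))" by simp
    also have "min 1 (v (of_int k)) \<le> v (of_int k - of_int (k - 1))"
      using assms by (intro v_diff_ge Rats_of_int min.cobounded2 min.coboundedI1 v_even_ge_1) simp
    finally show False by simp
  qed
qed (rule v_int_ge_0)

text \<open>The residue field of Q at 2 has two elements: in lowest terms a rational unit has odd
  numerator and odd denominator, whose sum is even. This is where rationality, beyond algebraicity,
  enters.\<close>

lemma v_unit_plus_1:
  assumes u: "u \<in> \<rat>" "v u = 0"
  shows "1 \<le> v (u + 1)"
proof -
  obtain n d where nd: "d > 0" "coprime n d" "u = of_int n / of_int d" using u(1) by (elim Rats_cases')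
  then have n: "of_int n = u * of_int d" by simp
  then have vn: "v (of_int n) = v (of_int d)" using v_mult_rat[of u "of_int d"] u by simp
  have "odd n \<and> odd d"
  proof (rule ccontr)
    assume "\<not> ?thesis"
    moreover have "odd n \<or> odd d" using nd(2) by (meson coprime_common_divisor odd_one)
    ultimately show False using vn v_even_ge_1[of n] v_even_ge_1[of d] v_odd[of n] v_odd[of d] by auto
  qed
  then have "1 \<le> v (of_int (n + d))" "v (of_int d) = 0" by (intro v_even_ge_1 v_odd; simp)+
  moreover have "of_int (n + d) = (u + 1) * of_int d" using nd by (simp add: field_simps)
  ultimately show ?thesis using v_mult_rat[of "u + 1" "of_int d"] u(1) by simp
qed

text \<open>\<open>x + y = (x / y + 1) * y\<close>, where \<open>x / y\<close> is a rational
  unit.\<close>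

lemma v_add_eq_1:
  assumes "x \<in> \<rat>" "y \<in> \<rat>" "v x = 1" "v y = 1"
  shows "2 \<le> v (x + y)"
proof -
  have y0: "y \<noteq> 0" using assms by auto
  then have xy: "x = (x / y) * y" by simp
  have "v x = v (x / y) + v y" using v_mult_rat[of "x / y" y] assms y0 by simp
  moreover have "x \<noteq> 0" using assms by auto
  then obtain r where "v (x / y) = ereal r"
    using v_real[of "x / y"] assms y0 rat_imp_algebraic[of "x / y"] by auto
  ultimately have "v (x / y) = 0" using assms(3,4) by (simp add: one_ereal_def zero_ereal_def)
  then have "1 \<le> v (x / y + 1)" using assms by (intro v_unit_plus_1) auto
  moreover have "x + y = (x / y + 1) * y" using y0 by (simp add: field_simps)
  ultimately have "1 + 1 \<le> v (x + y)"
    using v_mult_rat[of "x / y + 1" y] assms(1,2,4) add_right_mono[of 1 "v (x / y + 1)" "1::ereal"] by (simp del: one_add_one)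
  then show ?thesis by (simp only: one_add_one)
qed

lemma v_add_eq:
  assumes "x \<in> \<rat>" "y \<in> \<rat>" "v x < v y"
  shows "v (x + y) = v x"
proof (rule antisym)
  show "v (x + y) \<le> v x"
  proof (rule ccontr)
    assume "\<not> ?thesis"
    then have "v x < min (v (x + y)) (v y)" using assms by simp
    also have "\<dots> \<le> v (x + y - y)" using assms by (intro v_diff_ge) auto
    finally show False by simp
  qed
qed (use assms in \<open>intro v_add_ge; simp\<close>)

text \<open>Rationals of valuation 1 are all congruent to 2 modulo valuation 2, so only the parity
  of their number matters.\<close>

lemma v_sum_parity:
  assumes "finite A" "\<And>x. x \<in> A \<Longrightarrow> f x \<in> \<rat>" "\<And>x. x \<in> A \<Longrightarrow> v (f x) = 1"
  shows "(even (card A) \<longrightarrow> 2 \<le> v (sum f A)) \<and> (odd (card A) \<longrightarrow> v (sum f A) = 1)"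
  using assms
proof (induction A rule: finite_induct)
  case (insert x F)
  then have r: "f x \<in> \<rat>" "v (f x) = 1" "sum f F \<in> \<rat>" by (auto intro!: sum_in_Rats)
  have IH: "(even (card F) \<longrightarrow> 2 \<le> v (sum f F)) \<and> (odd (card F) \<longrightarrow> v (sum f F) = 1)"
    using insert by auto
  have "v (f x + sum f F) = 1" if "2 \<le> v (sum f F)"
  proof -
    have "v (f x) < v (sum f F)" using that r(2) by (auto intro: less_le_trans[of _ 2])
    then show ?thesis using v_add_eq r by simp
  qed
  moreover have "2 \<le> v (f x + sum f F)" if "v (sum f F) = 1"
    using that r v_add_eq_1 by simp
  ultimately show ?case using IH insert.hyps by auto
qed auto

lemma v_prod: "finite A \<Longrightarrow> (\<And>x. x \<in> A \<Longrightarrow> f x \<in> \<rat>) \<Longrightarrow> v (prod f A) = (\<Sum>x\<in>A. v (f x))"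
proof (induction A rule: finite_induct)
  case (insert x F)
  then have "v (f x * prod f F) = v (f x) + v (prod f F)" by (intro v_mult_rat prod_in_Rats) auto
  with insert show ?case by simp
qed simp

lemma v_2_power: "v (2 ^ n) = ereal n"
proof (induction n)
  case (Suc n)
  have "v (2 * 2 ^ n) = v 2 + v (2 ^ n)" by (intro v_mult_rat) auto
  with Suc show ?case by (simp add: v_2 one_ereal_def)
qed auto

text \<open>\<open>w\<close> has valuation 1 because its square is 4 times an odd number up to sign.
  The quotient is algebraic because its own square is rational.\<close>

lemma v_div_sqrt:
  assumes x: "x \<in> \<rat>" and w: "w * w = of_int (s * (4 * k))" "s \<in> {1, -1}" "odd k"
  shows "v (x / w) = v x - 1"
proof -
  have "k \<noteq> 0" using w by auto
  have s: "v (of_int s) = 0" using w(2) by auto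
  have w0: "w \<noteq> 0" using w \<open>k \<noteq> 0\<close> by auto
  have aw: "algebraic w"
    using w(1) by (intro algebraic_if_square_rat) (simp add: power2_eq_square del: of_int_mult)
  have "v (of_int (s * (4 * k))) = v (of_int s * (2 * (2 * of_int k)))" by (simp add: mult_ac)
  also have "\<dots> = 2"
    using v_mult_rat[of "of_int s" "2 * (2 * of_int k)"] v_mult_rat[of 2 "2 * of_int k"] v_mult_rat[of 2 "of_int k"]
    by (simp add: s v_2 v_odd w)
  finally have "v w + v w = 2" using w(1) v_mult[OF aw aw] by simp
  moreover obtain r where r: "v w = ereal r" using v_real[OF aw w0] by auto
  ultimately have "v w = 1" by (simp add: numeral_eq_ereal one_ereal_def)
  have "(x / w)\<^sup>2 = x * x / of_int (s * (4 * k))" using w(1) by (simp add: power2_eq_square)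
  then have "algebraic (x / w)" using x by (intro algebraic_if_square_rat) (auto intro!: Rats_divide simp del: of_int_mult)
  then have "v x = v (x / w) + v w" using v_mult[OF _ aw, of "x / w"] w0 by simp
  then show ?thesis using \<open>v w = 1\<close> by (simp add: one_ereal_def minus_ereal_def add.assoc)
qed

end

section \<open>Valuation bounds by induction over the set of primes\<close>

locale twisted_bounds = modular_symbols + two_adic
begin

lemma good_empty: "good {}"
  by (simp add: good_def)

lemma norm_sum_rat: "good D \<Longrightarrow> norm_sum D \<in> \<rat>"
  using norm_sum_Int[of D] by (auto elim!: Ints_cases)

definition lower_terms :: "nat set \<Rightarrow> nat set set" where
  "lower_terms Q = {D. D \<subset> Q \<and> even_char D = even_char Q}"

lemma euler_coeff_self: "euler_coeff Q Q = 1"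
  by (simp add: euler_coeff_def)

lemma norm_sum_recursion:
  assumes Q: "good Q"
  obtains z :: int where
    "norm_sum Q = 2 ^ card Q * of_int z - (\<Sum>D\<in>lower_terms Q. euler_coeff Q D * norm_sum D)"
    "(\<forall>p\<in>Q. Legendre (-1) (int p) = 1) \<longrightarrow> even z"
proof -
  obtain z :: int where z:
    "(\<Sum>D\<in>{D \<in> Pow Q. even_char D = even_char Q}. euler_coeff Q D * norm_sum D) = 2 ^ card Q * of_int z"
    "(\<forall>p\<in>Q. Legendre (-1) (int p) = 1) \<longrightarrow> even z"
    using norm_sum_relation[OF Q] by blast
  have fin: "finite Q" using Q by (simp add: good_def)
  have ins: "{D \<in> Pow Q. even_char D = even_char Q} = insert Q (lower_terms Q)" by (auto simp: lower_terms_def)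
  have "finite (lower_terms Q)"
    using fin by (auto simp: lower_terms_def intro: finite_subset[of _ "Pow Q"])
  moreover have "Q \<notin> lower_terms Q" by (auto simp: lower_terms_def)
  ultimately have "norm_sum Q + (\<Sum>D\<in>lower_terms Q. euler_coeff Q D * norm_sum D) =
      (\<Sum>D\<in>insert Q (lower_terms Q). euler_coeff Q D * norm_sum D)"
    by (simp add: euler_coeff_self)
  also have "\<dots> = 2 ^ card Q * of_int z" using z(1) unfolding ins .
  finally have "norm_sum Q + (\<Sum>D\<in>lower_terms Q. euler_coeff Q D * norm_sum D) = 2 ^ card Q * of_int z" .
  then have "norm_sum Q = 2 ^ card Q * of_int z - (\<Sum>D\<in>lower_terms Q. euler_coeff Q D * norm_sum D)"
    by (simp only: eq_diff_eq)
  with z(2) that show ?thesis by blast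
qed

text \<open>\<open>q\<close> lies outside \<open>D\<close> and is odd, so the character value is a
  sign. The value \<open>a q + 2\<close> is written as \<open>(a q - 2) + 4\<close> because the
  hypotheses concern \<open>a q - 2\<close>, and 4 has valuation 2.\<close>

lemma euler_factor:
  assumes "good Q" "D \<subseteq> Q" "q \<in> Q - D"
  shows "a q - 2 * of_int (tchar D (int q)) \<in> {a q - 2, (a q - 2) + 4}"
proof -
  have "\<not> int p dvd int q" if "p \<in> D" for p
    using that assms by (metis DiffD1 DiffD2 good_def int_dvd_int_iff primes_dvd_imp_eq subsetD)
  then have "tchar D (int q) \<noteq> 0"
    using assms good_subset[of Q D] by (auto simp: tchar_eq_0_iff good_def)
  then show ?thesis using tchar_values[of D "int q"] by auto
qed

lemma v_4: "v 4 = 2"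
  using v_2_power[of 2] by simp

lemma v_euler_factor_ge:
  assumes "good Q" "D \<subseteq> Q" "q \<in> Q - D" "c \<le> v (a q - 2)" "c \<le> 2"
  shows "c \<le> v (a q - 2 * of_int (tchar D (int q)))"
proof -
  have "c \<le> v ((a q - 2) + 4)" using assms(4,5) a_rat[of q] by (intro v_add_ge) (simp_all add: v_4)
  then show ?thesis using euler_factor[OF assms(1-3)] assms(4) by (metis insert_iff empty_iff)
qed

lemma v_euler_factor_eq:
  assumes "good Q" "D \<subseteq> Q" "q \<in> Q - D" "v (a q - 2) = 0"
  shows "v (a q - 2 * of_int (tchar D (int q))) = 0"
proof -
  have "v ((a q - 2) + 4) = 0" using assms(4) a_rat[of q] v_add_eq[of "a q - 2" 4] by (simp add: v_4)
  then show ?thesis using euler_factor[OF assms(1-3)] assms(4) by (metis insert_iff empty_iff)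
qed

lemma euler_factor_rat: "a q - 2 * of_int (tchar D (int q)) \<in> \<rat>"
  using a_rat by (intro Rats_diff Rats_mult) auto

text \<open>For the empty set the condition on -1 holds vacuously, so the integer is even.
  Concretely, \<open>char_sum {}\<close> is \<open>J (1/4) - J (3/4)\<close>, the difference of two
  conjugate numbers.\<close>

lemma v_norm_sum_empty: "1 \<le> v (norm_sum {})"
proof -
  obtain z :: int where "norm_sum {} = of_int z" "even z"
    using norm_sum_recursion[OF good_empty] by (auto simp: lower_terms_def)
  then show ?thesis using v_even_ge_1 by simp
qed

lemma v_leading_term: "c \<le> ereal (card Q) \<Longrightarrow> c \<le> v (2 ^ card Q * of_int z)"
  using v_mult_rat[of "2 ^ card Q" "of_int z"] v_int_ge_0[of z] by (simp add: v_2_power add_increasing2)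

lemma v_leading_term_even:
  assumes "even z" "c \<le> ereal (card Q) + 1"
  shows "c \<le> v (2 ^ card Q * of_int z)"
proof -
  note assms(2)
  also have "ereal (card Q) + 1 \<le> ereal (card Q) + v (of_int z)"
    using assms(1) by (intro add_left_mono v_even_ge_1)
  also have "\<dots> = v (2 ^ card Q * of_int z)"
    using v_mult_rat[of "2 ^ card Q" "of_int z"] by (simp add: v_2_power)
  finally show ?thesis .
qed

lemma v_norm_sum_ge:
  assumes Q: "good Q"
    and lead: "\<And>z :: int. (\<forall>p\<in>Q. Legendre (-1) (int p) = 1) \<longrightarrow> even z \<Longrightarrow> c \<le> v (2 ^ card Q * of_int z)"
    and low: "\<And>D. D \<subset> Q \<Longrightarrow> even_char D = even_char Q \<Longrightarrow> c \<le> v (euler_coeff Q D * norm_sum D)"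
  shows "c \<le> v (norm_sum Q)"
proof -
  obtain z :: int where z:
    "norm_sum Q = 2 ^ card Q * of_int z - (\<Sum>D\<in>lower_terms Q. euler_coeff Q D * norm_sum D)"
    "(\<forall>p\<in>Q. Legendre (-1) (int p) = 1) \<longrightarrow> even z"
    using norm_sum_recursion[OF Q] by blast
  have low_rat: "euler_coeff Q D * norm_sum D \<in> \<rat>" if "D \<in> lower_terms Q" for D
    using that good_subset[OF Q, of D]
    by (intro Rats_mult euler_coeff_rat norm_sum_rat) (auto simp: lower_terms_def)
  have low': "c \<le> v (euler_coeff Q D * norm_sum D)" if "D \<in> lower_terms Q" for D
    using that low by (simp add: lower_terms_def)
  have "(2::complex) ^ card Q * of_int z \<in> \<rat>" by simp
  then show ?thesis
    unfolding z(1) using z(2) by (intro v_diff_ge v_sum_ge sum_in_Rats lead low_rat low')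
qed

lemma v_coeff_mult: "good D \<Longrightarrow> v (euler_coeff Q D * norm_sum D) = v (euler_coeff Q D) + v (norm_sum D)"
  by (intro v_mult_rat euler_coeff_rat norm_sum_rat)

lemma v_euler_coeff:
  "good Q \<Longrightarrow> v (euler_coeff Q D) = (\<Sum>q\<in>Q - D. v (a q - 2 * of_int (tchar D (int q))))"
  unfolding euler_coeff_def by (intro v_prod euler_factor_rat) (simp add: good_def)

lemma v_euler_coeff_ge_0:
  assumes "good Q" "D \<subseteq> Q" "\<And>q. q \<in> Q \<Longrightarrow> 0 \<le> v (a q - 2)"
  shows "0 \<le> v (euler_coeff Q D)"
  unfolding v_euler_coeff[OF assms(1)] using assms
  by (intro sum_nonneg v_euler_factor_ge[OF assms(1,2)]) auto

lemma v_euler_coeff_ge_card: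
  assumes "good Q" "D \<subseteq> Q" "\<And>q. q \<in> Q \<Longrightarrow> 1 \<le> v (a q - 2)"
  shows "ereal (card (Q - D)) \<le> v (euler_coeff Q D)"
proof -
  have "(\<Sum>q\<in>Q - D. 1) \<le> v (euler_coeff Q D)"
    unfolding v_euler_coeff[OF assms(1)] using assms
    by (intro sum_mono v_euler_factor_ge[OF assms(1,2)]) auto
  moreover have "(\<Sum>q\<in>F. 1) = ereal (card F)" for F :: "nat set"
    by (simp add: one_ereal_def)
  ultimately show ?thesis by simp
qed

lemma card_split: "finite Q \<Longrightarrow> D \<subseteq> Q \<Longrightarrow> ereal (card Q) = ereal (card (Q - D)) + ereal (card D)"
  using card_Diff_subset[of D Q] card_mono[of Q D] finite_subset[of D Q] by simp

text \<open>The common frame of the four lower bounds below, with \<open>c\<close> giving the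
  claimed bound as a function of the subset. Condition \<open>low\<close> says that the Euler
  coefficient supplies whatever \<open>c\<close> gains in passing from \<open>D\<close> to
  \<open>R\<close>.\<close>

lemma v_norm_sum_induct:
  assumes Q: "good Q"
    and base: "c {} \<le> v (norm_sum {})"
    and lead: "\<And>R z :: int. R \<subseteq> Q \<Longrightarrow> R \<noteq> {} \<Longrightarrow>
      (\<forall>p\<in>R. Legendre (-1) (int p) = 1) \<longrightarrow> even z \<Longrightarrow> c R \<le> v (2 ^ card R * of_int z)"
    and low: "\<And>D R. D \<subset> R \<Longrightarrow> R \<subseteq> Q \<Longrightarrow> c R \<le> v (euler_coeff R D) + c D"
  shows "c Q \<le> v (norm_sum Q)"
proof -
  have "c R \<le> v (norm_sum R)" if "finite R" "R \<subseteq> Q" for R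
    using that
  proof (induction R rule: finite_psubset_induct)
    case (psubset R)
    show ?case
    proof (cases "R = {}")
      case False
      have gR: "good R" using good_subset[OF Q psubset.prems] .
      show ?thesis
      proof (rule v_norm_sum_ge[OF gR])
        fix D assume D: "D \<subset> R"
        then have gD: "good D" using good_subset gR by blast
        have "c R \<le> v (euler_coeff R D) + c D" using D psubset.prems by (rule low)
        also have "\<dots> \<le> v (euler_coeff R D) + v (norm_sum D)"
          using D psubset.prems by (intro add_left_mono psubset.IH) auto
        finally show "c R \<le> v (euler_coeff R D * norm_sum D)" by (simp add: v_coeff_mult gD)
      qed (use lead psubset.prems False in blast)
    qed (use base in simp)
  qed
  then show ?thesis using Q by (simp add: good_def)
qed

text \<open>Each prime of \<open>R\<close> missing from \<open>D\<close> contributes an Euler factor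
  of valuation at least 1, so a bound that counts primes reproduces itself.\<close>

lemma euler_coeff_card:
  assumes "good Q" "\<And>q. q \<in> Q \<Longrightarrow> 1 \<le> v (a q - 2)" "D \<subset> R" "R \<subseteq> Q"
  shows "ereal (card R) \<le> v (euler_coeff R D) + ereal (card D)"
proof -
  have gR: "good R" using good_subset assms by blast
  then have "ereal (card (R - D)) \<le> v (euler_coeff R D)"
    using assms by (intro v_euler_coeff_ge_card) auto
  then have "ereal (card (R - D)) + ereal (card D) \<le> v (euler_coeff R D) + ereal (card D)"
    by (rule add_right_mono)
  moreover have "finite R" using gR by (simp add: good_def)
  ultimately show ?thesis using card_split[of R D] assms(3) by auto
qed

lemma euler_coeff_add_ge:
  assumes "good Q" "\<And>q. q \<in> Q \<Longrightarrow> 0 \<le> v (a q - 2)" "D \<subset> R" "R \<subseteq> Q"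
  shows "c \<le> v (euler_coeff R D) + c"
proof -
  have "0 \<le> v (euler_coeff R D)"
    using assms good_subset by (intro v_euler_coeff_ge_0) blast+
  then show ?thesis using add_right_mono[of 0 _ c] by simp
qed

lemma card_pos: "good Q \<Longrightarrow> R \<subseteq> Q \<Longrightarrow> R \<noteq> {} \<Longrightarrow> 1 \<le> card R"
  by (auto simp: good_def Suc_le_eq card_gt_0_iff intro: finite_subset)

lemma v_norm_sum_ge_card:
  assumes "good Q" "\<And>q. q \<in> Q \<Longrightarrow> 1 \<le> v (a q - 2)"
  shows "ereal (card Q) \<le> v (norm_sum Q)"
proof (rule v_norm_sum_induct[OF assms(1)])
  show "ereal (card {}) \<le> v (norm_sum {})"
    using order_trans[OF _ v_norm_sum_empty, of 0] by (simp flip: zero_ereal_def)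
qed (use euler_coeff_card[OF assms] in \<open>auto intro: v_leading_term\<close>)

lemma v_norm_sum_ge_1:
  assumes "good Q" "\<And>q. q \<in> Q \<Longrightarrow> 0 \<le> v (a q - 2)"
  shows "1 \<le> v (norm_sum Q)"
proof (rule v_norm_sum_induct[OF assms(1) v_norm_sum_empty])
  fix R and z :: int assume "R \<subseteq> Q" "R \<noteq> {}"
  then show "1 \<le> v (2 ^ card R * of_int z)"
    using card_pos[OF assms(1)] by (intro v_leading_term) (simp add: one_ereal_def)
qed (rule euler_coeff_add_ge[OF assms])

text \<open>The extra 1 is present in the base case, where \<open>norm_sum {}\<close> is even, and
  in the leading terms, where \<open>z\<close> is even; the recursion passes it on.\<close>

lemma v_norm_sum_ge_Suc_card:
  assumes "good Q" "\<And>q. q \<in> Q \<Longrightarrow> 1 \<le> v (a q - 2)" "\<And>q. q \<in> Q \<Longrightarrow> Legendre (-1) (int q) = 1"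
  shows "ereal (card Q) + 1 \<le> v (norm_sum Q)"
proof (rule v_norm_sum_induct[OF assms(1)])
  show "ereal (card {}) + 1 \<le> v (norm_sum {})" using v_norm_sum_empty by (simp flip: zero_ereal_def one_ereal_def)
  fix R and z :: int assume "R \<subseteq> Q" "(\<forall>p\<in>R. Legendre (-1) (int p) = 1) \<longrightarrow> even z"
  then have "even z" using assms(3) by blast
  then show "ereal (card R) + 1 \<le> v (2 ^ card R * of_int z)" by (rule v_leading_term_even) simp
next
  fix D R assume "D \<subset> R" "R \<subseteq> Q"
  then have "ereal (card R) + 1 \<le> v (euler_coeff R D) + ereal (card D) + 1"
    by (intro add_right_mono euler_coeff_card[OF assms(1,2)])
  then show "ereal (card R) + 1 \<le> v (euler_coeff R D) + (ereal (card D) + 1)"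
    by (simp only: add.assoc)
qed

text \<open>Euler coefficients that are merely integral cannot make the bound grow with
  \<open>Q\<close>. A leading term with even \<open>z\<close> has valuation at least
  \<open>card R + 1\<close>, hence at least 2, and the only other limit is the base case.\<close>

lemma v_norm_sum_ge_min:
  assumes "good Q" "\<And>q. q \<in> Q \<Longrightarrow> 0 \<le> v (a q - 2)" "\<And>q. q \<in> Q \<Longrightarrow> Legendre (-1) (int q) = 1"
  shows "min 2 (v (norm_sum {})) \<le> v (norm_sum Q)"
proof (rule v_norm_sum_induct[OF assms(1)])
  fix R and z :: int
  assume R: "R \<subseteq> Q" "R \<noteq> {}" "(\<forall>p\<in>R. Legendre (-1) (int p) = 1) \<longrightarrow> even z"
  then have "even z" using assms(3) by blast
  moreover have "(2::ereal) \<le> ereal (card R) + 1"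
    using card_pos[OF assms(1) R(1,2)] by (simp add: one_ereal_def numeral_eq_ereal)
  ultimately show "min 2 (v (norm_sum {})) \<le> v (2 ^ card R * of_int z)"
    by (intro v_leading_term_even min.coboundedI1)
qed (use euler_coeff_add_ge[OF assms(1,2)] in auto)

text \<open>All subsets of \<open>Q\<close> are odd characters, so every one of the
  \<open>2 ^ card Q - 1\<close> proper subsets appears. That number is odd, each term has valuation
  exactly 1, and the leading term has valuation at least 2.\<close>

lemma v_norm_sum_eq_1:
  assumes "good Q" "\<And>q. q \<in> Q \<Longrightarrow> v (a q - 2) = 0" "\<And>q. q \<in> Q \<Longrightarrow> Legendre (-1) (int q) = 1"
    and one: "v (norm_sum {}) = 1"
  shows "v (norm_sum Q) = 1"
proof -
  have "finite Q" using assms by (simp add: good_def)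
  then show ?thesis using assms(1-3)
  proof (induction Q rule: finite_psubset_induct)
    case (psubset Q)
    show ?case
    proof (cases "Q = {}")
      case False
      obtain z :: int where z:
        "norm_sum Q = 2 ^ card Q * of_int z - (\<Sum>D\<in>lower_terms Q. euler_coeff Q D * norm_sum D)"
        "(\<forall>p\<in>Q. Legendre (-1) (int p) = 1) \<longrightarrow> even z"
        using norm_sum_recursion[OF psubset.prems(1)] by blast
      let ?S = "\<Sum>D\<in>lower_terms Q. euler_coeff Q D * norm_sum D"
      have "even_char D = even_char Q" if "D \<subseteq> Q" for D
      proof -
        have "tchar E (-1) = -1" if "E \<subseteq> Q" for E
        proof -
          have "(\<Prod>p\<in>E. Legendre (-1) (int p)) = 1"
            using that psubset.prems(3) by (intro prod.neutral) auto
          then show ?thesis by (simp add: tchar_def chi4_def)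
        qed
        then show ?thesis using that by (simp add: even_char_def)
      qed
      then have lt: "lower_terms Q = Pow Q - {Q}" unfolding lower_terms_def by blast
      have rat: "euler_coeff Q D * norm_sum D \<in> \<rat>" if "D \<in> lower_terms Q" for D
        using that good_subset[OF psubset.prems(1), of D]
        by (intro Rats_mult euler_coeff_rat norm_sum_rat) (auto simp: lt)
      have "v (euler_coeff Q D * norm_sum D) = 1" if D: "D \<in> lower_terms Q" for D
      proof -
        have D': "D \<subset> Q" using D lt by auto
        then have gD: "good D" using good_subset psubset.prems(1) by blast
        have "v (euler_coeff Q D) = 0"
          unfolding v_euler_coeff[OF psubset.prems(1)] using D' psubset.prems(2)
          by (intro sum.neutral ballI v_euler_factor_eq[OF psubset.prems(1)]) auto
        moreover have "v (norm_sum D) = 1"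
          using D' psubset.prems gD by (intro psubset.IH) auto
        ultimately show ?thesis by (simp add: v_coeff_mult gD)
      qed
      moreover have "odd (card (lower_terms Q))" "finite (lower_terms Q)"
        using psubset.hyps False by (auto simp: lt card_Pow card_gt_0_iff)
      ultimately have S: "v ?S = 1" using v_sum_parity[of "lower_terms Q"] rat by simp
      have "even z" using z(2) psubset.prems(3) by auto
      moreover have "card Q \<ge> 1" using False psubset.hyps by (simp add: Suc_le_eq card_gt_0_iff)
      then have "(2::ereal) \<le> ereal (card Q) + 1" by (simp add: one_ereal_def numeral_eq_ereal)
      ultimately have "2 \<le> v (2 ^ card Q * of_int z)" by (rule v_leading_term_even)
      then have "v (- ?S) < v (2 ^ card Q * of_int z)"
        using S rat by (auto simp: v_minus sum_in_Rats intro: less_le_trans[of _ 2])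
      then have "v (- ?S + 2 ^ card Q * of_int z) = v (- ?S)"
        using rat by (intro v_add_eq Rats_minus_iff[THEN iffD2] sum_in_Rats) auto
      then show ?thesis using S rat by (simp add: z(1) v_minus sum_in_Rats)
    qed (simp add: one)
  qed
qed

end

section \<open>Growth of cusp forms\<close>

definition mat2_mul :: "mat2 \<Rightarrow> mat2 \<Rightarrow> mat2" where
  "mat2_mul \<gamma> \<delta> = (case \<gamma> of (a, b, c, d) \<Rightarrow> case \<delta> of (a', b', c', d') \<Rightarrow>
     (a * a' + b * c', a * b' + b * d', c * a' + d * c', c * b' + d * d'))"

lemma upper_half_plane_iff [simp]: "z \<in> upper_half_plane \<longleftrightarrow> Im z > 0"
  by (simp add: upper_half_plane_def)

lemma open_upper_half_plane: "open upper_half_plane"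
  by (simp add: upper_half_plane_def open_halfspace_Im_gt)

lemma convex_upper_half_plane: "convex upper_half_plane"
  by (simp add: upper_half_plane_def convex_halfspace_Im_gt)

lemma aut_factor_nonzero:
  assumes "\<gamma> \<in> SL2Z" "Im z > 0"
  shows "aut_factor \<gamma> z \<noteq> 0"
proof -
  obtain a b c d where g: "\<gamma> = (a, b, c, d)" by (cases \<gamma>)
  have "a * d - b * c = 1" using assms by (simp add: g SL2Z_def)
  then have "c \<noteq> 0 \<or> d \<noteq> 0" by auto
  moreover have "Im (of_int c * z + of_int d) = of_int c * Im z" by simp
  ultimately show ?thesis using assms(2)
    by (cases "c = 0") (auto simp: g aut_factor_def complex_eq_iff)
qed

lemma Im_mat2_act:
  assumes "\<gamma> \<in> SL2Z"
  shows "Im (mat2_act \<gamma> z) = Im z / (cmod (aut_factor \<gamma> z))\<^sup>2"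
proof -
  obtain a b c d where g: "\<gamma> = (a, b, c, d)" by (cases \<gamma>)
  have "a * d - b * c = 1" using assms by (simp add: g SL2Z_def)
  then have det: "real_of_int a * of_int d - of_int b * of_int c = 1"
    by (metis of_int_1 of_int_diff of_int_mult)
  have "of_int a * Im z * (of_int c * Re z + of_int d) - (of_int a * Re z + of_int b) * (of_int c * Im z) =
      (real_of_int a * of_int d - of_int b * of_int c) * Im z"
    by (simp add: algebra_simps)
  then show ?thesis
    by (simp add: g mat2_act_def aut_factor_def Im_divide cmod_power2 det)
qed

lemma mat2_act_upper: "\<gamma> \<in> SL2Z \<Longrightarrow> Im z > 0 \<Longrightarrow> Im (mat2_act \<gamma> z) > 0"
  using aut_factor_nonzero[of \<gamma> z] by (simp add: Im_mat2_act)

lemma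
  assumes "\<delta> \<in> SL2Z" "Im z > 0"
  shows aut_factor_mul: "aut_factor (mat2_mul \<gamma> \<delta>) z = aut_factor \<gamma> (mat2_act \<delta> z) * aut_factor \<delta> z"
    and mat2_act_mul: "mat2_act (mat2_mul \<gamma> \<delta>) z = mat2_act \<gamma> (mat2_act \<delta> z)"
proof -
  obtain a b c d where g: "\<gamma> = (a, b, c, d)" by (cases \<gamma>)
  obtain a' b' c' d' where d: "\<delta> = (a', b', c', d')" by (cases \<delta>)
  define w where "w = of_int c' * z + (of_int d' :: complex)"
  have w: "w \<noteq> 0" using aut_factor_nonzero[OF assms] by (simp add: d aut_factor_def w_def)
  define u where "u = of_int a' * z + (of_int b' :: complex)"
  have den: "of_int (c * a' + d * c') * z + of_int (c * b' + d * d') = of_int c * u + (of_int d :: complex) * w"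
    and num: "of_int (a * a' + b * c') * z + of_int (a * b' + b * d') = of_int a * u + (of_int b :: complex) * w"
    by (simp_all add: u_def w_def algebra_simps)
  have act: "mat2_act \<delta> z = u / w" by (simp add: d mat2_act_def u_def w_def)
  have "aut_factor (mat2_mul \<gamma> \<delta>) z = of_int c * u + of_int d * w"
    by (simp add: g d mat2_mul_def aut_factor_def den del: of_int_add of_int_mult)
  also have "\<dots> = (of_int c * (u / w) + of_int d) * w" using w by (simp add: field_simps)
  also have "\<dots> = aut_factor \<gamma> (mat2_act \<delta> z) * aut_factor \<delta> z"
    unfolding act by (simp add: g d aut_factor_def w_def)
  finally show "aut_factor (mat2_mul \<gamma> \<delta>) z = aut_factor \<gamma> (mat2_act \<delta> z) * aut_factor \<delta> z" .
  have "(of_int a * u + of_int b * w) / (of_int c * u + of_int d * w) =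
      (w * (of_int a * (u / w) + of_int b)) / (w * (of_int c * (u / w) + of_int d))"
    using w by (simp add: algebra_simps)
  also have "\<dots> = (of_int a * (u / w) + of_int b) / (of_int c * (u / w) + of_int d)"
    using w by (rule mult_divide_mult_cancel_left)
  finally show "mat2_act (mat2_mul \<gamma> \<delta>) z = mat2_act \<gamma> (mat2_act \<delta> z)"
    unfolding act
    by (simp add: g d mat2_mul_def mat2_act_def den num del: of_int_add of_int_mult)
qed

lemma slash2_mul:
  assumes "\<delta> \<in> SL2Z" "Im z > 0"
  shows "slash2 f (mat2_mul \<gamma> \<delta>) z = slash2 (slash2 f \<gamma>) \<delta> z"
  by (simp add: slash2_def mat2_act_mul[OF assms] aut_factor_mul[OF assms] power_mult_distrib)

text \<open>In the coordinate \<open>q = exp (2 pi i z / p)\<close> the function becomes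
  \<open>G\<close> on the punctured unit disc. Its singularity at 0 is removable with value 0, so
  \<open>G\<close> is bounded by a multiple of \<open>cmod q\<close>, which is the claimed
  exponential.\<close>

lemma holomorphic_periodic_decay:
  assumes hol: "g holomorphic_on upper_half_plane" and p: "p > 0"
    and per: "\<And>z. Im z > 0 \<Longrightarrow> g (z + of_real p) = g z"
    and lim: "(g \<longlongrightarrow> 0) (filtercomap Im at_top)"
  obtains C T where "T > 0" "\<And>z. Im z \<ge> T \<Longrightarrow> cmod (g z) \<le> C * exp (- 2 * pi * Im z / p)"
proof -
  have per_int: "g (z + of_int k * of_real p) = g z" if "Im z > 0" for z k
    using that per by (intro periodic_int_multiple[of "{z. Im z > 0}"]) auto
  \<comment> \<open>With this \<open>c\<close> the coordinate is \<open>q = exp (z / c)\<close>, and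
    \<open>c * Ln q\<close> is one of its preimages.\<close>
  define c where "c = of_real p / (2 * of_real pi * \<i>)"
  have c: "c * (2 * of_real pi * \<i>) = of_real p" by (simp add: c_def)
  have Im_c: "Im (c * w) = - p / (2 * pi) * Re w" for w
    by (simp add: c_def Im_divide power2_eq_square field_simps)
  define G where "G = (\<lambda>q. g (c * Ln q))"
  have up: "Im (c * Ln q) > 0" if "q \<noteq> 0" "cmod q < 1" for q
    unfolding Im_c using that p by (auto intro!: mult_neg_neg[of "- p / (2 * pi)"] divide_neg_pos mult_pos_neg)
  have shift: "g (c * u) = g (c * v)" if e: "exp u = exp v" and r: "Im (c * v) > 0" for u v
  proof -
    obtain k :: int where "u = v + of_int (2 * k) * of_real pi * \<i>" using e by (auto simp: exp_eq)
    then have "c * u = c * v + of_int k * (c * (2 * of_real pi * \<i>))" by (simp add: algebra_simps)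
    then show ?thesis using per_int[OF r, of k] by (simp add: c)
  qed

  have Ghol: "G holomorphic_on (ball 0 1 - {0})"
  proof -
    have "G field_differentiable (at q0)" if q0: "q0 \<noteq> 0" "cmod q0 < 1" for q0
    proof -
      \<comment> \<open>\<open>Ln (q / q0) + Ln q0\<close> is a logarithm of \<open>q\<close> that
        is analytic near \<open>q0\<close> even on the branch cut of \<open>Ln\<close>; periodicity
        of \<open>g\<close> makes the choice of logarithm immaterial.\<close>
      define h where "h = (\<lambda>q. g (c * (Ln (q / q0) + Ln q0)))"
      have "Im (c * (Ln (q0 / q0) + Ln q0)) > 0" using up[OF q0] q0 by simp
      then have "g field_differentiable (at (c * (Ln (q0 / q0) + Ln q0)))"
        using hol open_upper_half_plane by (auto intro: holomorphic_on_imp_differentiable_at)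
      moreover have "(\<lambda>q. c * (Ln (q / q0) + Ln q0)) field_differentiable (at q0)"
        using q0 by (intro derivative_intros) (auto intro!: field_differentiable_compose[of "\<lambda>q. q / q0" _ Ln, unfolded o_def] field_differentiable_at_Ln derivative_intros)
      ultimately have hd: "h field_differentiable (at q0)"
        unfolding h_def using field_differentiable_compose[of "\<lambda>q. c * (Ln (q / q0) + Ln q0)" q0 g]
        by (simp add: o_def)
      have "h q = G q" if "q \<in> ball 0 1 - {0}" for q
      proof -
        have q: "q \<noteq> 0" "cmod q < 1" using that by auto
        then show ?thesis
          unfolding h_def G_def using q0 up[OF q] by (intro shift) (simp_all add: exp_add)
      qed
      moreover have "open (ball 0 1 - {0::complex})" "q0 \<in> ball 0 1 - {0}" using q0 by auto
      ultimately show ?thesis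
        using hd has_field_derivative_transform_within_open unfolding field_differentiable_def by blast
    qed
    then show ?thesis
      by (auto simp: holomorphic_on_def intro: field_differentiable_at_within)
  qed
  have Glim: "(G \<longlongrightarrow> 0) (at 0)"
  proof (rule tendstoI)
    fix e :: real assume "e > 0"
    with lim have "\<forall>\<^sub>F z in filtercomap Im at_top. dist (g z) 0 < e" by (rule tendstoD)
    then obtain T where T: "\<And>z. Im z \<ge> T \<Longrightarrow> cmod (g z) < e"
      by (auto simp: eventually_filtercomap eventually_at_top_linorder)
    show "\<forall>\<^sub>F q in at 0. dist (G q) 0 < e"
      unfolding eventually_at
    proof (intro exI[of _ "exp (- 2 * pi * T / p)"] conjI ballI impI)
      fix q :: complex assume q: "q \<noteq> 0 \<and> dist q 0 < exp (- 2 * pi * T / p)"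
      then have "ln (cmod q) < - 2 * pi * T / p" by (metis dist_0_norm dist_commute exp_less_cancel_iff exp_ln zero_less_norm_iff)
      then have "Im (c * Ln q) \<ge> T" unfolding Im_c using q p by (simp add: field_simps)
      then show "dist (G q) 0 < e" using T by (simp add: G_def)
    qed simp
  qed
  have "((\<lambda>q. (q - 0) * G q) \<longlongrightarrow> 0) (at 0)"
    using tendsto_mult[OF _ Glim, of "\<lambda>q. q - 0" 0] by (auto intro: tendsto_eq_intros)
  then obtain h where h: "h holomorphic_on ball 0 1" "\<And>q. q \<in> ball 0 1 - {0} \<Longrightarrow> h q = G q"
    using holomorphic_on_extend_lim[OF Ghol] by auto
  have hd: "h field_differentiable (at 0)"
    using h(1) by (intro holomorphic_on_imp_differentiable_at) auto
  have ev: "\<forall>\<^sub>F q in at 0. q \<in> ball 0 1 - {0}"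
    by (rule eventually_at_in_open) auto
  have "h 0 = 0"
  proof -
    have "(h \<longlongrightarrow> h 0) (at 0)"
      using hd field_differentiable_imp_continuous_at isCont_def by blast
    moreover have "(h \<longlongrightarrow> 0) (at 0)"
      using Glim by (rule Lim_transform_eventually) (use ev h(2) in \<open>auto elim!: eventually_mono\<close>)
    ultimately show ?thesis by (intro tendsto_unique[of "at (0::complex)"]) auto
  qed
  obtain D where "(h has_field_derivative D) (at 0)" using hd field_differentiable_def by blast
  then have "((\<lambda>q. h q / q) \<longlongrightarrow> D) (at 0)"
    using \<open>h 0 = 0\<close> by (simp add: has_field_derivative_iff)
  then have "\<forall>\<^sub>F q in at 0. dist (h q / q) D < 1" by (rule tendstoD) simp
  then have "\<forall>\<^sub>F q in at 0. cmod (G q) \<le> (cmod D + 1) * cmod q"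
    using ev
  proof eventually_elim
    case (elim q)
    have "cmod (h q / q) \<le> cmod D + 1"
      using elim(1) norm_triangle_ineq2[of "h q / q" D] by (simp add: dist_norm)
    then show ?case using elim(2) h(2)[OF elim(2)] by (simp add: norm_divide divide_le_eq)
  qed
  then obtain \<delta> where d: "\<delta> > 0" "\<And>q. q \<noteq> 0 \<Longrightarrow> cmod q < \<delta> \<Longrightarrow> cmod (G q) \<le> (cmod D + 1) * cmod q"
    by (auto simp: eventually_at)
  \<comment> \<open>Above this height \<open>cmod q\<close> is at most
    \<open>min \<delta> 1 / 2\<close>; the halving yields the strict inequality with
    \<open>\<delta>\<close>.\<close>
  define T where "T = max 1 (- p * ln (min \<delta> 1 / 2) / (2 * pi))"
  show ?thesis
  proof
    show "T > 0" by (simp add: T_def)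
    fix z assume z: "Im z \<ge> T"
    define u where "u = z / c"
    have c0: "c \<noteq> 0" using p by (simp add: c_def)
    have Imz: "Im z > 0" using z by (simp add: T_def)
    have cu: "c * u = z" using c0 by (simp add: u_def)
    have ru: "Re u = - 2 * pi * Im z / p"
      using Im_c[of u] p unfolding cu by (simp add: field_simps)
    have "- p * ln (min \<delta> 1 / 2) / (2 * pi) \<le> Im z" using z by (simp add: T_def)
    then have "- 2 * pi * Im z / p \<le> ln (min \<delta> 1 / 2)" using p by (simp add: field_simps)
    then have "cmod (exp u) \<le> min \<delta> 1 / 2"
      using d(1) by (simp add: ru ln_ge_iff)
    also have "\<dots> < \<delta>" using d(1) by (simp add: min_def)
    finally have "cmod (G (exp u)) \<le> (cmod D + 1) * cmod (exp u)" by (intro d(2)) auto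
    moreover have "G (exp u) = g (c * u)"
      unfolding G_def by (intro shift) (simp_all only: cu Imz exp_Ln exp_not_eq_zero not_False_eq_True)
    ultimately show "cmod (g z) \<le> (cmod D + 1) * exp (- 2 * pi * Im z / p)"
      by (simp add: ru cu)
  qed
qed

locale cusp_form_weight_2 =
  fixes N :: nat and f :: "complex \<Rightarrow> complex"
  assumes level_pos: "N > 0" and cusp_form: "cusp_form2 N f"
begin

lemma f_holomorphic: "f holomorphic_on upper_half_plane"
  using cusp_form by (simp add: cusp_form2_def)

lemma f_slash: "\<gamma> \<in> Gamma0 N \<Longrightarrow> Im z > 0 \<Longrightarrow> slash2 f \<gamma> z = f z"
  using cusp_form by (simp add: cusp_form2_def)

lemma slash_tendsto_0: "\<gamma> \<in> SL2Z \<Longrightarrow> (slash2 f \<gamma> \<longlongrightarrow> 0) (filtercomap Im at_top)"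
  using cusp_form by (simp add: cusp_form2_def)

lemma mat2_act_holomorphic:
  assumes "\<gamma> \<in> SL2Z"
  shows "mat2_act \<gamma> holomorphic_on upper_half_plane"
proof -
  obtain a b c d where g: "\<gamma> = (a, b, c, d)" by (cases \<gamma>)
  show ?thesis
    using aut_factor_nonzero[OF assms] unfolding g mat2_act_def aut_factor_def
    by (auto intro!: holomorphic_intros)
qed

lemma slash_holomorphic:
  assumes "\<gamma> \<in> SL2Z"
  shows "slash2 f \<gamma> holomorphic_on upper_half_plane"
proof -
  have "(f \<circ> mat2_act \<gamma>) holomorphic_on upper_half_plane"
    using mat2_act_upper[OF assms]
    by (intro holomorphic_on_compose_gen[OF mat2_act_holomorphic[OF assms] f_holomorphic]) auto
  moreover have "aut_factor \<gamma> holomorphic_on upper_half_plane"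
    by (cases \<gamma>) (auto simp: aut_factor_def[abs_def] intro!: holomorphic_intros)
  ultimately have "(\<lambda>z. (f \<circ> mat2_act \<gamma>) z / (aut_factor \<gamma> z)\<^sup>2) holomorphic_on upper_half_plane"
    using aut_factor_nonzero[OF assms] by (intro holomorphic_on_divide holomorphic_on_power) (auto simp: o_def)
  then show ?thesis by (simp add: slash2_def[abs_def] o_def)
qed

lemma slash_Gamma0_mul:
  assumes "\<eta> \<in> Gamma0 N" "\<gamma> \<in> SL2Z" "Im z > 0"
  shows "slash2 f (mat2_mul \<eta> \<gamma>) z = slash2 f \<gamma> z"
  using f_slash[OF assms(1), of "mat2_act \<gamma> z"] mat2_act_upper[OF assms(2,3)]
  by (simp add: slash2_mul[OF assms(2,3)] slash2_def[of "slash2 f \<eta>"] slash2_def[of f \<gamma>])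

text \<open>The lower left entry of the second matrix times the inverse of the first is
  \<open>c' * d - d' * c\<close>, divisible by \<open>N\<close>. So the two differ by a left factor
  in \<open>Gamma0 N\<close>.\<close>

lemma slash_cong:
  assumes "(a, b, c, d) \<in> SL2Z" "(a', b', c', d') \<in> SL2Z"
    and "[c = c'] (mod int N)" "[d = d'] (mod int N)" and z: "Im z > 0"
  shows "slash2 f (a', b', c', d') z = slash2 f (a, b, c, d) z"
proof -
  define \<eta> where "\<eta> = mat2_mul (a', b', c', d') (d, - b, - c, a)"
  have det: "a * d = 1 + b * c" "a' * d' = 1 + b' * c'" using assms by (auto simp: SL2Z_def)
  have "[c' * d = c * d'] (mod int N)" using assms(3,4) by (metis cong_mult cong_sym)
  then have "int N dvd c' * d - d' * c" by (simp add: cong_iff_dvd_diff mult.commute)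
  moreover have "(a' * d - b' * c) * (d' * a - c' * b) - (b' * a - a' * b) * (c' * d - d' * c) = (a' * d' - b' * c') * (a * d - b * c)"
    by (simp add: algebra_simps)
  ultimately have "\<eta> \<in> Gamma0 N" using det by (simp add: \<eta>_def mat2_mul_def Gamma0_def SL2Z_def algebra_simps)
  moreover have "mat2_mul \<eta> (a, b, c, d) = (a', b', c', d')"
  proof -
    have *: "x * (a * d) = x + x * (b * c)" for x using det by (simp add: distrib_left)
    show ?thesis using *[of a'] *[of b'] *[of c'] *[of d'] by (simp add: \<eta>_def mat2_mul_def algebra_simps)
  qed
  ultimately show ?thesis using slash_Gamma0_mul[OF _ assms(1) z, of \<eta>] by simp
qed

lemma slash_periodic:
  assumes "\<gamma> \<in> SL2Z" "Im z > 0"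
  shows "slash2 f \<gamma> (z + of_real (of_nat N)) = slash2 f \<gamma> z"
proof -
  obtain a b c d where g: "\<gamma> = (a, b, c, d)" by (cases \<gamma>)
  have T: "(1, int N, 0, 1) \<in> SL2Z" by (simp add: SL2Z_def)
  have "slash2 f \<gamma> (z + of_real (of_nat N)) = slash2 (slash2 f \<gamma>) (1, int N, 0, 1) z"
    by (simp add: slash2_def[of "slash2 f \<gamma>"] mat2_act_def aut_factor_def)
  also have "\<dots> = slash2 f (mat2_mul \<gamma> (1, int N, 0, 1)) z" by (rule slash2_mul[OF T assms(2), symmetric])
  also have "mat2_mul \<gamma> (1, int N, 0, 1) = (a, a * int N + b, c, c * int N + d)" by (simp add: g mat2_mul_def)
  also have "slash2 f \<dots> z = slash2 f \<gamma> z"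
    unfolding g using assms by (intro slash_cong) (auto simp: g SL2Z_def algebra_simps cong_iff_dvd_diff)
  finally show ?thesis .
qed

lemma slash_periodic_int:
  assumes "\<gamma> \<in> SL2Z" "Im z > 0"
  shows "slash2 f \<gamma> (z + of_int k * of_nat N) = slash2 f \<gamma> z"
  using assms slash_periodic[OF assms(1)] by (intro periodic_int_multiple[of "{z. Im z > 0}"]) auto

text \<open>Decay bounds the function high up; below, translation by multiples of \<open>N\<close>
  leads into a compact rectangle.\<close>

lemma slash_bounded:
  assumes "\<gamma> \<in> SL2Z" "t0 > 0"
  shows "\<exists>B. \<forall>z. Im z \<ge> t0 \<longrightarrow> cmod (slash2 f \<gamma> z) \<le> B"
proof -
  have "\<forall>\<^sub>F z in filtercomap Im at_top. dist (slash2 f \<gamma> z) 0 < 1"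
    using slash_tendsto_0[OF assms(1)] by (rule tendstoD) simp
  then obtain T where T: "\<And>z. Im z \<ge> T \<Longrightarrow> cmod (slash2 f \<gamma> z) < 1"
    by (auto simp: eventually_filtercomap eventually_at_top_linorder)
  let ?K = "cbox (Complex 0 t0) (Complex (real N) T)"
  have "continuous_on ?K (slash2 f \<gamma>)"
    using assms(2)
    by (intro continuous_on_subset[OF holomorphic_on_imp_continuous_on[OF slash_holomorphic[OF assms(1)]]])
       (auto simp: in_cbox_complex_iff)
  then have "bounded (slash2 f \<gamma> ` ?K)"
    by (intro compact_imp_bounded compact_continuous_image compact_cbox)
  then obtain B where B: "\<And>z. z \<in> ?K \<Longrightarrow> cmod (slash2 f \<gamma> z) \<le> B"
    by (auto simp: bounded_iff)
  show ?thesis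
  proof (intro exI[of _ "max 1 B"] allI impI)
    fix z assume z: "Im z \<ge> t0"
    show "cmod (slash2 f \<gamma> z) \<le> max 1 B"
    proof (cases "Im z \<ge> T")
      case True
      then show ?thesis using T[of z] by simp
    next
      case False
      define k where "k = - \<lfloor>Re z / real N\<rfloor>"
      define w where "w = z + of_int k * of_nat N"
      have "of_int \<lfloor>Re z / real N\<rfloor> \<le> Re z / real N" "Re z / real N < of_int \<lfloor>Re z / real N\<rfloor> + 1" by linarith+
      then have "of_int \<lfloor>Re z / real N\<rfloor> * real N \<le> Re z" "Re z < (of_int \<lfloor>Re z / real N\<rfloor> + 1) * real N"
        using level_pos by (simp_all only: pos_le_divide_eq pos_divide_less_eq of_nat_0_less_iff)
      then have "0 \<le> Re w" "Re w \<le> real N"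
        by (simp_all add: w_def k_def algebra_simps)
      then have "w \<in> ?K" using z False by (simp add: in_cbox_complex_iff w_def)
      then have "cmod (slash2 f \<gamma> w) \<le> B" by (rule B)
      then show ?thesis using slash_periodic_int[OF assms(1), of z k] z assms(2) by (simp add: w_def)
    qed
  qed
qed

text \<open>The translate depends only on the lower row modulo \<open>N\<close>, so finitely many
  functions have to be bounded.\<close>

lemma slash_uniformly_bounded:
  assumes "t0 > 0"
  obtains B where "B > 0" "\<And>\<gamma> z. \<gamma> \<in> SL2Z \<Longrightarrow> Im z \<ge> t0 \<Longrightarrow> cmod (slash2 f \<gamma> z) \<le> B"
proof -
  define R :: "mat2 \<Rightarrow> int \<times> int" where "R = (\<lambda>(a, b, c, d). (c mod int N, d mod int N))"
  obtain b where b: "\<And>\<gamma> z. \<gamma> \<in> SL2Z \<Longrightarrow> Im z \<ge> t0 \<Longrightarrow> cmod (slash2 f \<gamma> z) \<le> b \<gamma>"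
    using slash_bounded[OF _ assms] by metis
  define rep where "rep = (\<lambda>\<rho>. SOME \<gamma>. \<gamma> \<in> SL2Z \<and> R \<gamma> = \<rho>)"
  have rep: "rep (R \<gamma>) \<in> SL2Z" "R (rep (R \<gamma>)) = R \<gamma>" if "\<gamma> \<in> SL2Z" for \<gamma>
    using someI[of "\<lambda>\<gamma>'. \<gamma>' \<in> SL2Z \<and> R \<gamma>' = R \<gamma>" \<gamma>] that by (auto simp: rep_def)
  have same: "slash2 f \<gamma> z = slash2 f \<gamma>' z" if "\<gamma> \<in> SL2Z" "\<gamma>' \<in> SL2Z" "R \<gamma> = R \<gamma>'" "Im z > 0" for \<gamma> \<gamma>' z
    using that by (cases \<gamma>; cases \<gamma>') (auto simp: R_def cong_def intro!: slash_cong)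
  have "R ` SL2Z \<subseteq> {0..<int N} \<times> {0..<int N}" using level_pos by (auto simp: R_def)
  then have fin: "finite (R ` SL2Z)" by (rule finite_subset) auto
  define B where "B = Max (insert 1 ((\<lambda>\<rho>. b (rep \<rho>)) ` R ` SL2Z))"
  show ?thesis
  proof
    show "B > 0" unfolding B_def using fin by (intro less_le_trans[OF zero_less_one Max_ge]) auto
    fix \<gamma> z assume *: "\<gamma> \<in> SL2Z" "Im z \<ge> t0"
    have "slash2 f \<gamma> z = slash2 f (rep (R \<gamma>)) z"
      using * rep[OF *(1)] assms by (intro same) auto
    also have "cmod \<dots> \<le> b (rep (R \<gamma>))" using * rep by (intro b) auto
    also have "\<dots> \<le> B" unfolding B_def using fin * by (intro Max_ge) auto
    finally show "cmod (slash2 f \<gamma> z) \<le> B" .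
  qed
qed

lemma slash_inverse:
  assumes "(a, b, c, d) \<in> SL2Z" "Im z > 0"
  shows "f z = slash2 f (d, - b, - c, a) (mat2_act (a, b, c, d) z) / (aut_factor (a, b, c, d) z)\<^sup>2"
proof -
  have inv: "mat2_mul (d, - b, - c, a) (a, b, c, d) = (1, 0, 0, 1)"
    using assms(1) by (auto simp: mat2_mul_def SL2Z_def algebra_simps)
  have "f z = slash2 f (1, 0, 0, 1) z" by (simp add: slash2_def mat2_act_def aut_factor_def)
  also have "\<dots> = slash2 (slash2 f (d, - b, - c, a)) (a, b, c, d) z"
    using slash2_mul[OF assms, of f "(d, - b, - c, a)"] by (simp add: inv)
  finally show ?thesis by (simp add: slash2_def[of "slash2 f (d, - b, - c, a)"])
qed

text \<open>Dirichlet approximation takes the place of a fundamental domain: a matrix with lower row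
  \<open>(k, - h)\<close>, where \<open>h / k\<close> approximates \<open>Re z\<close>, lifts
  \<open>z\<close> to height at least \<open>1 / 5\<close>, where the uniform bound holds. Its
  automorphy factor has modulus at least \<open>k * Im z\<close>, hence at least
  \<open>Im z\<close>, and enters squared.\<close>

lemma polynomial_bound:
  obtains B where "B > 0" "\<And>z. 0 < Im z \<Longrightarrow> Im z \<le> 1 \<Longrightarrow> cmod (f z) \<le> B / (Im z)\<^sup>2"
proof -
  obtain B where B: "B > 0" "\<And>\<gamma> z. \<gamma> \<in> SL2Z \<Longrightarrow> Im z \<ge> 1 / 5 \<Longrightarrow> cmod (slash2 f \<gamma> z) \<le> B"
    using slash_uniformly_bounded[of "1 / 5"] by auto
  show ?thesis
  proof
    fix z assume z: "0 < Im z" "Im z \<le> 1"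
    define y where "y = Im z"
    define s where "s = sqrt y"
    have s: "s > 0" "s \<le> 1" "s * s = y" using z by (auto simp: s_def y_def)
    \<comment> \<open>Taking \<open>n\<close> about \<open>1 / s\<close> with \<open>s\<close> the
      square root of the height balances the two parts of \<open>k * z - h\<close>: the real part is
      at most \<open>s\<close> and the imaginary part at most \<open>2 * s\<close>. Their squares
      add up to \<open>5 * y\<close>, whence the height \<open>1 / 5\<close>.\<close>
    define n where "n = nat \<lceil>1 / s\<rceil>"
    have n: "n > 0" "1 / s \<le> real n" "real n \<le> 1 / s + 1"
      using s by (auto simp: n_def of_nat_nat)
    obtain h k where hk: "coprime h k" "0 < k" "k \<le> int n" "\<bar>of_int k * Re z - of_int h\<bar> < 1 / n"
      using Dirichlet_approx_coprime[of n "Re z"] n by auto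
    obtain u v where uv: "u * h + v * k = 1" using hk(1) by (metis bezout_int coprime_iff_gcd_eq_1)
    define \<gamma> where "\<gamma> = (- u, - v, k, - h)"
    have \<gamma>: "\<gamma> \<in> SL2Z" using uv by (simp add: \<gamma>_def SL2Z_def algebra_simps)
    have inv: "(- h, v, - k, - u) \<in> SL2Z" using uv by (simp add: SL2Z_def algebra_simps)
    have norm2: "(cmod (aut_factor \<gamma> z))\<^sup>2 = (of_int k * Re z - of_int h)\<^sup>2 + (of_int k * y)\<^sup>2"
      by (simp add: \<gamma>_def aut_factor_def cmod_power2 y_def)
    have "(cmod (aut_factor \<gamma> z))\<^sup>2 \<le> 5 * y"
    proof -
      have "\<bar>of_int k * Re z - of_int h\<bar> \<le> s"
      proof -
        have "1 / real n \<le> s" using n s by (simp add: field_simps)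
        then show ?thesis using hk(4) by linarith
      qed
      then have "(of_int k * Re z - of_int h)\<^sup>2 \<le> s\<^sup>2" by (metis abs_le_square_iff abs_of_pos s(1))
      moreover have "of_int k * y \<le> 2 * s"
      proof -
        have "of_int k \<le> 1 / s + 1" using hk(3) n(3) by linarith
        also have "\<dots> \<le> 2 / s" using s(1,2) by (simp add: field_simps)
        finally have "of_int k * y \<le> 2 / s * y" using z by (intro mult_right_mono) (auto simp: y_def)
        moreover have "2 / s * y = 2 * s" using s(1) by (simp add: s(3)[symmetric])
        ultimately show ?thesis by simp
      qed
      then have "(of_int k * y)\<^sup>2 \<le> (2 * s)\<^sup>2" using hk(2) z by (intro power_mono) (auto simp: y_def)
      moreover have "s\<^sup>2 = y" "(2 * s)\<^sup>2 = 4 * y" using s(3) by (simp_all add: power2_eq_square)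
      ultimately show ?thesis unfolding norm2 by linarith
    qed
    then have "1 / 5 \<le> Im (mat2_act \<gamma> z)"
      using aut_factor_nonzero[OF \<gamma>] z by (simp add: Im_mat2_act[OF \<gamma>] y_def field_simps)
    then have bound: "cmod (slash2 f (- h, v, - k, - u) (mat2_act \<gamma> z)) \<le> B" using B(2)[OF inv] by simp
    have "y \<le> of_int k * y" using hk(2) z by (simp add: y_def)
    then have "y\<^sup>2 \<le> (of_int k * y)\<^sup>2" using z by (intro power_mono) (auto simp: y_def)
    also have "\<dots> \<le> (cmod (aut_factor \<gamma> z))\<^sup>2" by (simp add: norm2)
    finally have le: "y\<^sup>2 \<le> (cmod (aut_factor \<gamma> z))\<^sup>2" .
    have "f z = slash2 f (- h, v, - k, - u) (mat2_act \<gamma> z) / (aut_factor \<gamma> z)\<^sup>2"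
      using slash_inverse[of "- u" "- v" k "- h" z] \<gamma> z by (simp add: \<gamma>_def)
    then have "cmod (f z) = cmod (slash2 f (- h, v, - k, - u) (mat2_act \<gamma> z)) / (cmod (aut_factor \<gamma> z))\<^sup>2"
      by (simp add: norm_divide norm_power)
    also have "\<dots> \<le> B / y\<^sup>2"
      using bound le z B(1) by (intro frac_le) (auto simp: y_def)
    finally show "cmod (f z) \<le> B / (Im z)\<^sup>2" by (simp add: y_def)
  qed (rule B(1))
qed

section \<open>Decay of cusp forms on vertical lines\<close>

lemma slash_decay:
  assumes "\<gamma> \<in> SL2Z"
  obtains C T where "T > 0" "C > 0" "\<And>z. Im z \<ge> T \<Longrightarrow> cmod (slash2 f \<gamma> z) \<le> C * exp (- 2 * pi * Im z / real N)"
proof -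
  obtain C T where CT: "T > 0" "\<And>z. Im z \<ge> T \<Longrightarrow> cmod (slash2 f \<gamma> z) \<le> C * exp (- 2 * pi * Im z / real N)"
    using holomorphic_periodic_decay[OF slash_holomorphic[OF assms], of "real N"]
      slash_periodic[OF assms] slash_tendsto_0[OF assms] level_pos by (metis of_nat_0_less_iff)
  have "C * exp (- 2 * pi * Im z / real N) \<le> max C 1 * exp (- 2 * pi * Im z / real N)" for z
    by (intro mult_right_mono) auto
  then show ?thesis using CT that[of T "max C 1"] by (meson less_max_iff_disj order_trans zero_less_one)
qed

lemma vertical_decay_at_top:
  obtains C where "\<And>x y. y \<ge> 1 \<Longrightarrow> cmod (f (Complex x y)) \<le> C / y ^ n"
proof -
  have id: "(1, 0, 0, 1) \<in> SL2Z" by (simp add: SL2Z_def)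
  have f_eq: "slash2 f (1, 0, 0, 1) = f" by (rule ext) (simp add: slash2_def mat2_act_def aut_factor_def)
  obtain C T where C: "T > 0" "C > 0" "\<And>z. Im z \<ge> T \<Longrightarrow> cmod (f z) \<le> C * exp (- 2 * pi * Im z / real N)"
    using slash_decay[OF id] unfolding f_eq by metis
  have "((\<lambda>y. C * exp (- 2 * pi * y / real N) * y ^ n) \<longlongrightarrow> 0) at_top"
    using level_pos by real_asymp
  then have "\<forall>\<^sub>F y in at_top. C * exp (- 2 * pi * y / real N) * y ^ n < 1"
    by (rule order_tendstoD) simp
  then obtain T' where T': "\<And>y. y \<ge> T' \<Longrightarrow> C * exp (- 2 * pi * y / real N) * y ^ n < 1"
    by (auto simp: eventually_at_top_linorder)
  obtain B where B: "\<And>z. Im z \<ge> 1 \<Longrightarrow> cmod (f z) \<le> B" using slash_bounded[OF id, of 1] unfolding f_eq by auto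
  define U where "U = max 1 (max T T')"
  show ?thesis
  proof (rule that[of "max 1 (B * U ^ n)"])
    fix x y :: real assume y: "y \<ge> 1"
    have "cmod (f (Complex x y)) * y ^ n \<le> max 1 (B * U ^ n)"
    proof (cases "y \<ge> U")
      case True
      then have "cmod (f (Complex x y)) * y ^ n \<le> C * exp (- 2 * pi * y / real N) * y ^ n"
        using C(3)[of "Complex x y"] y by (intro mult_right_mono) (auto simp: U_def)
      also have "\<dots> \<le> 1" using T'[of y] True by (simp add: U_def)
      finally show ?thesis by simp
    next
      case False
      have "cmod (f (Complex x y)) * y ^ n \<le> B * U ^ n"
        using B[of "Complex x y"] y False by (intro mult_mono power_mono) (auto intro: order_trans[OF norm_ge_zero])
      then show ?thesis by simp
    qed
    then show "cmod (f (Complex x y)) \<le> max 1 (B * U ^ n) / y ^ n"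
      using y by (simp add: pos_le_divide_eq)
  qed
qed

text \<open>A matrix with lower row \<open>(K, - A)\<close> moves the point at height
  \<open>y\<close> above \<open>A / K\<close> to height \<open>1 / (k\<^sup>2 * y)\<close>, so
  exponential decay at infinity becomes decay like \<open>exp (- c / y)\<close> at the cusp, which
  beats every power of \<open>y\<close>.\<close>

lemma vertical_decay_at_0:
  assumes "r \<in> \<rat>"
  obtains C where "\<And>y. 0 < y \<Longrightarrow> y \<le> 1 \<Longrightarrow> cmod (f (Complex r y)) \<le> C * y ^ n"
proof -
  obtain A K where AK: "K > 0" "coprime A K" "r = of_int A / of_int K" using assms by (elim Rats_cases')
  obtain u v where uv: "u * A + v * K = 1" using AK(2) by (metis bezout_int coprime_iff_gcd_eq_1)
  define \<delta> where "\<delta> = (- u, - v, K, - A)"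
  have \<delta>: "\<delta> \<in> SL2Z" and inv: "(- A, v, - K, - u) \<in> SL2Z"
    using uv by (simp_all add: \<delta>_def SL2Z_def algebra_simps)
  obtain C T where C: "T > 0" "C > 0"
    "\<And>z. Im z \<ge> T \<Longrightarrow> cmod (slash2 f (- A, v, - K, - u) z) \<le> C * exp (- 2 * pi * Im z / real N)"
    using slash_decay[OF inv] by metis
  define k where "k = real_of_int K"
  have k: "k > 0" using AK by (simp add: k_def)
  have bnd: "cmod (f (Complex r y)) \<le> C * exp (- 2 * pi / (k\<^sup>2 * real N) / y) / (k * y)\<^sup>2"
    if y: "y > 0" "y \<le> 1 / (k\<^sup>2 * T)" for y
  proof -
    have af: "aut_factor \<delta> (Complex r y) = Complex 0 (k * y)"
      using AK by (simp add: \<delta>_def aut_factor_def complex_eq_iff k_def)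
    then have n: "cmod (aut_factor \<delta> (Complex r y)) = k * y" using k y by (simp add: cmod_def)
    have im: "Im (mat2_act \<delta> (Complex r y)) = 1 / (k\<^sup>2 * y)"
      using k y by (simp add: Im_mat2_act[OF \<delta>] n power2_eq_square)
    have "T \<le> 1 / (k\<^sup>2 * y)" using y C(1) k by (simp add: field_simps)
    then have "cmod (slash2 f (- A, v, - K, - u) (mat2_act \<delta> (Complex r y))) \<le> C * exp (- 2 * pi * (1 / (k\<^sup>2 * y)) / real N)"
      using C(3)[of "mat2_act \<delta> (Complex r y)"] by (simp add: im)
    moreover have "f (Complex r y) = slash2 f (- A, v, - K, - u) (mat2_act \<delta> (Complex r y)) / (aut_factor \<delta> (Complex r y))\<^sup>2"
      using slash_inverse[of "- u" "- v" K "- A" "Complex r y"] \<delta> y by (simp add: \<delta>_def)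
    ultimately show ?thesis
      by (simp add: norm_divide norm_power n divide_right_mono field_simps)
  qed
  define c where "c = 2 * pi / (k\<^sup>2 * real N)"
  have c: "c > 0" using k level_pos by (simp add: c_def)
  have "((\<lambda>y. C * exp (- c / y) / (k * y)\<^sup>2 / y ^ n) \<longlongrightarrow> 0) (at_right 0)"
    using c k by real_asymp
  then have "\<forall>\<^sub>F y in at_right 0. C * exp (- c / y) / (k * y)\<^sup>2 / y ^ n < 1"
    by (rule order_tendstoD) simp
  then obtain b where b: "b > 0" "\<And>y. 0 < y \<Longrightarrow> y < b \<Longrightarrow> C * exp (- c / y) / (k * y)\<^sup>2 / y ^ n < 1"
    by (auto simp: eventually_at_right_field)
  obtain B where B: "B > 0" "\<And>z. 0 < Im z \<Longrightarrow> Im z \<le> 1 \<Longrightarrow> cmod (f z) \<le> B / (Im z)\<^sup>2"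
    using polynomial_bound by blast
  \<comment> \<open>Below \<open>w\<close> the exponential estimate and its comparison with
    \<open>y ^ n\<close> are both valid (\<open>b / 2\<close> because the latter requires
    \<open>y < b\<close>); between \<open>w\<close> and 1 the polynomial bound suffices.\<close>
  define w where "w = min (b / 2) (1 / (k\<^sup>2 * T))"
  have w: "w > 0" using b k C by (simp add: w_def)
  show ?thesis
  proof (rule that[of "max 1 (B / w\<^sup>2 / w ^ n)"])
    fix y :: real assume y: "0 < y" "y \<le> 1"
    have "cmod (f (Complex r y)) / y ^ n \<le> max 1 (B / w\<^sup>2 / w ^ n)"
    proof (cases "y \<le> w")
      case True
      then have "cmod (f (Complex r y)) / y ^ n \<le> C * exp (- c / y) / (k * y)\<^sup>2 / y ^ n"
        using bnd[of y] y by (intro divide_right_mono) (auto simp: w_def c_def)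
      also have "\<dots> \<le> 1" using b(2)[of y] True b(1) y by (simp add: w_def)
      finally show ?thesis by simp
    next
      case False
      have "cmod (f (Complex r y)) \<le> B / y\<^sup>2" using B(2)[of "Complex r y"] y by simp
      also have "\<dots> \<le> B / w\<^sup>2" using False w B(1) by (intro divide_left_mono power_mono) auto
      finally have "cmod (f (Complex r y)) / y ^ n \<le> B / w\<^sup>2 / w ^ n"
        using False w B(1) by (intro frac_le power_mono) auto
      then show ?thesis by simp
    qed
    then show "cmod (f (Complex r y)) \<le> max 1 (B / w\<^sup>2 / w ^ n) * y ^ n"
      using y by (simp add: pos_divide_le_eq)
  qed
qed

end

section \<open>Mellin transforms and Dirichlet series\<close>

lemma integrable_lborel_inverse_1_plus_square: "integrable lborel (\<lambda>y::real. inverse (1 + y\<^sup>2))"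
  using integrable_inverse_1_plus_square by (simp add: set_integrable_def einterval_def)

lemma set_integrable_quadratic_decay:
  fixes g :: "real \<Rightarrow> complex"
  assumes "continuous_on {0<..} g" "\<And>y. y > 0 \<Longrightarrow> cmod (g y) \<le> A * inverse (1 + y\<^sup>2)"
  shows "set_integrable lborel {0<..} g"
  unfolding set_integrable_def
proof (rule Bochner_Integration.integrable_bound[of _ "\<lambda>y. A * inverse (1 + y\<^sup>2)"])
  show "integrable lborel (\<lambda>y. A * inverse (1 + y\<^sup>2))"
    by (intro integrable_mult_right integrable_lborel_inverse_1_plus_square)
  show "(\<lambda>y. indicator {0<..} y *\<^sub>R g y) \<in> borel_measurable lborel"
    using borel_measurable_continuous_on_indicator[OF _ assms(1)] by simp
  show "AE y in lborel. norm (indicator {0<..} y *\<^sub>R g y) \<le> norm (A * inverse (1 + y\<^sup>2))"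
    using assms(2) by (intro AE_I2) (auto simp: indicator_def intro: order_trans[OF _ abs_ge_self])
qed

text \<open>Dominated convergence with \<open>g\<close> itself as majorant. The two end points are
  independent sequences, since comparing cusps later requires different rates at 0.\<close>

lemma tendsto_integral_exhaust:
  fixes g :: "real \<Rightarrow> 'a :: {banach, second_countable_topology}"
  assumes int: "set_integrable lborel {0<..} g"
    and u: "\<And>n. u n > 0" "u \<longlonglongrightarrow> 0" and w: "filterlim w at_top sequentially"
  shows "(\<lambda>n. LINT y:{u n..w n}|lborel. g y) \<longlonglongrightarrow> (LINT y:{0<..}|lborel. g y)"
  unfolding set_lebesgue_integral_def
proof (rule integral_dominated_convergence[where w = "\<lambda>y. norm (indicator {0<..} y *\<^sub>R g y)"])
  have meas: "(\<lambda>y. indicator {0<..} y *\<^sub>R g y) \<in> borel_measurable lborel"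
    using int by (auto simp: set_integrable_def)
  then show "(\<lambda>y. indicator {0<..} y *\<^sub>R g y) \<in> borel_measurable lborel" .
  show "(\<lambda>y. indicator {u n..w n} y *\<^sub>R g y) \<in> borel_measurable lborel" for n
  proof -
    have "(\<lambda>y. indicator {u n..w n} y *\<^sub>R (indicator {0<..} y *\<^sub>R g y)) \<in> borel_measurable lborel"
      using meas by measurable
    also have "(\<lambda>y. indicator {u n..w n} y *\<^sub>R (indicator {0<..} y *\<^sub>R g y)) = (\<lambda>y. indicator {u n..w n} y *\<^sub>R g y)"
      using u(1)[of n] by (auto simp: fun_eq_iff indicator_def)
    finally show ?thesis .
  qed
  show "integrable lborel (\<lambda>y. norm (indicator {0<..} y *\<^sub>R g y))"
    using int unfolding set_integrable_def by (rule integrable_norm)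
  show "AE y in lborel. (\<lambda>n. indicator {u n..w n} y *\<^sub>R g y) \<longlonglongrightarrow> indicator {0<..} y *\<^sub>R g y"
  proof (rule AE_I2)
    fix y :: real
    show "(\<lambda>n. indicator {u n..w n} y *\<^sub>R g y) \<longlonglongrightarrow> indicator {0<..} y *\<^sub>R g y"
    proof (cases "y > 0")
      case True
      have "\<forall>\<^sub>F n in sequentially. u n < y" using u(2) True by (rule order_tendstoD)
      moreover have "\<forall>\<^sub>F n in sequentially. y \<le> w n" using w by (simp add: filterlim_at_top)
      ultimately have "\<forall>\<^sub>F n in sequentially. indicator {0<..} y *\<^sub>R g y = indicator {u n..w n} y *\<^sub>R g y"
        by eventually_elim (use True in \<open>auto simp: indicator_def\<close>)
      then show ?thesis by (rule Lim_transform_eventually[OF tendsto_const])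
    next
      case False
      then have "(\<lambda>n. indicator {u n..w n} y *\<^sub>R g y) = (\<lambda>n. 0)"
        using u(1) by (auto simp: fun_eq_iff indicator_def intro: less_le_trans)
      then show ?thesis using False by (simp only:) simp
    qed
  qed
  show "AE y in lborel. norm (indicator {u n..w n} y *\<^sub>R g y) \<le> norm (indicator {0<..} y *\<^sub>R g y)" for n
    using u(1)[of n] by (intro AE_I2) (auto simp: indicator_def)
qed

lemma set_integral_scale:
  fixes g :: "real \<Rightarrow> complex"
  assumes "a > 0"
  shows "(LINT y:{0<..}|lborel. g (a * y)) = (LINT y:{0<..}|lborel. g y) / of_real a"
proof -
  have "(LINT y:{0<..}|lborel. g y) = of_real a * (LINT y:{0<..}|lborel. g (a * y))"
    unfolding set_lebesgue_integral_def
    using assms by (subst lborel_integral_real_affine[of a _ 0])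
      (auto simp: indicator_def zero_less_mult_iff scaleR_conv_of_real intro!: Bochner_Integration.integral_cong)
  then show ?thesis using assms by simp
qed

lemma set_integrable_scale:
  fixes g :: "real \<Rightarrow> complex"
  assumes "a > 0" "set_integrable lborel {0<..} g"
  shows "set_integrable lborel {0<..} (\<lambda>y. g (a * y))"
proof -
  have "integrable lborel (\<lambda>y. indicator {0<..} (0 + a * y) *\<^sub>R g (0 + a * y))"
    using assms by (intro lborel_integrable_real_affine) (auto simp: set_integrable_def)
  also have "(\<lambda>y. indicator {0<..} (0 + a * y) *\<^sub>R g (0 + a * y)) = (\<lambda>y. indicator {0<..} y *\<^sub>R g (a * y))"
    using assms(1) by (auto simp: fun_eq_iff indicator_def zero_less_mult_iff)
  finally show ?thesis by (simp add: set_integrable_def)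
qed

lemma continuous_on_of_real_powr:
  "continuous_on {0<..} (\<lambda>t. complex_of_real t powr s)"
  by (intro continuous_intros) (auto simp: complex_nonpos_Reals_iff)

lemma Gamma_set_integral:
  assumes "Re s > 0"
  shows "set_integrable lborel {0<..} (\<lambda>t. complex_of_real t powr (s - 1) * of_real (exp (- t)))"
    and "(LINT t:{0<..}|lborel. complex_of_real t powr (s - 1) * of_real (exp (- t))) = Gamma s"
proof -
  let ?g = "\<lambda>t. complex_of_real t powr (s - 1) * of_real (exp (- t))"
  have g: "?g = (\<lambda>t. complex_of_real t powr (s - 1) / of_real (exp t))"
    by (simp add: exp_minus field_simps)
  have "continuous_on {0<..} ?g"
    by (intro continuous_intros continuous_on_of_real_powr)
  then have "(\<lambda>y. indicator {0<..} y *\<^sub>R ?g y) \<in> borel_measurable lborel"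
    using borel_measurable_continuous_on_indicator[of "{0<..}" ?g] by simp
  moreover have "?g absolutely_integrable_on {0<..}"
    unfolding g by (rule absolutely_integrable_Gamma_integral'[OF assms])
  ultimately show int: "set_integrable lborel {0<..} ?g"
    unfolding set_integrable_def by (subst (asm) integrable_completion) auto
  have "(LINT t:{0<..}|lborel. ?g t) = integral {0<..} ?g"
    by (rule set_borel_integral_eq_integral(2)[OF int])
  also have "\<dots> = Gamma s"
    unfolding g using Gamma_integral_complex'[OF assms] by (rule integral_unique)
  finally show "(LINT t:{0<..}|lborel. ?g t) = Gamma s" .
qed

lemma Gamma_set_integral_scaled:
  assumes "Re s > 0" "a > 0"
  shows "set_integrable lborel {0<..} (\<lambda>t. complex_of_real t powr (s - 1) * of_real (exp (- a * t)))"
    and "(LINT t:{0<..}|lborel. complex_of_real t powr (s - 1) * of_real (exp (- a * t))) = Gamma s * of_real a powr (- s)"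
proof -
  let ?G = "\<lambda>t. complex_of_real t powr (s - 1) * of_real (exp (- a * t))"
  let ?I = "LINT t:{0<..}|lborel. ?G t"
  let ?g = "\<lambda>t. complex_of_real t powr (s - 1) * of_real (exp (- t))"
  define k where "k = complex_of_real a powr (s - 1)"
  have k0: "k \<noteq> 0" using assms by (simp add: k_def)
  have eq: "?g (a * t) = k * ?G t" if "t > 0" for t
    using that assms(2) by (simp add: k_def powr_times_real)
  have i: "set_integrable lborel {0<..} (\<lambda>t. ?g (a * t))"
    by (rule set_integrable_scale[OF assms(2) Gamma_set_integral(1)[OF assms(1)]])
  then have i': "set_integrable lborel {0<..} (\<lambda>t. k * ?G t)"
    using eq by (subst (asm) set_integrable_cong[OF refl refl, of "{0<..}" _ "\<lambda>t. k * ?G t"]) auto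
  then have "set_integrable lborel {0<..} (\<lambda>t. inverse k * (k * ?G t))"
    by (rule set_integrable_mult_right)
  then show "set_integrable lborel {0<..} ?G"
    using k0 by (simp flip: mult.assoc)
  have "(LINT t:{0<..}|lborel. ?g (a * t)) = k * ?I"
    unfolding set_integral_mult_right[symmetric] using eq by (intro set_lebesgue_integral_cong) auto
  moreover have "(LINT t:{0<..}|lborel. ?g (a * t)) = Gamma s / of_real a"
    using set_integral_scale[OF assms(2), of ?g] Gamma_set_integral(2)[OF assms(1)] by simp
  ultimately have "k * ?I = Gamma s / of_real a"
    by simp
  then have "?I = Gamma s / of_real a / k"
    using k0 by (metis nonzero_mult_div_cancel_left)
  also have "\<dots> = Gamma s * of_real a powr (- s)"
    using assms(2) by (simp add: k_def powr_diff powr_minus field_simps)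
  finally show "?I = Gamma s * of_real a powr (- s)" .
qed

lemma summable_square_times_exp:
  assumes "b > 0"
  shows "summable (\<lambda>n. real n ^ 2 * exp (- b * real n))"
proof (rule summable_comparison_test_bigo)
  show "summable (\<lambda>n. norm (inverse (real n ^ 2)))"
    using inverse_power_summable[of 2, where 'a = real] by simp
  show "(\<lambda>n. real n ^ 2 * exp (- b * real n)) \<in> O(\<lambda>n. inverse (real n ^ 2))"
    using assms by real_asymp
qed

text \<open>Decay faster than every power at both ends makes the Mellin integral converge for all
  \<open>s\<close>; the decay at 0 does the work for which a functional equation is usually
  invoked.\<close>

locale mellin_transform =
  fixes h :: "real \<Rightarrow> complex"
  assumes h_cont: "continuous_on {0<..} h"
    and h_at_0: "\<And>n. \<exists>C. \<forall>y. 0 < y \<and> y \<le> 1 \<longrightarrow> cmod (h y) \<le> C * y ^ n"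
    and h_at_top: "\<And>n. \<exists>C. \<forall>y\<ge>1. cmod (h y) \<le> C / y ^ n"
begin

definition mellin :: "complex \<Rightarrow> complex" where
  "mellin s = (LINT y:{0<..}|lborel. h y * of_real y powr (s - 1))"

lemma integrand_continuous: "continuous_on {0<..} (\<lambda>y. h y * of_real y powr (s - 1))"
  by (intro continuous_intros h_cont continuous_on_of_real_powr)

text \<open>One majorant serves a whole vertical strip. Decay of order \<open>K + 1\<close> leaves a
  constant near 0 and a multiple of the inverse square of \<open>y\<close> at infinity; the factor 2
  compares both with \<open>inverse (1 + y\<^sup>2)\<close>.\<close>

lemma integrand_bound:
  obtains A where "A \<ge> 0" "\<And>s y. \<bar>Re s\<bar> \<le> real K \<Longrightarrow> y > 0 \<Longrightarrow> cmod (h y * of_real y powr (s - 1)) \<le> A * inverse (1 + y\<^sup>2)"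
proof -
  obtain C where C: "\<And>y. 0 < y \<Longrightarrow> y \<le> 1 \<Longrightarrow> cmod (h y) \<le> C * y ^ (K + 1)" using h_at_0[of "K + 1"] by auto
  obtain D where D: "\<And>y. 1 \<le> y \<Longrightarrow> cmod (h y) \<le> D / y ^ (K + 1)" using h_at_top[of "K + 1"] by auto
  have C0: "C \<ge> 0" using order_trans[OF norm_ge_zero C[of 1]] by simp
  have D0: "D \<ge> 0" using order_trans[OF norm_ge_zero D[of 1]] by simp
  show ?thesis
  proof
    show "0 \<le> 2 * max C D" using C0 by simp
    fix s y assume s: "\<bar>Re s\<bar> \<le> real K" and y: "y > (0::real)"
    have pw: "y ^ (K + 1) = y powr (real K + 1)" using powr_realpow[OF y, of "K + 1"] by (simp add: add.commute)
    have norm: "cmod (h y * of_real y powr (s - 1)) = cmod (h y) * y powr (Re s - 1)"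
      using y by (simp add: norm_mult norm_powr_real_powr)
    show "cmod (h y * of_real y powr (s - 1)) \<le> 2 * max C D * inverse (1 + y\<^sup>2)"
    proof (cases "y \<le> 1")
      case True
      have "cmod (h y) * y powr (Re s - 1) \<le> (C * y ^ (K + 1)) * y powr (- (real K + 1))"
        using s y True C C0 by (intro mult_mono powr_mono') auto
      also note pw
      also have "C * y powr (real K + 1) * y powr (- (real K + 1)) = C"
        using y by (simp add: mult.assoc flip: powr_add)
      also have "C \<le> max C D * 1" by simp
      also have "\<dots> \<le> max C D * (2 * inverse (1 + y\<^sup>2))"
      proof (rule mult_left_mono)
        have "1 + y\<^sup>2 \<le> 2" "1 + y\<^sup>2 > 0" using y True power_le_one[of y 2] by (auto simp: add_pos_nonneg)
        then show "1 \<le> 2 * inverse (1 + y\<^sup>2)" by (simp add: inverse_eq_divide)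
      qed (use C0 in simp)
      finally show ?thesis unfolding norm by (simp add: mult_ac)
    next
      case False
      have "cmod (h y) * y powr (Re s - 1) \<le> (D / y ^ (K + 1)) * y powr (real K - 1)"
        using s y False D D0 by (intro mult_mono powr_mono) auto
      also note pw
      also have "D / y powr (real K + 1) * y powr (real K - 1) = D * (y powr (real K - 1) / y powr (real K + 1))" by simp
      also have "y powr (real K - 1) / y powr (real K + 1) = y powr (- 2)"
        unfolding powr_diff[symmetric] by simp
      also have "y powr (- 2) = inverse (y\<^sup>2)" using y by (simp add: powr_minus)
      finally have 1: "cmod (h y) * y powr (Re s - 1) \<le> D * inverse (y\<^sup>2)" .
      have "1 \<le> y\<^sup>2" using False by (intro one_le_power) auto
      then have "inverse (y\<^sup>2) \<le> inverse ((1 + y\<^sup>2) / 2)" by (intro le_imp_inverse_le) auto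
      then have "inverse (y\<^sup>2) \<le> 2 * inverse (1 + y\<^sup>2)" by (simp add: inverse_eq_divide)
      then have "D * inverse (y\<^sup>2) \<le> D * (2 * inverse (1 + y\<^sup>2))" using D0 by (rule mult_left_mono)
      also have "\<dots> \<le> max C D * (2 * inverse (1 + y\<^sup>2))"
        by (intro mult_right_mono) (auto simp: add_nonneg_nonneg)
      finally show ?thesis using 1 unfolding norm by (simp add: mult_ac)
    qed
  qed
qed

lemma integrand_integrable: "set_integrable lborel {0<..} (\<lambda>y. h y * of_real y powr (s - 1))"
proof -
  obtain A where A: "\<And>s' y. \<bar>Re s'\<bar> \<le> real (nat \<lceil>\<bar>Re s\<bar>\<rceil>) \<Longrightarrow> y > 0 \<Longrightarrow>
      cmod (h y * of_real y powr (s' - 1)) \<le> A * inverse (1 + y\<^sup>2)"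
    using integrand_bound[of "nat \<lceil>\<bar>Re s\<bar>\<rceil>"] by metis
  show ?thesis
    by (rule set_integrable_quadratic_decay[OF integrand_continuous A]) (auto simp: real_nat_ceiling_ge)
qed

lemma h_integrable: "set_integrable lborel {0<..} h"
proof -
  have "set_integrable lborel {0<..} (\<lambda>y. h y * of_real y powr (1 - 1))" by (rule integrand_integrable)
  then show ?thesis
    by (subst (asm) set_integrable_cong[OF refl refl, of "{0<..}" _ h]) auto
qed

lemma mellin_1: "mellin 1 = (LINT y:{0<..}|lborel. h y)"
  unfolding mellin_def by (intro set_lebesgue_integral_cong) auto

lemma truncated_holomorphic:
  assumes "u > 0"
  shows "(\<lambda>s. LINT y:{u..w}|lborel. h y * of_real y powr (s - 1)) holomorphic_on UNIV"
proof -
  have sub: "cbox u w \<subseteq> {0<..}" using assms by auto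
  have cont: "continuous_on (cbox u w) (\<lambda>y. h y * of_real y powr (s - 1))" for s
    using integrand_continuous sub by (rule continuous_on_subset)
  have "(\<lambda>s. integral (cbox u w) (\<lambda>y. h y * of_real y powr (s - 1))) holomorphic_on UNIV"
  proof (rule leibniz_rule_holomorphic[where fx = "\<lambda>s y. h y * (Ln (of_real y) * of_real y powr (s - 1))"])
    fix s and y assume "y \<in> cbox u w"
    then have "y \<noteq> 0" using assms by auto
    then have "((\<lambda>s. of_real y powr (s - 1)) has_field_derivative (Ln (of_real y) * of_real y powr (s - 1)) * 1) (at s)"
      by (intro DERIV_chain2[OF has_field_derivative_powr_right]) (auto intro!: derivative_eq_intros)
    then show "((\<lambda>s. h y * of_real y powr (s - 1)) has_field_derivative h y * (Ln (of_real y) * of_real y powr (s - 1))) (at s within UNIV)"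
      by (intro DERIV_cmult) simp
  next
    show "(\<lambda>y. h y * of_real y powr (s - 1)) integrable_on cbox u w" for s
      by (intro integrable_continuous cont)
  next
    have h2: "continuous_on (UNIV \<times> cbox u w) (\<lambda>x. h (snd x))"
      by (rule continuous_on_compose2[OF h_cont]) (use sub in \<open>auto intro!: continuous_intros\<close>)
    have "continuous_on (UNIV \<times> cbox u w) (\<lambda>x::complex \<times> real. h (snd x) * (Ln (of_real (snd x)) * of_real (snd x) powr (fst x - 1)))"
      using assms by (intro continuous_intros h2) (auto simp: complex_nonpos_Reals_iff)
    then show "continuous_on (UNIV \<times> cbox u w) (\<lambda>(s, y). h y * (Ln (of_real y) * of_real y powr (s - 1)))"
      by (simp add: case_prod_beta')
  qed auto
  also have "(\<lambda>s. integral (cbox u w) (\<lambda>y. h y * of_real y powr (s - 1))) =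
      (\<lambda>s. LINT y:{u..w}|lborel. h y * of_real y powr (s - 1))"
  proof
    fix s
    have "set_integrable lborel {u..w} (\<lambda>y. h y * of_real y powr (s - 1))"
      using cont[of s] by (intro borel_integrable_atLeastAtMost') auto
    then show "integral (cbox u w) (\<lambda>y. h y * of_real y powr (s - 1)) =
      (LINT y:{u..w}|lborel. h y * of_real y powr (s - 1))"
      by (simp add: set_borel_integral_eq_integral)
  qed
  finally show ?thesis .
qed

text \<open>The truncated integrals are holomorphic by differentiation under the integral. Their
  distance from the limit is at most the tail \<open>W - Wn n\<close> of the majorant, which does
  not depend on \<open>s\<close> within the strip, so convergence is locally uniform.\<close>

lemma mellin_holomorphic: "mellin holomorphic_on UNIV"
proof (rule holomorphic_uniform_sequence[where f = "\<lambda>n s. LINT y:{inverse (real (Suc n))..real (Suc n)}|lborel. h y * of_real y powr (s - 1)"])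
  show "(\<lambda>s. LINT y:{inverse (real (Suc n))..real (Suc n)}|lborel. h y * of_real y powr (s - 1)) holomorphic_on UNIV" for n
    by (rule truncated_holomorphic) simp
next
  fix x :: complex
  define K where "K = nat \<lceil>\<bar>Re x\<bar> + 1\<rceil>"
  obtain A where A: "A \<ge> 0" "\<And>s y. \<bar>Re s\<bar> \<le> real K \<Longrightarrow> y > 0 \<Longrightarrow> cmod (h y * of_real y powr (s - 1)) \<le> A * inverse (1 + y\<^sup>2)"
    using integrand_bound[of K] by blast
  let ?I = "\<lambda>n. {inverse (real (Suc n))..real (Suc n)}"
  let ?w = "\<lambda>y::real. A * inverse (1 + y\<^sup>2)"
  have wint: "set_integrable lborel S ?w" if "S \<in> sets borel" for S
    unfolding set_integrable_def using that
    by (intro integrable_mult_indicator integrable_mult_right integrable_lborel_inverse_1_plus_square) auto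
  define W where "W = (LINT y:{0<..}|lborel. ?w y)"
  define Wn where "Wn = (\<lambda>n. LINT y:?I n|lborel. ?w y)"
  have W: "Wn \<longlonglongrightarrow> W"
    unfolding W_def Wn_def
    by (intro tendsto_integral_exhaust wint LIMSEQ_inverse_real_of_nat
         filterlim_compose[OF filterlim_real_sequentially filterlim_Suc]) auto
  have bound: "dist (LINT y:?I n|lborel. h y * of_real y powr (s - 1)) (mellin s) \<le> W - Wn n"
    if s: "\<bar>Re s\<bar> \<le> real K" for s n
  proof -
    let ?g = "\<lambda>y. h y * of_real y powr (s - 1)"
    let ?R = "{0<..} - ?I n"
    have sub: "?I n \<subseteq> {0<..}" by (auto intro: less_le_trans[of _ "inverse (real (Suc n))"])
    have un: "{0<..} = ?I n \<union> ?R" using sub by auto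
    have gint: "set_integrable lborel S ?g" if "S \<in> sets borel" "S \<subseteq> {0<..}" for S
      using integrand_integrable[of s] that by (auto intro: set_integrable_subset)
    have "mellin s = (LINT y:?I n|lborel. ?g y) + (LINT y:?R|lborel. ?g y)"
      unfolding mellin_def by (subst un, rule set_integral_Un) (use sub in \<open>auto intro!: gint\<close>)
    moreover have "W = Wn n + (LINT y:?R|lborel. ?w y)"
      unfolding W_def Wn_def by (subst un, rule set_integral_Un) (auto intro!: wint)
    moreover have "cmod (LINT y:?R|lborel. ?g y) \<le> (LINT y:?R|lborel. ?w y)"
    proof -
      have "cmod (LINT y:?R|lborel. ?g y) \<le> (LINT y:?R|lborel. cmod (?g y))"
        by (intro set_integral_norm_bound gint) auto
      also have "\<dots> \<le> (LINT y:?R|lborel. ?w y)"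
        using A(2)[OF s] by (intro set_integral_mono set_integrable_norm gint wint) auto
      finally show ?thesis .
    qed
    ultimately show ?thesis by (simp add: dist_norm norm_minus_commute)
  qed
  have "uniform_limit (cball x 1) (\<lambda>n s. LINT y:?I n|lborel. h y * of_real y powr (s - 1)) mellin sequentially"
  proof (rule uniform_limitI)
    fix e :: real assume "e > 0"
    then have "\<forall>\<^sub>F n in sequentially. dist (Wn n) W < e" using W by (intro tendstoD)
    then show "\<forall>\<^sub>F n in sequentially. \<forall>s\<in>cball x 1. dist (LINT y:?I n|lborel. h y * of_real y powr (s - 1)) (mellin s) < e"
    proof eventually_elim
      case (elim n)
      show ?case
      proof
        fix s assume "s \<in> cball x 1"
        then have "cmod (s - x) \<le> 1" by (simp add: dist_norm norm_minus_commute)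
        then have "\<bar>Re s - Re x\<bar> \<le> 1" using abs_Re_le_cmod[of "s - x"] by simp
        then have "\<bar>Re s\<bar> \<le> \<bar>Re x\<bar> + 1" by linarith
        also have "\<dots> \<le> real K" unfolding K_def by (rule real_nat_ceiling_ge)
        finally have "dist (LINT y:?I n|lborel. h y * of_real y powr (s - 1)) (mellin s) \<le> W - Wn n" by (rule bound)
        also have "\<dots> \<le> dist (Wn n) W" by (simp add: dist_real_def)
        finally show "dist (LINT y:?I n|lborel. h y * of_real y powr (s - 1)) (mellin s) < e" using elim by simp
      qed
    qed
  qed
  then show "\<exists>d>0. cball x d \<subseteq> UNIV \<and>
      uniform_limit (cball x d) (\<lambda>n s. LINT y:?I n|lborel. h y * of_real y powr (s - 1)) mellin sequentially"
    by (intro exI[of _ 1]) auto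
qed simp

text \<open>Termwise integration: the \<open>n\<close>-th exponential contributes
  \<open>Gamma s\<close> times \<open>2 * pi * n\<close> to the power \<open>- s\<close>.
  Coefficients of order \<open>n^2\<close> make the interchange legitimate for
  \<open>Re s > 3\<close>.\<close>

lemma mellin_dirichlet:
  fixes c :: "nat \<Rightarrow> complex"
  assumes c: "\<And>n. cmod (c n) \<le> B * real n ^ 2"
    and sums: "\<And>y. y > 0 \<Longrightarrow> (\<lambda>n. c n * of_real (exp (- (2 * pi * real n) * y))) sums h y"
    and s: "Re s > 3"
  shows "(\<lambda>n. c (Suc n) * of_nat (Suc n) powr (- s)) sums (of_real (2 * pi) powr s * rGamma s * mellin s)"
proof -
  have c0: "c 0 = 0" using c[of 0] by simp
  have B0: "B \<ge> 0" using order_trans[OF norm_ge_zero c[of 1]] by simp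
  define \<sigma> where "\<sigma> = Re s"
  let ?e = "\<lambda>s n t. complex_of_real t powr (s - 1) * of_real (exp (- (2 * pi * real n) * t))"
  define \<Phi> where "\<Phi> = (\<lambda>n y. indicator {0<..} y *\<^sub>R (c n * ?e s n y))"
  have int: "integrable lborel (\<Phi> n) \<and> integral\<^sup>L lborel (\<Phi> n) = c n * (Gamma s * of_real (2 * pi * real n) powr (- s))" for n
  proof (cases "n = 0")
    case True
    then show ?thesis by (simp add: \<Phi>_def c0)
  next
    case False
    then have a: "2 * pi * real n > 0" "Re s > 0" using s by auto
    have "\<Phi> n = (\<lambda>y. c n * (indicator {0<..} y *\<^sub>R ?e s n y))"
      by (simp add: \<Phi>_def fun_eq_iff)
    moreover have "integrable lborel (\<lambda>y. indicator {0<..} y *\<^sub>R ?e s n y)"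
      "(LINT y|lborel. indicator {0<..} y *\<^sub>R ?e s n y) = Gamma s * of_real (2 * pi * real n) powr (- s)"
      using Gamma_set_integral_scaled[OF a(2) a(1)] by (simp_all only: set_integrable_def set_lebesgue_integral_def)
    ultimately show ?thesis by (simp only: integrable_mult_right integral_mult_right_zero)
  qed
  \<comment> \<open>Passing to absolute values replaces \<open>s\<close> by its real part, so these
    norms are Gamma integrals again, at the real point \<open>\<sigma>\<close>. They are dominated
    by \<open>n powr (2 - \<sigma>)\<close>, summable as \<open>\<sigma> > 3\<close>.\<close>
  have norm_int: "(LINT y|lborel. norm (\<Phi> n y)) \<le> B * cmod (Gamma (of_real \<sigma>)) * (2 * pi) powr (- \<sigma>) * real n powr (2 - \<sigma>)" for n
  proof (cases "n = 0")
    case True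
    then show ?thesis by (simp add: \<Phi>_def c0)
  next
    case False
    then have a: "2 * pi * real n > 0" "Re (complex_of_real \<sigma>) > 0" using s by (auto simp: \<sigma>_def)
    have eq: "complex_of_real (norm (\<Phi> n y)) = of_real (cmod (c n)) * (indicator {0<..} y *\<^sub>R ?e (of_real \<sigma>) n y)" for y
    proof (cases "y > 0")
      case True
      have "complex_of_real y powr (of_real \<sigma> - 1) = of_real (y powr (\<sigma> - 1))"
        using True powr_of_real[of y "\<sigma> - 1"] by simp
      then show ?thesis
        using True by (simp add: \<Phi>_def norm_mult norm_powr_real_powr \<sigma>_def)
    qed (simp add: \<Phi>_def)
    have "complex_of_real (LINT y|lborel. norm (\<Phi> n y)) = (LINT y|lborel. complex_of_real (norm (\<Phi> n y)))" by simp
    also have "\<dots> = of_real (cmod (c n)) * (Gamma (of_real \<sigma>) * of_real (2 * pi * real n) powr (- of_real \<sigma>))"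
      unfolding eq integral_mult_right_zero using Gamma_set_integral_scaled(2)[OF a(2) a(1)]
      by (simp only: set_lebesgue_integral_def)
    finally have "cmod (complex_of_real (LINT y|lborel. norm (\<Phi> n y))) =
        cmod (c n) * (cmod (Gamma (of_real \<sigma>)) * (2 * pi * real n) powr (- \<sigma>))"
      using a by (simp add: norm_mult norm_powr_real_powr)
    then have "(LINT y|lborel. norm (\<Phi> n y)) = cmod (c n) * (cmod (Gamma (of_real \<sigma>)) * (2 * pi * real n) powr (- \<sigma>))"
      by (simp add: abs_of_nonneg[OF Bochner_Integration.integral_nonneg])
    also have "\<dots> \<le> (B * real n ^ 2) * (cmod (Gamma (of_real \<sigma>)) * (2 * pi * real n) powr (- \<sigma>))"
      using c by (intro mult_right_mono) auto
    also have "(2 * pi * real n) powr (- \<sigma>) = (2 * pi) powr (- \<sigma>) * real n powr (- \<sigma>)"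
      by (simp add: powr_mult)
    also have "(B * real n ^ 2) * (cmod (Gamma (of_real \<sigma>)) * ((2 * pi) powr (- \<sigma>) * real n powr (- \<sigma>))) =
        B * cmod (Gamma (of_real \<sigma>)) * (2 * pi) powr (- \<sigma>) * (real n powr 2 * real n powr (- \<sigma>))"
      using False by (simp add: powr_numeral)
    also have "real n powr 2 * real n powr (- \<sigma>) = real n powr (2 - \<sigma>)" unfolding powr_add[symmetric] by simp
    finally show ?thesis .
  qed
  have summ: "summable (\<lambda>n. LINT y|lborel. norm (\<Phi> n y))"
  proof (rule summable_comparison_test'[where N = 0])
    show "summable (\<lambda>n. B * cmod (Gamma (of_real \<sigma>)) * (2 * pi) powr (- \<sigma>) * real n powr (2 - \<sigma>))"
      using s by (intro summable_mult) (simp add: summable_real_powr_iff \<sigma>_def)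
    show "norm (LINT y|lborel. norm (\<Phi> n y)) \<le> B * cmod (Gamma (of_real \<sigma>)) * (2 * pi) powr (- \<sigma>) * real n powr (2 - \<sigma>)" for n
      using norm_int[of n] by (simp add: abs_of_nonneg[OF Bochner_Integration.integral_nonneg])
  qed
  have \<Phi>_sums: "(\<lambda>n. \<Phi> n y) sums (indicator {0<..} y *\<^sub>R (h y * of_real y powr (s - 1)))" for y
  proof (cases "y > 0")
    case True
    show ?thesis
      using sums_mult2[OF sums[OF True], of "of_real y powr (s - 1)"] True by (simp add: \<Phi>_def mult_ac)
  qed (simp add: \<Phi>_def)
  have abs_summ: "AE y in lborel. summable (\<lambda>n. norm (\<Phi> n y))"
  proof (rule AE_I2)
    fix y :: real
    show "summable (\<lambda>n. norm (\<Phi> n y))"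
    proof (cases "y > 0")
      case True
      have "summable (\<lambda>n. (B * y powr (\<sigma> - 1)) * (real n ^ 2 * exp (- (2 * pi * y) * real n)))"
        using True by (intro summable_mult summable_square_times_exp) auto
      then show ?thesis
      proof (rule summable_comparison_test'[where N = 0])
        fix n
        have "norm (\<Phi> n y) = cmod (c n) * (y powr (\<sigma> - 1) * exp (- (2 * pi * y) * real n))"
          using True by (simp add: \<Phi>_def norm_mult norm_powr_real_powr \<sigma>_def mult_ac)
        also have "\<dots> \<le> (B * real n ^ 2) * (y powr (\<sigma> - 1) * exp (- (2 * pi * y) * real n))"
          using c by (intro mult_right_mono) auto
        finally show "norm (norm (\<Phi> n y)) \<le> (B * y powr (\<sigma> - 1)) * (real n ^ 2 * exp (- (2 * pi * y) * real n))" by (simp add: mult_ac)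
      qed
    qed (simp add: \<Phi>_def)
  qed
  have "(\<lambda>n. integral\<^sup>L lborel (\<Phi> n)) sums (LINT y|lborel. (\<Sum>n. \<Phi> n y))"
    using int by (intro sums_integral abs_summ summ) auto
  also have "(\<lambda>n. integral\<^sup>L lborel (\<Phi> n)) = (\<lambda>n. c n * (Gamma s * of_real (2 * pi * real n) powr (- s)))"
    using int by auto
  also have "(LINT y|lborel. (\<Sum>n. \<Phi> n y)) = mellin s"
    using \<Phi>_sums[THEN sums_unique] by (simp add: mellin_def set_lebesgue_integral_def)
  finally have "(\<lambda>n. (of_real (2 * pi) powr s * rGamma s) * (c n * (Gamma s * of_real (2 * pi * real n) powr (- s))))
      sums ((of_real (2 * pi) powr s * rGamma s) * mellin s)" by (rule sums_mult)
  moreover have "(of_real (2 * pi) powr s * rGamma s) * (c n * (Gamma s * of_real (2 * pi * real n) powr (- s))) =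
      c n * of_nat n powr (- s)" for n
  proof -
    have "Gamma s \<noteq> 0" using s by (intro Gamma_nonzero) (auto elim!: nonpos_Ints_cases)
    then have "rGamma s * Gamma s = 1" by (simp add: rGamma_inverse_Gamma)
    moreover have scale: "of_real (2 * pi * real n) powr (- s) = of_real (2 * pi) powr (- s) * of_nat n powr (- s)"
      using powr_times_real[of "of_real (2 * pi)" "of_nat n" "- s"] by simp
    moreover have "of_real (2 * pi) powr s * of_real (2 * pi) powr (- s) = (1 :: complex)"
      by (simp add: powr_minus)
    moreover have "(of_real (2 * pi) powr s * rGamma s) * (c n * (Gamma s * (of_real (2 * pi) powr (- s) * of_nat n powr (- s)))) =
        (of_real (2 * pi) powr s * of_real (2 * pi) powr (- s)) * (rGamma s * Gamma s) * (c n * of_nat n powr (- s))"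
      by (simp only: mult_ac)
    ultimately show ?thesis unfolding scale by (simp only: mult_1)
  qed
  ultimately have "(\<lambda>n. c n * of_nat n powr (- s)) sums (of_real (2 * pi) powr s * rGamma s * mellin s)"
    by (simp only:)
  then show ?thesis
    using sums_Suc_iff[of "\<lambda>n. c n * of_nat n powr (- s)"] by (simp add: c0 del: of_nat_Suc)
qed

text \<open>Writing the candidate with the entire function \<open>rGamma\<close> makes it entire; at
  1 the prefactor is \<open>2 * pi\<close>. Two candidates agree on the smaller of their half planes
  of convergence, hence everywhere by the identity theorem.\<close>

lemma L_function:
  fixes c :: "nat \<Rightarrow> complex"
  assumes c: "\<And>n. cmod (c n) \<le> B * real n ^ 2"
    and sums: "\<And>y. y > 0 \<Longrightarrow> (\<lambda>n. c n * of_real (exp (- (2 * pi * real n) * y))) sums h y"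
  shows "(THE L. L holomorphic_on UNIV \<and>
        (\<exists>\<sigma>. \<forall>s. Re s > \<sigma> \<longrightarrow> (\<lambda>n. c (Suc n) * of_nat (Suc n) powr (- s)) sums L s)) 1
     = 2 * pi * (LINT y:{0<..}|lborel. h y)"
proof -
  define L where "L = (\<lambda>s. of_real (2 * pi) powr s * rGamma s * mellin s)"
  define P where "P = (\<lambda>L. L holomorphic_on UNIV \<and>
        (\<exists>\<sigma>. \<forall>s. Re s > \<sigma> \<longrightarrow> (\<lambda>n. c (Suc n) * of_nat (Suc n) powr (- s)) sums L s))"
  have L: "P L"
    unfolding P_def
  proof (intro conjI exI allI impI)
    show "L holomorphic_on UNIV"
      unfolding L_def by (intro holomorphic_intros mellin_holomorphic)
    fix s :: complex assume "Re s > 3"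
    then show "(\<lambda>n. c (Suc n) * of_nat (Suc n) powr (- s)) sums L s"
      unfolding L_def by (intro mellin_dirichlet[of c B] c sums)
  qed
  have "(THE L. P L) = L"
  proof (rule the_equality[of P L, OF L])
    fix L' assume L': "P L'"
    obtain \<sigma> where "\<forall>s. Re s > \<sigma> \<longrightarrow> (\<lambda>n. c (Suc n) * of_nat (Suc n) powr (- s)) sums L s"
      using L by (auto simp: P_def)
    moreover obtain \<sigma>' where "\<forall>s. Re s > \<sigma>' \<longrightarrow> (\<lambda>n. c (Suc n) * of_nat (Suc n) powr (- s)) sums L' s"
      using L' by (auto simp: P_def)
    ultimately have eq: "L' s = L s" if "Re s > max \<sigma> \<sigma>'" for s
      using that by (meson max_less_iff_conj sums_unique2)
    have "L' s - L s = 0" for s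
    proof (rule analytic_continuation_open[where f = "\<lambda>s. L' s - L s" and g = "\<lambda>_. 0" and s = "{s. Re s > max \<sigma> \<sigma>'}" and s' = UNIV])
      show "{s. Re s > max \<sigma> \<sigma>'} \<noteq> {}"
        by (auto intro!: exI[of _ "of_real (max \<sigma> \<sigma>' + 1)"])
      show "(\<lambda>s. L' s - L s) holomorphic_on UNIV"
        using L L' by (auto simp: P_def intro!: holomorphic_intros)
      show "open {s. Re s > max \<sigma> \<sigma>'}" by (rule open_halfspace_Re_gt)
    qed (use eq in auto)
    then show "L' = L" by (simp add: fun_eq_iff)
  qed
  then have "(THE L. P L) 1 = L 1" by simp
  then show ?thesis by (simp add: P_def L_def mellin_1)
qed

end

section \<open>Modular symbols of a rational newform\<close>

lemma powser_unique_zero: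
  fixes d :: "nat \<Rightarrow> complex"
  assumes "\<And>x. cmod x < 1 \<Longrightarrow> (\<lambda>n. d n * x ^ n) sums 0"
  shows "d n = 0"
proof -
  have rad: "conv_radius d \<ge> 1"
  proof (rule conv_radius_geI_ex')
    fix r :: real assume "0 < r" "ereal r < 1"
    then show "summable (\<lambda>n. d n * of_real r ^ n)"
      using assms[of "of_real r"] by (auto intro: sums_summable simp: one_ereal_def)
  qed
  define F where "F = Abs_fps d"
  have "eval_fps F x = 0" if "cmod x < 1" for x
    using assms[OF that] by (simp add: F_def eval_fps_def sums_iff)
  then have "\<forall>\<^sub>F x in nhds 0. eval_fps F x = eval_fps 0 x"
    by (intro eventually_mono[OF eventually_nhds_in_open[of "ball 0 1"]]) auto
  moreover have "fps_conv_radius F > 0"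
    using rad by (simp add: F_def fps_conv_radius_def fps_nth_Abs_fps[abs_def] less_le_trans[of 0 1])
  ultimately have "F = 0" by (intro eval_fps_eqD) auto
  then have "fps_nth F n = 0" by simp
  then show ?thesis by (simp add: F_def)
qed

text \<open>A right inverse of \<open>z \<mapsto> exp (2 pi i z)\<close>, which carries the
  punctured unit disc into the upper half plane.\<close>

definition upper_log :: "complex \<Rightarrow> complex" where
  "upper_log x = Ln x / (2 * of_real pi * \<i>)"

lemma Im_upper_log: "x \<noteq> 0 \<Longrightarrow> Im (upper_log x) = - ln (cmod x) / (2 * pi)"
  by (simp add: upper_log_def Im_divide power2_eq_square field_simps)

lemma exp_upper_log: "x \<noteq> 0 \<Longrightarrow> exp (2 * of_real pi * \<i> * upper_log x) = x"
  by (simp add: upper_log_def)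

lemma upper_log_upper: "x \<noteq> 0 \<Longrightarrow> cmod x < 1 \<Longrightarrow> Im (upper_log x) > 0"
  by (simp add: Im_upper_log divide_neg_pos)

lemma sums_multiples:
  fixes g :: "nat \<Rightarrow> complex"
  assumes "q > 0" "(\<lambda>n. g n * (x ^ q) ^ n) sums s"
  shows "(\<lambda>m. (if q dvd m then g (m div q) else 0) * x ^ m) sums s"
proof -
  have "strict_mono (\<lambda>n. q * n)" using assms(1) by (simp add: strict_mono_def)
  moreover have "(if q dvd m then g (m div q) else 0) * x ^ m = 0" if "m \<notin> range (\<lambda>n. q * n)" for m
    using that by (auto simp: dvd_def)
  ultimately have "(\<lambda>n. (if q dvd q * n then g (q * n div q) else 0) * x ^ (q * n)) sums s \<longleftrightarrow> ?thesis"
    using sums_mono_reindex[of "\<lambda>n. q * n" "\<lambda>m. (if q dvd m then g (m div q) else 0) * x ^ m" s] by simp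
  moreover have "(\<lambda>n. (if q dvd q * n then g (q * n div q) else 0) * x ^ (q * n)) = (\<lambda>n. g n * (x ^ q) ^ n)"
    using assms(1) by (auto simp: fun_eq_iff power_mult)
  ultimately show ?thesis using assms(2) by simp
qed

locale rational_newform = cusp_form_weight_2 +
  fixes a :: "nat \<Rightarrow> complex"
  assumes eigenform: "hecke_eigenform2 N f"
    and expansion: "q_expansion f a"
    and a_1: "a 1 = 1"
    and a_rational: "\<And>n. a n \<in> \<rat>"
begin

lemma a_0: "a 0 = 0"
  using expansion by (simp add: q_expansion_def)

lemma f_sums: "Im z > 0 \<Longrightarrow> (\<lambda>n. a n * exp (2 * of_real pi * \<i> * z) ^ n) sums f z"
  using expansion by (simp add: q_expansion_def)

lemma powser_sums: "x \<noteq> 0 \<Longrightarrow> cmod x < 1 \<Longrightarrow> (\<lambda>n. a n * x ^ n) sums f (upper_log x)"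
  using f_sums[of "upper_log x"] by (simp add: upper_log_upper exp_upper_log)

text \<open>Cauchy's inequality on the circle of radius \<open>exp (- 2 * pi / n)\<close>, the image
  of height \<open>1 / n\<close>: there the form is at most \<open>B * n^2\<close>, and the radius
  to the power \<open>- n\<close> is the constant \<open>exp (2 * pi)\<close>.\<close>

lemma coefficient_bound:
  obtains B where "\<And>n. cmod (a n) \<le> B * real n ^ 2"
proof -
  obtain B where B: "B > 0" "\<And>z. 0 < Im z \<Longrightarrow> Im z \<le> 1 \<Longrightarrow> cmod (f z) \<le> B / (Im z)\<^sup>2"
    using polynomial_bound by blast
  define F where "F = Abs_fps a"
  have "conv_radius a \<ge> 1"
  proof (rule conv_radius_geI_ex')
    fix r :: real assume "0 < r" "ereal r < 1"
    then show "summable (\<lambda>n. a n * of_real r ^ n)"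
      using powser_sums[of "of_real r"] by (auto intro: sums_summable simp: one_ereal_def)
  qed
  then have rad: "fps_conv_radius F \<ge> 1" by (simp add: F_def fps_conv_radius_def fps_nth_Abs_fps[abs_def])
  have eval: "eval_fps F x = f (upper_log x)" if "x \<noteq> 0" "cmod x < 1" for x
    using powser_sums[OF that] by (simp add: F_def eval_fps_def sums_iff)
  have "cmod (a n) \<le> (B * exp (2 * pi)) * real n ^ 2" for n
  proof (cases "n = 0")
    case True
    then show ?thesis by (simp add: a_0)
  next
    case False
    define r where "r = exp (- 2 * pi / real n)"
    have r: "0 < r" "r < 1" using False by (auto simp: r_def)
    have "cball 0 r \<subseteq> eball (0::complex) (fps_conv_radius F)"
    proof
      fix x :: complex assume "x \<in> cball 0 r"
      then have "ereal (norm x) < 1" using r by (simp add: one_ereal_def)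
      also note rad
      finally show "x \<in> eball 0 (fps_conv_radius F)" by (simp add: in_eball_iff)
    qed
    then have hol: "eval_fps F holomorphic_on cball 0 r" by (rule holomorphic_on_eval_fps)
    have "cmod ((deriv ^^ n) (eval_fps F) 0) \<le> fact n * (B * real n ^ 2) / r ^ n"
    proof (rule Cauchy_inequality)
      show "eval_fps F holomorphic_on ball 0 r" by (rule holomorphic_on_subset[OF hol]) auto
      show "continuous_on (cball 0 r) (eval_fps F)" by (rule holomorphic_on_imp_continuous_on[OF hol])
      fix x :: complex assume "cmod (0 - x) = r"
      then have x: "cmod x = r" "x \<noteq> 0" "cmod x < 1" using r by auto
      have im: "Im (upper_log x) = 1 / real n" using x(2) by (simp add: Im_upper_log x(1) r_def)
      have "cmod (f (upper_log x)) \<le> B / (1 / real n)\<^sup>2"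
        using B(2)[of "upper_log x"] False by (simp add: im)
      then show "cmod (eval_fps F x) \<le> B * real n ^ 2" using eval[OF x(2,3)] by (simp add: power_divide)
    qed (rule r)
    then have "cmod ((deriv ^^ n) (eval_fps F) 0) / fact n \<le> fact n * (B * real n ^ 2) / r ^ n / fact n"
      by (rule divide_right_mono) simp
    moreover have "fps_nth F n = (deriv ^^ n) (eval_fps F) 0 / fact n"
      using rad by (intro fps_nth_conv_deriv) (auto intro: less_le_trans[of 0 1])
    then have "cmod (a n) = cmod ((deriv ^^ n) (eval_fps F) 0) / fact n"
      by (subst (asm) F_def) (simp add: norm_divide)
    ultimately have "cmod (a n) \<le> B * real n ^ 2 / r ^ n" by simp
    also have "r ^ n = exp (- 2 * pi)"
      using False by (simp add: r_def exp_of_nat_mult[symmetric])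
    finally show ?thesis by (simp add: exp_minus field_simps)
  qed
  then show ?thesis by (rule that)
qed

section \<open>Hecke relations and symmetries of the form\<close>

lemma hecke_op_prime:
  assumes q: "prime q" "\<not> q dvd N"
  shows "hecke_op2 N q f z = of_nat q * f (of_nat q * z) + (\<Sum>b<q. f ((z + of_nat b) / of_nat q)) / of_nat q"
proof -
  have "{d. d dvd q \<and> coprime (q div d) N} = {1, q}"
    using q prime_gt_0_nat[of q] by (auto simp: prime_imp_coprime prime_nat_iff)
  moreover have "q \<noteq> 1" "q \<noteq> 0" using q by auto
  ultimately show ?thesis
    by (simp add: hecke_op2_def distrib_left power2_eq_square)
qed

text \<open>Averaging over the \<open>q\<close> translates multiplies the \<open>n\<close>-th
  coefficient by a mean of roots of unity, which keeps exactly the exponents divisible by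
  \<open>q\<close>.\<close>

lemma average_sums:
  assumes q: "q > 0" and x: "x \<noteq> 0" "cmod x < 1"
  shows "(\<lambda>m. a (q * m) * x ^ m) sums ((\<Sum>b<q. f ((upper_log x + of_nat b) / of_nat q)) / of_nat q)"
proof -
  define z where "z = upper_log x"
  have z: "Im z > 0" using upper_log_upper[OF x] by (simp add: z_def)
  define w where "w = exp (2 * of_real pi * \<i> * (z / of_nat q))"
  have wq: "w ^ q = x"
    using q x by (simp add: w_def exp_of_nat_mult[symmetric] z_def exp_upper_log)
  have "(\<lambda>n. a n * exp (2 * of_real pi * \<i> * ((z + of_nat b) / of_nat q)) ^ n) sums f ((z + of_nat b) / of_nat q)" for b
    using z q by (intro f_sums) (simp add: zero_less_divide_iff)
  moreover have "exp (2 * of_real pi * \<i> * ((z + of_nat b) / of_nat q)) ^ n = w ^ n * eM (int q) (int b * int n)" for b n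
  proof -
    have "exp (2 * of_real pi * \<i> * ((z + of_nat b) / of_nat q)) ^ n =
        exp (2 * of_real pi * \<i> * (z / of_nat q)) ^ n * exp (2 * of_real pi * \<i> * (of_nat b / of_nat q)) ^ n"
      by (simp add: add_divide_distrib distrib_left exp_add power_mult_distrib)
    also have "exp (2 * of_real pi * \<i> * (of_nat b / of_nat q)) ^ n = eM (int q) (int b * int n)"
      by (simp add: eM_def exp_of_nat_mult[symmetric] mult_ac)
    finally show ?thesis by (simp add: w_def)
  qed
  ultimately have "(\<lambda>n. a n * (w ^ n * eM (int q) (int b * int n))) sums f ((z + of_nat b) / of_nat q)" for b
    by simp
  then have "(\<lambda>n. \<Sum>b<q. a n * (w ^ n * eM (int q) (int b * int n))) sums (\<Sum>b<q. f ((z + of_nat b) / of_nat q))"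
    by (intro sums_sum)
  moreover have "(\<Sum>b<q. a n * (w ^ n * eM (int q) (int b * int n))) = (if q dvd n then of_nat q * a n * w ^ n else 0)" for n
  proof -
    have "(\<Sum>b<q. eM (int q) (int b * int n)) = (\<Sum>k\<in>{0..<int q}. eM (int q) (k * int n))"
      by (rule sum.reindex_bij_witness[where i = nat and j = int]) auto
    also have "\<dots> = (if q dvd n then of_nat q else 0)" using q by (simp add: sum_eM)
    finally show ?thesis by (simp flip: sum_distrib_left)
  qed
  ultimately have "(\<lambda>n. if q dvd n then of_nat q * a n * w ^ n else 0) sums (\<Sum>b<q. f ((z + of_nat b) / of_nat q))"
    by simp
  moreover have "strict_mono (\<lambda>n. q * n)" using q by (simp add: strict_mono_def)
  ultimately have "(\<lambda>m. if q dvd q * m then of_nat q * a (q * m) * w ^ (q * m) else 0) sums (\<Sum>b<q. f ((z + of_nat b) / of_nat q))"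
    by (subst sums_mono_reindex[of "\<lambda>n. q * n"]) (auto simp: dvd_def)
  then have "(\<lambda>m. of_nat q * (a (q * m) * x ^ m)) sums (\<Sum>b<q. f ((z + of_nat b) / of_nat q))"
    using q by (simp add: power_mult[of w q] wq mult.assoc)
  then have "(\<lambda>m. of_nat q * (a (q * m) * x ^ m) / of_nat q) sums ((\<Sum>b<q. f ((z + of_nat b) / of_nat q)) / of_nat q)"
    by (rule sums_divide)
  then show ?thesis using q by (simp add: z_def)
qed

text \<open>The eigenform property gives some eigenvalue \<open>c\<close>. Comparing first
  coefficients identifies it with \<open>a q\<close>, because \<open>a 1 = 1\<close> and the
  oldform-type term \<open>f (q z)\<close> has no first coefficient.\<close>

lemma hecke_relation:
  assumes q: "prime q" "\<not> q dvd N" and z: "Im z > 0"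
  shows "a q * f z = of_nat q * f (of_nat q * z) + (\<Sum>b<q. f ((z + of_nat b) / of_nat q)) / of_nat q"
proof -
  have q1: "q \<ge> 1" "q > 1" using q prime_gt_1_nat[of q] by auto
  have "\<exists>c. \<forall>z\<in>upper_half_plane. hecke_op2 N q f z = c * f z"
    using eigenform q1(1) unfolding hecke_eigenform2_def by blast
  then obtain c where "\<forall>z\<in>upper_half_plane. hecke_op2 N q f z = c * f z" by blast
  then have c: "hecke_op2 N q f z = c * f z" if "Im z > 0" for z using that by simp
  \<comment> \<open>The \<open>m\<close>-th coefficient of the Hecke operator applied to
    \<open>f\<close>, minus \<open>c\<close> times \<open>f\<close>.\<close>
  define d where "d = (\<lambda>m. a (q * m) + (if q dvd m then of_nat q * a (m div q) else 0) - c * a m)"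
  have "(\<lambda>m. d m * x ^ m) sums 0" if x1: "cmod x < 1" for x
  proof (cases "x = 0")
    case True
    then show ?thesis using sums_finite[of "{0}" "\<lambda>m. d m * x ^ m"] by (auto simp: d_def a_0)
  next
    case False
    define z where "z = upper_log x"
    have z: "Im z > 0" using upper_log_upper[OF False x1] by (simp add: z_def)
    have 1: "(\<lambda>m. a (q * m) * x ^ m) sums ((\<Sum>b<q. f ((z + of_nat b) / of_nat q)) / of_nat q)"
      unfolding z_def using q1 by (intro average_sums False x1) auto
    have "exp (2 * of_real pi * \<i> * (of_nat q * z)) = x ^ q"
      using False by (simp add: z_def exp_upper_log flip: exp_of_nat_mult) (metis exp_of_nat_mult exp_upper_log mult.left_commute)
    then have "(\<lambda>n. a n * (x ^ q) ^ n) sums f (of_nat q * z)"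
      using f_sums[of "of_nat q * z"] z q1 by simp
    then have "(\<lambda>n. of_nat q * a n * (x ^ q) ^ n) sums (of_nat q * f (of_nat q * z))"
      using sums_mult by (simp add: mult.assoc)
    then have 2: "(\<lambda>m. (if q dvd m then of_nat q * a (m div q) else 0) * x ^ m) sums (of_nat q * f (of_nat q * z))"
      using q1 by (intro sums_multiples) auto
    have 3: "(\<lambda>m. c * (a m * x ^ m)) sums (c * f z)"
      unfolding z_def by (intro sums_mult powser_sums False x1)
    have "(\<lambda>m. a (q * m) * x ^ m + (if q dvd m then of_nat q * a (m div q) else 0) * x ^ m - c * (a m * x ^ m)) sums
        ((\<Sum>b<q. f ((z + of_nat b) / of_nat q)) / of_nat q + of_nat q * f (of_nat q * z) - c * f z)"
      by (intro sums_add sums_diff 1 2 3)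
    moreover have "(\<Sum>b<q. f ((z + of_nat b) / of_nat q)) / of_nat q + of_nat q * f (of_nat q * z) - c * f z = 0"
      using c[OF z] hecke_op_prime[OF q, of z] by (simp add: add.commute)
    ultimately show ?thesis by (simp add: d_def algebra_simps)
  qed
  then have "d 1 = 0" by (rule powser_unique_zero)
  then have "c = a q" using q1 a_1 by (simp add: d_def)
  with c[OF z] hecke_op_prime[OF q, of z] show ?thesis by simp
qed

lemma f_plus_1: "Im z > 0 \<Longrightarrow> f (z + 1) = f z"
  using f_slash[of "(1, 1, 0, 1)" z] by (simp add: Gamma0_def SL2Z_def slash2_def mat2_act_def aut_factor_def)

lemma f_cnj:
  assumes "Im z > 0"
  shows "f (- cnj z) = cnj (f z)"
proof -
  have "(\<lambda>n. cnj (a n * exp (2 * of_real pi * \<i> * z) ^ n)) sums cnj (f z)"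
    using f_sums[OF assms] by (simp only: sums_cnj)
  moreover have "cnj (a n) = a n" for n
    using a_rational[of n] by (auto elim!: Rats_cases')
  ultimately have "(\<lambda>n. a n * exp (2 * of_real pi * \<i> * (- cnj z)) ^ n) sums cnj (f z)"
    by (simp add: exp_cnj)
  moreover have "(\<lambda>n. a n * exp (2 * of_real pi * \<i> * (- cnj z)) ^ n) sums f (- cnj z)"
    using assms by (intro f_sums) simp
  ultimately show ?thesis using sums_unique2 by blast
qed

section \<open>Modular symbols as integrals along vertical lines\<close>

definition symbol :: "real \<Rightarrow> complex" where
  "symbol r = 2 * pi * (LINT y:{0<..}|lborel. f (Complex r y))"

lemma vertical_continuous: "continuous_on {0<..} (\<lambda>y. f (Complex r y))"
proof (rule continuous_on_compose2[OF holomorphic_on_imp_continuous_on[OF f_holomorphic]])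
  show "continuous_on {0<..} (\<lambda>y. Complex r y)"
    unfolding Complex_eq by (intro continuous_intros)
qed auto

lemma vertical_mellin:
  assumes "r \<in> \<rat>"
  shows "mellin_transform (\<lambda>y. f (Complex r y))"
proof
  show "continuous_on {0<..} (\<lambda>y. f (Complex r y))" by (rule vertical_continuous)
  show "\<exists>C. \<forall>y. 0 < y \<and> y \<le> 1 \<longrightarrow> cmod (f (Complex r y)) \<le> C * y ^ n" for n
    using vertical_decay_at_0[OF assms, of n] by metis
  show "\<exists>C. \<forall>y\<ge>1. cmod (f (Complex r y)) \<le> C / y ^ n" for n
    using vertical_decay_at_top[of n] by metis
qed

lemma vertical_integrable: "r \<in> \<rat> \<Longrightarrow> set_integrable lborel {0<..} (\<lambda>y. f (Complex r y))"
  using mellin_transform.h_integrable[OF vertical_mellin] .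

lemma symbol_plus_1: "symbol (r + 1) = symbol r"
proof -
  have "f (Complex (r + 1) y) = f (Complex r y)" if "y > 0" for y
    using f_plus_1[of "Complex r y"] that by (simp add: complex_eq_iff Complex_eq add_ac)
  then have "(LINT y:{0<..}|lborel. f (Complex (r + 1) y)) = (LINT y:{0<..}|lborel. f (Complex r y))"
    by (intro set_lebesgue_integral_cong) auto
  then show ?thesis by (simp add: symbol_def)
qed

lemma symbol_minus: "symbol (- r) = cnj (symbol r)"
proof -
  have "f (Complex (- r) y) = cnj (f (Complex r y))" if "y > 0" for y
  proof -
    have "- cnj (Complex r y) = Complex (- r) y" by (simp add: complex_eq_iff)
    then show ?thesis using f_cnj[of "Complex r y"] that by simp
  qed
  then have "(LINT y:{0<..}|lborel. f (Complex (- r) y)) = (LINT y:{0<..}|lborel. cnj (f (Complex r y)))"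
    by (intro set_lebesgue_integral_cong) auto
  also have "\<dots> = cnj (LINT y:{0<..}|lborel. f (Complex r y))"
  proof -
    have "(\<lambda>y. indicator {0<..} y *\<^sub>R cnj (f (Complex r y))) = (\<lambda>y. cnj (indicator {0<..} y *\<^sub>R f (Complex r y)))"
      by auto
    then show ?thesis unfolding set_lebesgue_integral_def by (simp only: Bochner_Integration.integral_cnj)
  qed
  finally show ?thesis by (simp add: symbol_def)
qed

text \<open>Rescaling \<open>y\<close> by \<open>q\<close> in the first term and by
  \<open>1 / q\<close> in the others absorbs exactly the factors \<open>q\<close> and
  \<open>1 / q\<close> of the weight 2 relation.\<close>

lemma symbol_hecke:
  assumes q: "prime q" "\<not> q dvd N" and r: "r \<in> \<rat>"
  shows "a q * symbol r = symbol (of_nat q * r) + (\<Sum>b<q. symbol ((r + of_nat b) / of_nat q))"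
proof -
  have q0: "real q > 0" using q prime_gt_0_nat[of q] by simp
  have rb: "(r + of_nat b) / of_nat q \<in> \<rat>" "of_nat q * r \<in> \<rat>" for b using r by auto
  let ?g = "\<lambda>b y. f (Complex ((r + of_nat b) / of_nat q) y)"
  have rel: "a q * f (Complex r y) = of_nat q * f (Complex (real q * r) (real q * y)) +
      (\<Sum>b<q. ?g b (inverse (real q) * y) / of_nat q)" if "y > 0" for y
  proof -
    have "of_nat q * Complex r y = Complex (real q * r) (real q * y)" by (simp add: complex_eq_iff)
    moreover have "(Complex r y + of_nat b) / of_nat q = Complex ((r + of_nat b) / of_nat q) (inverse (real q) * y)" for b
    proof -
      have "(Complex r y + of_nat b) / of_real (real q) = Complex ((r + of_nat b) / of_nat q) (inverse (real q) * y)"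
        by (simp only: complex_eq_iff Re_divide_of_real Im_divide_of_real) (simp add: divide_inverse mult.commute)
      then show ?thesis by simp
    qed
    ultimately show ?thesis using hecke_relation[OF q, of "Complex r y"] that by (simp add: sum_divide_distrib)
  qed
  have i1: "set_integrable lborel {0<..} (\<lambda>y. of_nat q * f (Complex (real q * r) (real q * y)))"
    by (intro set_integrable_mult_right set_integrable_scale[where g = "\<lambda>y. f (Complex (real q * r) y)"] q0 vertical_integrable rb)
  have i2: "set_integrable lborel {0<..} (\<lambda>y. ?g b (inverse (real q) * y) / of_nat q)" for b
    using q0 by (intro set_integrable_divide set_integrable_scale[where g = "?g b"] vertical_integrable rb) auto
  have i3: "set_integrable lborel {0<..} (\<lambda>y. \<Sum>b<q. ?g b (inverse (real q) * y) / of_nat q)"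
    using i2 unfolding set_integrable_def scaleR_sum_right by (intro Bochner_Integration.integrable_sum)
  have "a q * (LINT y:{0<..}|lborel. f (Complex r y)) = (LINT y:{0<..}|lborel. a q * f (Complex r y))"
    by simp
  also have "\<dots> = (LINT y:{0<..}|lborel. of_nat q * f (Complex (real q * r) (real q * y)) +
      (\<Sum>b<q. ?g b (inverse (real q) * y) / of_nat q))"
    using rel by (intro set_lebesgue_integral_cong) auto
  also have "\<dots> = (LINT y:{0<..}|lborel. of_nat q * f (Complex (real q * r) (real q * y))) +
      (LINT y:{0<..}|lborel. \<Sum>b<q. ?g b (inverse (real q) * y) / of_nat q)"
    by (rule set_integral_add(2)[OF i1 i3])
  also have "(LINT y:{0<..}|lborel. of_nat q * f (Complex (real q * r) (real q * y))) =
      of_nat q * (LINT y:{0<..}|lborel. f (Complex (real q * r) (real q * y)))" by simp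
  also have "\<dots> = (LINT y:{0<..}|lborel. f (Complex (real q * r) y))"
    using set_integral_scale[OF q0, of "\<lambda>y. f (Complex (real q * r) y)"] q0 by simp
  also have "(LINT y:{0<..}|lborel. \<Sum>b<q. ?g b (inverse (real q) * y) / of_nat q) =
      (\<Sum>b<q. LINT y:{0<..}|lborel. ?g b (inverse (real q) * y) / of_nat q)"
    using i2 unfolding set_lebesgue_integral_def set_integrable_def scaleR_sum_right
    by (intro Bochner_Integration.integral_sum)
  also have "\<dots> = (\<Sum>b<q. LINT y:{0<..}|lborel. ?g b y)"
  proof (intro sum.cong refl)
    fix b
    have "(LINT y:{0<..}|lborel. ?g b (inverse (real q) * y) / of_nat q) =
        (LINT y:{0<..}|lborel. ?g b (inverse (real q) * y)) / of_nat q" by simp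
    also have "\<dots> = (LINT y:{0<..}|lborel. ?g b y)"
      using set_integral_scale[of "inverse (real q)" "?g b"] q0 by simp
    finally show "(LINT y:{0<..}|lborel. ?g b (inverse (real q) * y) / of_nat q) = (LINT y:{0<..}|lborel. ?g b y)" .
  qed
  finally have "2 * pi * (a q * (LINT y:{0<..}|lborel. f (Complex r y))) =
      2 * pi * ((LINT y:{0<..}|lborel. f (Complex (real q * r) y)) + (\<Sum>b<q. LINT y:{0<..}|lborel. ?g b y))"
    by simp
  then show ?thesis by (simp add: symbol_def distrib_left sum_distrib_left mult_ac)
qed

end

section \<open>Differences of symbols as periods\<close>

context rational_newform
begin

lemma primitive_exists:
  obtains F where "\<And>z. Im z > 0 \<Longrightarrow> (F has_field_derivative 2 * of_real pi * \<i> * f z) (at z)"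
proof -
  have "(\<lambda>z. 2 * of_real pi * \<i> * f z) holomorphic_on upper_half_plane"
    by (intro holomorphic_intros f_holomorphic)
  then obtain F where "\<And>z. z \<in> upper_half_plane \<Longrightarrow>
      (F has_field_derivative 2 * of_real pi * \<i> * f z) (at z within upper_half_plane)"
    using holomorphic_convex_primitive'[OF convex_upper_half_plane open_upper_half_plane] by metis
  then have "(F has_field_derivative 2 * of_real pi * \<i> * f z) (at z)" if "Im z > 0" for z
    using that at_within_open[OF _ open_upper_half_plane, of z] by (metis upper_half_plane_iff)
  then show ?thesis by (rule that)
qed

end

text \<open>Fixing one primitive on the half plane replaces path integrals by differences of
  values.\<close>

locale rational_newform_primitive = rational_newform +
  fixes F :: "complex \<Rightarrow> complex"
  assumes F_deriv: "\<And>z. Im z > 0 \<Longrightarrow> (F has_field_derivative 2 * of_real pi * \<i> * f z) (at z)"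
begin

lemma vertical_primitive:
  assumes "0 < u" "u \<le> w"
  shows "F (Complex r u) - F (Complex r w) = 2 * pi * (LINT y:{u..w}|lborel. f (Complex r y))"
proof -
  have sub: "{u..w} \<subseteq> {0<..}" using assms by auto
  have "((\<lambda>y. F (Complex r y)) has_vector_derivative (- 2 * pi * f (Complex r y))) (at y within {u..w})"
    if "y \<in> {u..w}" for y
  proof -
    have y: "y > 0" using that assms by auto
    have "(Complex r has_vector_derivative \<i>) (at y within {u..w})"
      unfolding Complex_eq[abs_def] by (auto intro!: derivative_eq_intros simp: has_vector_derivative_def scaleR_conv_of_real)
    then have "((F \<circ> Complex r) has_vector_derivative \<i> * (2 * of_real pi * \<i> * f (Complex r y))) (at y within {u..w})"
      by (rule field_vector_diff_chain_within)
         (auto intro!: has_field_derivative_at_within F_deriv simp: y)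
    moreover have "\<i> * (2 * of_real pi * \<i> * f (Complex r y)) = - 2 * pi * f (Complex r y)"
    proof -
      have "\<i> * (2 * of_real pi * \<i> * f (Complex r y)) = (\<i> * \<i>) * (2 * of_real pi * f (Complex r y))"
        by (simp only: mult_ac)
      also have "\<dots> = - 2 * pi * f (Complex r y)" by simp
      finally show ?thesis .
    qed
    ultimately show ?thesis by (simp only: o_def)
  qed
  then have "((\<lambda>y. - 2 * pi * f (Complex r y)) has_integral (F (Complex r w) - F (Complex r u))) {u..w}"
    using assms(2) by (intro fundamental_theorem_of_calculus) auto
  then have "integral {u..w} (\<lambda>y. - 2 * pi * f (Complex r y)) = F (Complex r w) - F (Complex r u)"
    by (rule integral_unique)
  moreover have "set_integrable lborel {u..w} (\<lambda>y. f (Complex r y))"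
    using continuous_on_subset[OF vertical_continuous sub] by (intro borel_integrable_atLeastAtMost')
  then have "(LINT y:{u..w}|lborel. f (Complex r y)) = integral {u..w} (\<lambda>y. f (Complex r y))"
    by (rule set_borel_integral_eq_integral)
  ultimately show ?thesis by (simp add: algebra_simps)
qed

lemma symbol_limit:
  assumes "r \<in> \<rat>" and u: "\<And>n. u n > 0" "u \<longlonglongrightarrow> 0" and w: "filterlim w at_top sequentially"
  shows "(\<lambda>n. F (Complex r (u n)) - F (Complex r (w n))) \<longlonglongrightarrow> symbol r"
proof -
  have "(\<lambda>n. 2 * pi * (LINT y:{u n..w n}|lborel. f (Complex r y))) \<longlonglongrightarrow> symbol r"
    unfolding symbol_def
    by (intro tendsto_mult tendsto_const tendsto_integral_exhaust vertical_integrable assms)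
  moreover have "\<forall>\<^sub>F n in sequentially. u n < 1" using u(2) by (rule order_tendstoD) simp
  moreover have "\<forall>\<^sub>F n in sequentially. 1 \<le> w n" using w by (simp add: filterlim_at_top)
  ultimately have lim: "(\<lambda>n. 2 * pi * (LINT y:{u n..w n}|lborel. f (Complex r y))) \<longlonglongrightarrow> symbol r"
    and ev: "\<forall>\<^sub>F n in sequentially. u n < 1" "\<forall>\<^sub>F n in sequentially. 1 \<le> w n" by blast+
  have "\<forall>\<^sub>F n in sequentially. 2 * pi * (LINT y:{u n..w n}|lborel. f (Complex r y)) =
      F (Complex r (u n)) - F (Complex r (w n))"
    using ev
  proof eventually_elim
    case (elim n)
    then show ?case using vertical_primitive[of "u n" "w n" r] u(1)[of n] by simp
  qed
  with lim show ?thesis by (rule Lim_transform_eventually)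
qed

lemma mat2_act_deriv:
  assumes "\<gamma> \<in> SL2Z" "Im z > 0"
  shows "(mat2_act \<gamma> has_field_derivative 1 / (aut_factor \<gamma> z)\<^sup>2) (at z)"
proof -
  obtain a b c d where g: "\<gamma> = (a, b, c, d)" by (cases \<gamma>)
  define j where "j = of_int c * z + (of_int d :: complex)"
  have j: "j \<noteq> 0" using aut_factor_nonzero[OF assms] by (simp add: g aut_factor_def j_def)
  have "a * d - b * c = 1" using assms by (simp add: g SL2Z_def)
  then have det: "of_int a * of_int d - of_int b * of_int c = (1 :: complex)"
    by (metis of_int_1 of_int_diff of_int_mult)
  have "((\<lambda>z. (of_int a * z + of_int b) / (of_int c * z + of_int d)) has_field_derivative
      (of_int a * j - (of_int a * z + of_int b) * of_int c) / (j * j)) (at z)"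
    using j unfolding j_def by (auto intro!: derivative_eq_intros)
  also have "of_int a * j - (of_int a * z + of_int b) * of_int c = of_int a * of_int d - of_int b * (of_int c :: complex)"
    by (simp add: j_def algebra_simps)
  finally show ?thesis
    by (simp add: g mat2_act_def[abs_def] aut_factor_def j_def det power2_eq_square)
qed

lemma F_mat2_act_deriv:
  assumes "\<gamma> \<in> SL2Z" "Im z > 0"
  shows "((\<lambda>z. F (mat2_act \<gamma> z)) has_field_derivative 2 * of_real pi * \<i> * slash2 f \<gamma> z) (at z)"
proof -
  have "((\<lambda>z. F (mat2_act \<gamma> z)) has_field_derivative
      (2 * of_real pi * \<i> * f (mat2_act \<gamma> z)) * (1 / (aut_factor \<gamma> z)\<^sup>2)) (at z)"
    by (rule DERIV_chain2[OF F_deriv[OF mat2_act_upper[OF assms]] mat2_act_deriv[OF assms]])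
  then show ?thesis by (simp add: slash2_def)
qed

text \<open>The horizontal segment keeps its length as it rises, while the derivative of
  \<open>F\<close> composed with the matrix tends to 0 by the cusp condition. Its image shrinks
  towards a cusp, so this is how paths are closed up there.\<close>

lemma horizontal_limit:
  assumes "\<gamma> \<in> SL2Z"
  shows "((\<lambda>T. F (mat2_act \<gamma> (Complex x T)) - F (mat2_act \<gamma> (Complex x' T))) \<longlongrightarrow> 0) at_top"
proof (rule tendstoI)
  fix e :: real assume e: "e > 0"
  define \<delta> where "\<delta> = e / (2 * pi * (\<bar>x - x'\<bar> + 1))"
  have \<delta>: "\<delta> > 0" using e by (simp add: \<delta>_def add_nonneg_pos)
  have "\<forall>\<^sub>F z in filtercomap Im at_top. dist (slash2 f \<gamma> z) 0 < \<delta>"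
    using slash_tendsto_0[OF assms] \<delta> by (rule tendstoD)
  then obtain T0 where T0: "\<And>z. Im z \<ge> T0 \<Longrightarrow> cmod (slash2 f \<gamma> z) < \<delta>"
    by (auto simp: eventually_filtercomap eventually_at_top_linorder)
  show "\<forall>\<^sub>F T in at_top. dist (F (mat2_act \<gamma> (Complex x T)) - F (mat2_act \<gamma> (Complex x' T))) 0 < e"
    using eventually_ge_at_top[of "max 1 T0"]
  proof eventually_elim
    case (elim T)
    have "norm (F (mat2_act \<gamma> (Complex x T)) - F (mat2_act \<gamma> (Complex x' T))) \<le>
        (2 * pi * \<delta>) * norm (Complex x T - Complex x' T)"
    proof (rule field_differentiable_bound[where S = "{z. Im z = T}"])
      have "{z. Im z = T} = {z. Im z \<le> T} \<inter> {z. Im z \<ge> T}" by auto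
      then show "convex {z. Im z = T}" by (simp add: convex_Int convex_halfspace_Im_le convex_halfspace_Im_ge)
      fix z assume "z \<in> {z. Im z = T}"
      then have z: "Im z > 0" "Im z \<ge> T0" using elim by auto
      show "((\<lambda>z. F (mat2_act \<gamma> z)) has_field_derivative 2 * of_real pi * \<i> * slash2 f \<gamma> z) (at z within {z. Im z = T})"
        by (rule has_field_derivative_at_within[OF F_mat2_act_deriv[OF assms z(1)]])
      show "norm (2 * of_real pi * \<i> * slash2 f \<gamma> z) \<le> 2 * pi * \<delta>"
        using T0[OF z(2)] by (simp add: norm_mult)
    qed auto
    also have "norm (Complex x T - Complex x' T) = \<bar>x - x'\<bar>" by (simp add: cmod_def)
    also have "2 * pi * \<delta> * \<bar>x - x'\<bar> < 2 * pi * \<delta> * (\<bar>x - x'\<bar> + 1)"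
      using \<delta> by (intro mult_strict_left_mono) auto
    also have "\<dots> = e" by (simp add: \<delta>_def)
    finally show ?case by simp
  qed
qed

text \<open>Invariance of the differential makes the difference constant, and the segment from
  \<open>\<i>\<close> to its image exhibits the constant as a period.\<close>

lemma period_of_Gamma0:
  assumes g: "\<gamma> \<in> Gamma0 N"
  obtains l where "l \<in> period_lattice N f" "\<And>z. Im z > 0 \<Longrightarrow> F (mat2_act \<gamma> z) - F z = l"
proof -
  have sl: "\<gamma> \<in> SL2Z" using g by (auto simp: Gamma0_def)
  have "\<exists>l. \<forall>z\<in>upper_half_plane. F (mat2_act \<gamma> z) - F z = l"
  proof (rule has_field_derivative_zero_constant[OF convex_upper_half_plane])
    fix z assume "z \<in> upper_half_plane"
    then have z: "Im z > 0" by simp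
    have "((\<lambda>z. F (mat2_act \<gamma> z) - F z) has_field_derivative
        2 * of_real pi * \<i> * slash2 f \<gamma> z - 2 * of_real pi * \<i> * f z) (at z)"
      by (intro DERIV_diff F_mat2_act_deriv[OF sl z] F_deriv z)
    then show "((\<lambda>z. F (mat2_act \<gamma> z) - F z) has_field_derivative 0) (at z within upper_half_plane)"
      using f_slash[OF g z] by (auto dest: has_field_derivative_at_within)
  qed
  then obtain l where l: "\<And>z. Im z > 0 \<Longrightarrow> F (mat2_act \<gamma> z) - F z = l" by auto
  let ?p = "linepath \<i> (mat2_act \<gamma> \<i>)"
  have im: "Im (mat2_act \<gamma> \<i>) > 0" by (rule mat2_act_upper[OF sl]) simp
  have sub: "path_image ?p \<subseteq> upper_half_plane"
    using im convex_upper_half_plane by (auto simp: closed_segment_subset)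
  have "((\<lambda>z. 2 * of_real pi * \<i> * f z) has_contour_integral (F (pathfinish ?p) - F (pathstart ?p))) ?p"
    by (rule contour_integral_primitive[where S = upper_half_plane])
       (use sub in \<open>auto intro!: has_field_derivative_at_within[OF F_deriv]\<close>)
  then have "contour_integral ?p (\<lambda>z. 2 * of_real pi * \<i> * f z) = l"
    using l[of \<i>] by (simp add: contour_integral_unique)
  then have "l \<in> period_lattice N f"
    unfolding period_lattice_def using sub g
    by (intro CollectI exI[of _ ?p] conjI) (auto intro!: bexI[of _ \<gamma>])
  with l show ?thesis by (rule_tac that)
qed

text \<open>\<open>(x, b, c, D)\<close> sends 0 to \<open>b / D\<close>, so formally the difference
  is the period of this matrix. As both ends are cusps, they are approached: the point at height
  \<open>u n\<close> above \<open>b / D\<close>, and the image of the point at height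
  \<open>k\<^sup>2 * u n\<close> above 0, are the images of two points at the common height
  \<open>T n\<close> under one matrix. So \<open>horizontal_limit\<close> closes the gap.\<close>

lemma symbol_difference_lowest_terms:
  fixes b D :: int
  assumes D: "D > 0" "coprime b D" "coprime D (int N)"
  shows "symbol (of_int b / of_int D) - symbol 0 \<in> period_lattice N f"
proof -
  \<comment> \<open>Bezout is applied to \<open>b * N\<close> instead of \<open>b\<close>, so that
    the lower left entry becomes a multiple of \<open>N\<close>.\<close>
  have "coprime D (b * int N)" using D by (simp add: coprime_commute)
  then obtain x y where xy: "x * D + y * (b * int N) = 1" by (metis bezout_int coprime_iff_gcd_eq_1)
  define c where "c = - y * int N"
  have det: "x * D - b * c = 1" using xy by (simp add: c_def algebra_simps)
  have g: "(x, b, c, D) \<in> Gamma0 N" using det by (simp add: Gamma0_def SL2Z_def c_def)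
  have al: "(b, - x, D, - c) \<in> SL2Z" using det by (simp add: SL2Z_def algebra_simps)
  obtain l where l: "l \<in> period_lattice N f" "\<And>z. Im z > 0 \<Longrightarrow> F (mat2_act (x, b, c, D) z) - F z = l"
    using period_of_Gamma0[OF g] by metis
  define k where "k = real_of_int D"
  have k: "k > 0" using D by (simp add: k_def)
  define u where "u = (\<lambda>n. inverse (real (Suc n)))"
  define w where "w = (\<lambda>n. real (Suc n))"
  have u: "\<And>n. u n > 0" "u \<longlonglongrightarrow> 0" using LIMSEQ_inverse_real_of_nat by (auto simp: u_def)
  have w: "filterlim w at_top sequentially"
    unfolding w_def by (rule filterlim_compose[OF filterlim_real_sequentially filterlim_Suc])
  have ku: "\<And>n. k\<^sup>2 * u n > 0" "(\<lambda>n. k\<^sup>2 * u n) \<longlonglongrightarrow> 0"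
    using u k tendsto_mult[OF tendsto_const u(2), of "k\<^sup>2"] by auto
  let ?r = "real_of_int b / k"
  have s1: "(\<lambda>n. F (Complex ?r (u n)) - F (Complex ?r (w n))) \<longlonglongrightarrow> symbol ?r"
    by (rule symbol_limit[OF _ u w]) (simp add: k_def)
  have s0: "(\<lambda>n. F (Complex 0 (k\<^sup>2 * u n)) - F (Complex 0 (w n))) \<longlonglongrightarrow> symbol 0"
    by (rule symbol_limit[OF _ ku w]) simp
  have id: "(1, 0, 0, 1) \<in> SL2Z" "mat2_act (1, 0, 0, 1) = (\<lambda>z. z)" by (auto simp: SL2Z_def mat2_act_def)
  have top: "(\<lambda>n. F (Complex ?r (w n)) - F (Complex 0 (w n))) \<longlonglongrightarrow> 0"
    using filterlim_compose[OF horizontal_limit[OF id(1), of ?r 0] w] by (simp add: id(2))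
  \<comment> \<open>The inversion exchanges height \<open>k\<^sup>2 * u n\<close> above 0 with
    height \<open>T n\<close>. The matrix \<open>(b, - x, D, - c)\<close> is the given one times
    this inversion; its pole is \<open>c / k\<close>, so it maps the vertical line above
    \<open>c / k\<close> to that above \<open>b / D\<close>.\<close>
  define T where "T = (\<lambda>n. inverse (k\<^sup>2 * u n))"
  have T: "T n > 0" "T n * (k\<^sup>2 * u n) = 1" for n
    unfolding T_def using ku(1)[of n] by (intro positive_imp_inverse_positive left_inverse; linarith)+
  have "T = (\<lambda>n. inverse (k\<^sup>2) * w n)" by (simp add: T_def u_def w_def fun_eq_iff)
  then have "filterlim T at_top sequentially"
    using k by (auto intro!: filterlim_tendsto_pos_mult_at_top[OF tendsto_const _ w])
  then have bot: "(\<lambda>n. F (mat2_act (b, - x, D, - c) (Complex (of_int c / k) (T n))) -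
      F (mat2_act (b, - x, D, - c) (Complex 0 (T n)))) \<longlonglongrightarrow> 0"
    by (rule filterlim_compose[OF horizontal_limit[OF al]])
  have detk: "of_int x * k - of_int b * of_int c = 1"
    unfolding k_def using det by (metis of_int_1 of_int_diff of_int_mult)
  have e1: "mat2_act (b, - x, D, - c) (Complex (of_int c / k) (T n)) = Complex ?r (u n)" for n
  proof -
    have den: "of_int D * Complex (of_int c / k) (T n) + of_int (- c) = Complex 0 (k * T n)"
      using k by (simp add: complex_eq_iff k_def)
    have num: "of_int b * Complex (of_int c / k) (T n) + of_int (- x) = Complex (- 1 / k) (of_int b * T n)"
      using k detk by (simp add: complex_eq_iff field_simps)
    have "Complex ?r (u n) * Complex 0 (k * T n) = Complex (- 1 / k) (of_int b * T n)"
      using T(2)[of n] k by (simp add: complex_eq_iff power2_eq_square field_simps)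
    moreover have "Complex 0 (k * T n) \<noteq> 0" using T(1)[of n] k by (simp add: complex_eq_iff)
    ultimately show ?thesis
      unfolding mat2_act_def prod.case den num by (simp add: nonzero_divide_eq_eq)
  qed
  have e0: "mat2_act (b, - x, D, - c) (Complex 0 (T n)) = mat2_act (x, b, c, D) (Complex 0 (k\<^sup>2 * u n))" for n
  proof -
    have S: "(0, - 1, 1, 0) \<in> SL2Z" by (simp add: SL2Z_def)
    have "mat2_mul (x, b, c, D) (0, - 1, 1, 0) = (b, - x, D, - c)" by (simp add: mat2_mul_def)
    moreover have "mat2_act (0, - 1, 1, 0) (Complex 0 (T n)) = Complex 0 (k\<^sup>2 * u n)"
      using T[of n] by (simp add: mat2_act_def complex_eq_iff Re_divide Im_divide power2_eq_square field_simps)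
    ultimately show ?thesis using mat2_act_mul[OF S, of "Complex 0 (T n)" "(x, b, c, D)"] T(1)[of n] by simp
  qed
  have "F (mat2_act (x, b, c, D) (Complex 0 (k\<^sup>2 * u n))) = F (Complex 0 (k\<^sup>2 * u n)) + l" for n
    using l(2)[of "Complex 0 (k\<^sup>2 * u n)"] ku(1)[of n] by (simp add: algebra_simps)
  with bot have "(\<lambda>n. F (Complex ?r (u n)) - (F (Complex 0 (k\<^sup>2 * u n)) + l)) \<longlonglongrightarrow> 0"
    by (simp only: e1 e0)
  then have "(\<lambda>n. (F (Complex ?r (u n)) - (F (Complex 0 (k\<^sup>2 * u n)) + l)) + l - (F (Complex ?r (w n)) - F (Complex 0 (w n)))) \<longlonglongrightarrow> 0 + l - 0"
    by (intro tendsto_intros top)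
  moreover have "(\<lambda>n. (F (Complex ?r (u n)) - F (Complex ?r (w n))) - (F (Complex 0 (k\<^sup>2 * u n)) - F (Complex 0 (w n)))) \<longlonglongrightarrow> symbol ?r - symbol 0"
    by (rule tendsto_diff[OF s1 s0])
  moreover have "(\<lambda>n. (F (Complex ?r (u n)) - (F (Complex 0 (k\<^sup>2 * u n)) + l)) + l - (F (Complex ?r (w n)) - F (Complex 0 (w n)))) =
      (\<lambda>n. (F (Complex ?r (u n)) - F (Complex ?r (w n))) - (F (Complex 0 (k\<^sup>2 * u n)) - F (Complex 0 (w n))))"
    by (simp add: fun_eq_iff)
  ultimately have "symbol ?r - symbol 0 = l" using LIMSEQ_unique by fastforce
  with l(1) show ?thesis by (simp add: k_def)
qed

end

context rational_newform
begin

lemma symbol_difference: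
  fixes b D :: int
  assumes D: "D > 0" "coprime D (int N)"
  shows "symbol (of_int b / of_int D) - symbol 0 \<in> period_lattice N f"
proof -
  obtain F where F: "\<And>z. Im z > 0 \<Longrightarrow> (F has_field_derivative 2 * of_real pi * \<i> * f z) (at z)"
    using primitive_exists by metis
  interpret rational_newform_primitive N f a F by unfold_locales (rule F)
  define g where "g = gcd b D"
  have g: "g > 0" using D by (simp add: g_def)
  have "b = g * (b div g)" "D = g * (D div g)" by (simp_all add: g_def)
  then have "real_of_int b = of_int g * of_int (b div g)" "real_of_int D = of_int g * of_int (D div g)"
    by (metis of_int_mult)+
  then have "real_of_int b / of_int D = of_int (b div g) / of_int (D div g)"
    using g by simp
  moreover have "symbol (of_int (b div g) / of_int (D div g)) - symbol 0 \<in> period_lattice N f"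
  proof (rule symbol_difference_lowest_terms)
    show "D div g > 0" using D g by (simp add: g_def pos_imp_zdiv_pos_iff zdvd_imp_le)
    show "coprime (b div g) (D div g)" using D div_gcd_coprime[of b D] by (simp add: g_def)
    show "coprime (D div g) (int N)"
      using D(2) \<open>D = g * (D div g)\<close> by (metis coprime_mult_left_iff)
  qed
  ultimately show ?thesis by simp
qed

text \<open>Because \<open>gauss_eq\<close> holds for every \<open>n\<close>, also those not prime
  to \<open>M\<close>, the combination \<open>h\<close> of the form on the lines above
  \<open>b / M\<close> has precisely the twisted coefficients. As a finite combination it inherits
  the decay on these lines, and \<open>L_function\<close> applies to it.\<close>

lemma twisted_L_value:
  assumes chr: "primitive_quadratic_character M chr"
  shows "twisted_L a chr 1 =
    (\<Sum>b\<in>{0..<M}. of_int (chr b) * symbol (of_int b / of_int M)) / primitive_quadratic_character.gauss M chr 1"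
proof -
  let ?f = "\<lambda>b y. f (Complex (of_int b / of_int M) y)"
  interpret primitive_quadratic_character M chr by (rule chr)
  define \<tau> where "\<tau> = gauss 1"
  have "\<tau>\<^sup>2 \<noteq> 0" using gauss_square modulus_pos zero_iff[of "-1"] by (simp add: \<tau>_def)
  then have \<tau>: "\<tau> \<noteq> 0" by auto
  define c where "c = (\<lambda>n. of_int (chr (int n)) * a n)"
  define h where "h = (\<lambda>y. (\<Sum>b\<in>{0..<M}. of_int (chr b) * ?f b y) / \<tau>)"
  have norm_chr: "cmod (of_int (chr n)) \<le> 1" for n using range[of n] by auto
  obtain B where B: "\<And>n. cmod (a n) \<le> B * real n ^ 2" using coefficient_bound by metis
  have c: "cmod (c n) \<le> B * real n ^ 2" for n
  proof -
    have "cmod (c n) \<le> 1 * cmod (a n)"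
      unfolding c_def norm_mult by (intro mult_right_mono norm_chr) auto
    then show ?thesis using B[of n] by simp
  qed
  have sums: "(\<lambda>n. c n * of_real (exp (- (2 * pi * real n) * y))) sums h y" if y: "y > 0" for y
  proof -
    let ?e = "\<lambda>n. complex_of_real (exp (- (2 * pi * real n) * y))"
    have "(\<lambda>n. a n * exp (2 * of_real pi * \<i> * Complex (of_int b / of_int M) y) ^ n) sums ?f b y" for b
      using y by (intro f_sums) simp
    moreover have "exp (2 * of_real pi * \<i> * Complex (of_int b / of_int M) y) ^ n = ?e n * eM M (b * int n)" for b n
    proof -
      have "of_nat n * (2 * of_real pi * \<i> * Complex (of_int b / of_int M) y) =
          of_real (- (2 * pi * real n) * y) + 2 * of_real pi * \<i> * (of_int (b * int n) / of_int M)"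
        by (simp add: Complex_eq algebra_simps)
      then show ?thesis by (simp only: exp_of_nat_mult[symmetric] exp_add eM_def exp_of_real)
    qed
    ultimately have "(\<lambda>n. a n * (?e n * eM M (b * int n))) sums ?f b y" for b
      by simp
    then have "(\<lambda>n. \<Sum>b\<in>{0..<M}. of_int (chr b) * (a n * (?e n * eM M (b * int n)))) sums
        (\<Sum>b\<in>{0..<M}. of_int (chr b) * ?f b y)"
      by (intro sums_sum sums_mult)
    moreover have "(\<Sum>b\<in>{0..<M}. of_int (chr b) * (a n * (?e n * eM M (b * int n)))) = c n * ?e n * \<tau>" for n
    proof -
      have "(\<Sum>b\<in>{0..<M}. of_int (chr b) * (a n * (?e n * eM M (b * int n)))) = a n * ?e n * gauss (int n)"
        by (simp add: gauss_def sum_distrib_left mult_ac)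
      also have "gauss (int n) = of_int (chr (int n)) * \<tau>" by (simp only: gauss_eq[of "int n"] \<tau>_def)
      finally show ?thesis by (simp add: c_def mult_ac)
    qed
    ultimately have "(\<lambda>n. c n * ?e n * \<tau>) sums (\<Sum>b\<in>{0..<M}. of_int (chr b) * ?f b y)"
      by simp
    then have "(\<lambda>n. c n * ?e n * \<tau> / \<tau>) sums h y" unfolding h_def by (rule sums_divide)
    then show ?thesis using \<tau> by simp
  qed
  have rb: "real_of_int b / of_int M \<in> \<rat>" for b by simp
  have h_le: "cmod (h y) \<le> (\<Sum>b\<in>{0..<M}. cmod (?f b y)) / cmod \<tau>" for y
    unfolding h_def norm_divide
  proof (rule divide_right_mono, rule sum_norm_le)
    fix b
    show "cmod (of_int (chr b) * ?f b y) \<le> cmod (?f b y)"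
      using mult_right_mono[OF norm_chr[of b], of "cmod (?f b y)"] by (simp add: norm_mult)
  qed simp
  interpret mellin_transform h
  proof
    show "continuous_on {0<..} h"
      unfolding h_def by (intro continuous_intros vertical_continuous) (use \<tau> in auto)
    show "\<exists>C. \<forall>y. 0 < y \<and> y \<le> 1 \<longrightarrow> cmod (h y) \<le> C * y ^ n" for n
    proof -
      have "\<exists>C. \<forall>y. 0 < y \<and> y \<le> 1 \<longrightarrow> cmod (?f b y) \<le> C * y ^ n" for b
        by (rule vertical_decay_at_0[OF rb[of b], of n]) blast
      then obtain C where C: "\<And>b y. 0 < y \<Longrightarrow> y \<le> 1 \<Longrightarrow> cmod (?f b y) \<le> C b * y ^ n"
        by metis
      have "cmod (h y) \<le> (\<Sum>b\<in>{0..<M}. C b) / cmod \<tau> * y ^ n" if "0 < y" "y \<le> 1" for y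
      proof -
        have "(\<Sum>b\<in>{0..<M}. cmod (?f b y)) \<le> (\<Sum>b\<in>{0..<M}. C b * y ^ n)"
          by (intro sum_mono C that)
        then have "(\<Sum>b\<in>{0..<M}. cmod (?f b y)) / cmod \<tau> \<le> (\<Sum>b\<in>{0..<M}. C b * y ^ n) / cmod \<tau>"
          by (rule divide_right_mono) simp
        with h_le[of y] show ?thesis by (simp add: sum_distrib_right)
      qed
      then show ?thesis by blast
    qed
    show "\<exists>C. \<forall>y\<ge>1. cmod (h y) \<le> C / y ^ n" for n
    proof -
      obtain C where C: "\<And>x y. y \<ge> 1 \<Longrightarrow> cmod (f (Complex x y)) \<le> C / y ^ n"
        using vertical_decay_at_top by metis
      have "cmod (h y) \<le> (of_int M * C / cmod \<tau>) / y ^ n" if "1 \<le> y" for y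
      proof -
        have "(\<Sum>b\<in>{0..<M}. cmod (?f b y)) \<le> (\<Sum>b\<in>{0..<M}. C / y ^ n)"
          by (intro sum_mono C that)
        then have "(\<Sum>b\<in>{0..<M}. cmod (?f b y)) / cmod \<tau> \<le> (\<Sum>b\<in>{0..<M}. C / y ^ n) / cmod \<tau>"
          by (rule divide_right_mono) simp
        with h_le[of y] show ?thesis using modulus_pos by (simp add: mult.commute)
      qed
      then show ?thesis by blast
    qed
  qed
  have "twisted_L a chr 1 = 2 * pi * (LINT y:{0<..}|lborel. h y)"
    using L_function[OF c sums] by (simp add: twisted_L_def c_def)
  also have "(LINT y:{0<..}|lborel. h y) =
      (LINT y:{0<..}|lborel. (\<Sum>b\<in>{0..<M}. of_int (chr b) * ?f b y)) / \<tau>"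
    unfolding h_def by simp
  also have "(LINT y:{0<..}|lborel. (\<Sum>b\<in>{0..<M}. of_int (chr b) * ?f b y)) =
      (\<Sum>b\<in>{0..<M}. LINT y:{0<..}|lborel. of_int (chr b) * ?f b y)"
    unfolding set_lebesgue_integral_def scaleR_sum_right
    using set_integrable_mult_right[OF vertical_integrable[OF rb]] unfolding set_integrable_def
    by (intro Bochner_Integration.integral_sum)
  finally show ?thesis
    by (simp add: symbol_def \<tau>_def sum_distrib_left mult_ac)
qed

end

section \<open>The valuation of the central value\<close>

text \<open>Moving \<open>u\<close> into the denominator changes the square of the Gauss sum by a
  sign at most, which \<open>v_div_sqrt\<close> tolerates.\<close>

lemma (in two_adic) v_twisted_quotient:
  assumes x: "x \<in> \<rat>" and u: "u\<^sup>2 = 1 \<or> u\<^sup>2 = -1" and \<tau>: "\<tau>\<^sup>2 = of_int (s * (4 * k))" "s \<in> {1, -1}" "odd k"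
  shows "v (x * u / \<tau>) = v x - 1"
proof -
  have "u \<noteq> 0" using u by auto
  then have eq: "x * u / \<tau> = x / (\<tau> / u)" by simp
  show ?thesis
  proof (cases "u\<^sup>2 = 1")
    case True
    then have "\<tau> / u * (\<tau> / u) = of_int (s * (4 * k))" using \<tau>(1) by (simp add: power2_eq_square)
    then show ?thesis unfolding eq using \<tau> by (intro v_div_sqrt[OF x])
  next
    case False
    then have "u * u = -1" using u by (simp add: power2_eq_square)
    then have "\<tau> / u * (\<tau> / u) = of_int ((- s) * (4 * k))" using \<tau>(1) by (simp add: power2_eq_square)
    moreover have "- s \<in> {1, -1}" using \<tau>(2) by auto
    ultimately show ?thesis unfolding eq by (rule v_div_sqrt[OF x _ _ \<tau>(3)])
  qed
qed

theorem theorem4p3: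
  fixes N m M r :: nat
    and f X Y :: "complex \<Rightarrow> complex"
    and a :: "nat \<Rightarrow> complex"
    and E :: weierstrass
    and v :: "complex \<Rightarrow> ereal"
    and \<Omega>p \<Omega>m :: real
    and q :: "nat \<Rightarrow> nat"
  assumes "N > 0" and "odd N"
    and "new_cusp_form2 N f" and "hecke_eigenform2 N f"
    and "q_expansion f a" and "a 1 = 1" and "\<And>n. a n \<in> \<rat>"
    and "optimal_curve_manin_one N f E X Y"
    and "two_adic_valuation v"
    and "\<Omega>p > 0" and "\<Omega>m > 0"
    and "period_lattice N f = rectangular_lattice \<Omega>p \<Omega>m"
    and "r \<ge> 1" and "inj_on q {1..r}"
    and "\<And>i. i \<in> {1..r} \<Longrightarrow> prime (q i) \<and> odd (q i)"
    and "m = (\<Prod>i=1..r. q i)" and "coprime m N"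
    and "M = 4 * m"
  shows
    "((\<forall>i\<in>{1..r}. q i \<in> S_all N a v 0 \<union> S_all N a v 1 \<union> S_all N a v 2) \<longrightarrow>
        v (twisted_L a (quad_char M) 1 / of_real (period_sgn (quad_char M) \<Omega>p \<Omega>m)) \<ge>
          w_ind a v m * ereal (of_nat r) +
          Min {- 1 + kdelta (v_min a v m) 0,
               - 1 + kdelta (v_min a v m) 0 + v (modular_L a 1 / of_real \<Omega>p),
               v (twisted_L a (quad_char 4) 1 / of_real \<Omega>m) + kdelta (v_min a v m) 2})
     \<and>
     ((\<forall>i\<in>{1..r}. q i \<in> S_plus N a v 0 \<union> S_plus N a v 1 \<union> S_plus N a v 2) \<longrightarrow>
        v (twisted_L a (quad_char M) 1 / of_real (period_sgn (quad_char M) \<Omega>p \<Omega>m)) \<ge>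
          w_ind a v m * ereal (of_nat r) +
          Min {kdelta (v_min a v m) 0,
               v (twisted_L a (quad_char 4) 1 / of_real \<Omega>m) + kdelta (v_min a v m) 2})
     \<and>
     ((\<forall>i\<in>{1..r}. q i \<in> S_plus N a v 0) \<and>
      v (twisted_L a (quad_char 4) 1 / of_real \<Omega>m) = 0 \<longrightarrow>
        v (twisted_L a (quad_char M) 1 / of_real (period_sgn (quad_char M) \<Omega>p \<Omega>m)) =
          w_ind a v m * ereal (of_nat r) +
          Min {kdelta (v_min a v m) 0,
               v (twisted_L a (quad_char 4) 1 / of_real \<Omega>m) + kdelta (v_min a v m) 2})"
proof -
  let ?all = "\<forall>i\<in>{1..r}. q i \<in> S_all N a v 0 \<union> S_all N a v 1 \<union> S_all N a v 2"
  let ?plus = "\<forall>i\<in>{1..r}. q i \<in> S_plus N a v 0 \<union> S_plus N a v 1 \<union> S_plus N a v 2"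
  interpret rational_newform N f a
    using assms by unfold_locales (auto simp: new_cusp_form2_def)
  interpret twisted_bounds N symbol a \<Omega>p \<Omega>m v
  proof
    show "symbol (of_int b / of_int D) - symbol 0 \<in> rectangular_lattice \<Omega>p \<Omega>m"
      if "D > 0" "coprime D (int N)" for b D :: int
      using symbol_difference[OF that] assms by simp
  qed (use assms symbol_hecke in \<open>auto simp: symbol_plus_1 symbol_minus\<close>)
  define Q where "Q = q ` {1..r}"
  have m: "m = \<Prod>Q" using assms by (simp add: Q_def prod.reindex)
  have card: "card Q = r" using assms by (simp add: Q_def card_image)
  have pr: "prime p \<and> odd p" if "p \<in> Q" for p using that assms by (auto simp: Q_def)
  have fin: "finite Q" by (simp add: Q_def)
  have ne: "Q \<noteq> {}" using assms by (simp add: Q_def)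
  have gQ: "good Q"
    unfolding good_def
  proof (intro conjI ballI fin)
    fix p assume p: "p \<in> Q"
    show "prime p" "odd p" using pr p by auto
    show "\<not> p dvd N"
    proof
      assume "p dvd N"
      moreover have "p dvd m" unfolding m using fin p by (metis dvd_prodI eq_id_iff)
      ultimately have "is_unit p" using \<open>coprime m N\<close> by (meson coprime_common_divisor)
      then show False using pr[OF p] by auto
    qed
  qed
  have pf: "prime_factors m = Q"
    unfolding m using fin pr by (intro prime_factors_prod_primes) auto
  have vmin: "v_min a v m = Min ((\<lambda>p. v (a p - 2)) ` Q)" by (simp add: v_min_def pf)
  have L: "v (twisted_L a (tchar D) 1 / of_real (period_sgn (tchar D) \<Omega>p \<Omega>m)) = v (norm_sum D) - 1" if D: "good D" for D
  proof -
    have D': "finite D" "\<And>p. p \<in> D \<Longrightarrow> prime p \<and> odd p" using D by (auto simp: good_def)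
    interpret ch: primitive_quadratic_character "4 * int (\<Prod>D)" "tchar D"
      by (rule tchar_primitive[OF D'])
    \<comment> \<open>The statement divides by a real period, whereas \<open>period D\<close>
      carries a factor \<open>\<i>\<close> for odd characters; \<open>u\<close> is the quotient of
      the two.\<close>
    define u where "u = (if even_char D then 1 else \<i>)"
    have per: "period D = u * of_real (period_sgn (tchar D) \<Omega>p \<Omega>m)"
      by (simp add: period_def u_def period_sgn_def even_char_def)
    have p0: "period_sgn (tchar D) \<Omega>p \<Omega>m \<noteq> 0" using omega_pos by (simp add: period_sgn_def)
    have "twisted_L a (tchar D) 1 = char_sum D / ch.gauss 1"
      unfolding char_sum_def by (rule twisted_L_value) unfold_locales
    also have "char_sum D = norm_sum D * u * of_real (period_sgn (tchar D) \<Omega>p \<Omega>m)"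
      using p0 by (simp add: norm_sum_def per u_def)
    finally have "twisted_L a (tchar D) 1 / of_real (period_sgn (tchar D) \<Omega>p \<Omega>m) = norm_sum D * u / ch.gauss 1"
      using p0 by simp
    also have "v \<dots> = v (norm_sum D) - 1"
    proof (rule v_twisted_quotient[OF norm_sum_rat[OF D]])
      show "u\<^sup>2 = 1 \<or> u\<^sup>2 = - 1" by (simp add: u_def)
      show "(ch.gauss 1)\<^sup>2 = of_int (tchar D (-1) * (4 * int (\<Prod>D)))"
        unfolding ch.gauss_square by simp
      show "tchar D (-1) \<in> {1, -1}" using good_minus_1[OF D] by simp
      have "odd (\<Prod>D)" using D' by (auto simp: even_prod_iff)
      then show "odd (int (\<Prod>D))" by (simp del: of_nat_prod)
    qed
    finally show ?thesis .
  qed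
  have qM: "quad_char M = tchar Q" unfolding \<open>M = 4 * m\<close> m using fin pr by (intro quad_char_4_times) auto
  have q4: "quad_char 4 = tchar {}" using quad_char_4_times[of "{}"] by simp
  have sgn4: "period_sgn (tchar {}) \<Omega>p \<Omega>m = \<Omega>m" by (simp add: period_sgn_def tchar_def chi4_def)
  define VM where "VM = v (twisted_L a (quad_char M) 1 / of_real (period_sgn (quad_char M) \<Omega>p \<Omega>m))"
  define V4 where "V4 = v (twisted_L a (quad_char 4) 1 / of_real \<Omega>m)"
  have VM: "VM = v (norm_sum Q) - 1" unfolding VM_def qM by (rule L[OF gQ])
  have V4: "V4 = v (norm_sum {}) - 1" using L[OF good_empty] by (simp add: V4_def q4 sgn4)
  have V4_0: "0 \<le> V4" unfolding V4 using v_norm_sum_empty by (cases "v (norm_sum {})") (auto simp: one_ereal_def)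
  define \<delta> where "\<delta> = v_min a v m"
  have S: "v (a p - 2) \<in> {0, 1, 2}" if "p \<in> Q" ?all for p
    using that by (auto simp: Q_def S_all_def S_sgn_def zero_ereal_def one_ereal_def)
  have S_leg: "Legendre (-1) (int p) = 1"
    if "p \<in> Q" ?plus for p
  proof -
    have "quad_char p (-1) = 1" using that by (auto simp: Q_def S_sgn_def)
    moreover have "\<not> 4 dvd p" using pr[OF that(1)] by auto
    ultimately show ?thesis using pr[OF that(1)] by (simp add: quad_char_def prime_prime_factors)
  qed
  have S_plus_all: ?all
    if ?plus
    using that by (auto simp: S_all_def)
  have \<delta>_le: "\<delta> \<le> v (a p - 2)" if "p \<in> Q" for p
    unfolding \<delta>_def vmin using that fin by (intro Min_le) auto
  have \<delta>_in: "\<delta> \<in> {0, 1, 2}" if all: ?all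
  proof -
    have "\<delta> \<in> (\<lambda>p. v (a p - 2)) ` Q" unfolding \<delta>_def vmin using fin ne by (intro Min_in) auto
    then show ?thesis using S[OF _ all] by auto
  qed
  have sub1: "c - 1 \<le> x - 1" if "c \<le> x" for c x :: ereal
    using that by (rule ereal_minus_mono) simp
  have nonneg: "0 \<le> v (a p - 2)" if "p \<in> Q" ?all for p
    using S[OF that] by auto
  \<comment> \<open>A minimum of values in {0, 1, 2} that is not 0 is at least 1.\<close>
  have pos: "1 \<le> v (a p - 2)" if "p \<in> Q" "\<delta> \<noteq> 0" ?all for p
    using \<delta>_in[OF that(3)] \<delta>_le[OF that(1)] that(2) by (auto intro: order_trans[of 1 2])
  have A: "w_ind a v m * ereal (of_nat r) +
          Min {- 1 + kdelta \<delta> 0, - 1 + kdelta \<delta> 0 + v (modular_L a 1 / of_real \<Omega>p), V4 + kdelta \<delta> 2} \<le> VM"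
    if all: ?all
  proof -
    \<comment> \<open>The minimum is at most its first entry, so it suffices to reach that one:
      \<open>norm_sum Q\<close> has valuation at least 1 if \<open>\<delta> = 0\<close> and at least
      \<open>r\<close> otherwise, and the Gauss sum takes away 1.\<close>
    have "Min {- 1 + kdelta \<delta> 0, - 1 + kdelta \<delta> 0 + v (modular_L a 1 / of_real \<Omega>p), V4 + kdelta \<delta> 2} \<le> - 1 + kdelta \<delta> 0"
      by (rule Min_le) auto
    then have "w_ind a v m * ereal (of_nat r) +
          Min {- 1 + kdelta \<delta> 0, - 1 + kdelta \<delta> 0 + v (modular_L a 1 / of_real \<Omega>p), V4 + kdelta \<delta> 2}
        \<le> w_ind a v m * ereal (of_nat r) + (- 1 + kdelta \<delta> 0)"
      by (rule add_left_mono)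
    also have "\<dots> \<le> VM"
    proof (cases "\<delta> = 0")
      case True
      have "1 \<le> v (norm_sum Q)" using nonneg all by (intro v_norm_sum_ge_1 gQ)
      then have "1 - 1 \<le> VM" unfolding VM by (rule sub1)
      then show ?thesis using True by (simp add: w_ind_def \<delta>_def[symmetric] kdelta_def one_ereal_def zero_ereal_def)
    next
      case False
      have "ereal (card Q) \<le> v (norm_sum Q)" using pos False all by (intro v_norm_sum_ge_card gQ)
      then have "ereal (card Q) - 1 \<le> VM" unfolding VM by (rule sub1)
      then show ?thesis using False by (simp add: w_ind_def \<delta>_def[symmetric] kdelta_def card one_ereal_def)
    qed
    finally show ?thesis .
  qed
  have B: "w_ind a v m * ereal (of_nat r) + Min {kdelta \<delta> 0, V4 + kdelta \<delta> 2} \<le> VM"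
    if plus: ?plus
  proof (cases "\<delta> = 0")
    case True
    note all = S_plus_all[OF plus]
    have "min 2 (v (norm_sum {})) \<le> v (norm_sum Q)"
      using nonneg all S_leg plus by (intro v_norm_sum_ge_min gQ)
    then have "min 2 (v (norm_sum {})) - 1 \<le> VM" unfolding VM by (rule sub1)
    \<comment> \<open>The shift by the Gauss sum turns the bound 2 into the entry
      \<open>kdelta 0 0 = 1\<close> and the base case into \<open>V4\<close>.\<close>
    moreover have "min 2 (v (norm_sum {})) - 1 = min 1 V4"
      unfolding V4 by (cases "v (norm_sum {})") (auto simp: one_ereal_def min_def)
    ultimately show ?thesis using True by (simp add: w_ind_def \<delta>_def[symmetric] kdelta_def)
  next
    case False
    note all = S_plus_all[OF plus]
    \<comment> \<open>The first entry is now 0, so the claim reduces to \<open>r \<le> VM\<close>: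
      the extra factor 2 from the symmetry offsets the Gauss sum.\<close>
    have "Min {kdelta \<delta> 0, V4 + kdelta \<delta> 2} \<le> 0" using False by (simp add: kdelta_def)
    then have "w_ind a v m * ereal (of_nat r) + Min {kdelta \<delta> 0, V4 + kdelta \<delta> 2} \<le> w_ind a v m * ereal (of_nat r) + 0"
      by (rule add_left_mono)
    also have "\<dots> = ereal (card Q) + 1 - 1"
      using False by (simp add: w_ind_def \<delta>_def[symmetric] card one_ereal_def)
    also have "\<dots> \<le> VM"
      unfolding VM using pos False all S_leg plus by (intro sub1 v_norm_sum_ge_Suc_card gQ)
    finally show ?thesis .
  qed
  have C: "VM = w_ind a v m * ereal (of_nat r) + Min {kdelta \<delta> 0, V4 + kdelta \<delta> 2}"
    if plus: "\<forall>i\<in>{1..r}. q i \<in> S_plus N a v 0" and zero: "V4 = 0"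
  proof -
    have v0: "v (a p - 2) = 0" if "p \<in> Q" for p
      using that plus by (auto simp: Q_def S_sgn_def zero_ereal_def)
    have "(\<lambda>p. v (a p - 2)) ` Q = {0}" using v0 ne by auto
    then have \<delta>: "\<delta> = 0" by (simp add: \<delta>_def vmin)
    have "v (norm_sum {}) = 1"
      using zero unfolding V4 by (cases "v (norm_sum {})") (auto simp: one_ereal_def)
    moreover have "Legendre (-1) (int p) = 1" if "p \<in> Q" for p
      using that plus by (intro S_leg) auto
    ultimately have "v (norm_sum Q) = 1"
      using v_norm_sum_eq_1[OF gQ v0] by blast
    then show ?thesis
      using \<delta> zero by (simp add: VM w_ind_def \<delta>_def[symmetric] kdelta_def one_ereal_def)
  qed
  show ?thesis
  proof (intro conjI impI, goal_cases)
    case 1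
    then show ?case by (rule A[unfolded VM_def V4_def \<delta>_def])
  next
    case 2
    then show ?case by (rule B[unfolded VM_def V4_def \<delta>_def])
  next
    case 3
    then show ?case by (elim conjE) (rule C[unfolded VM_def V4_def \<delta>_def])
  qed
qed

end
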